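(* Let $K$ be a commutative ring and $n\ge4$. The group $\Sigma'$ is a unipotent affine group over $K$ of dimension $$\dim(\Sigma')=\sum_{s=1}^{[\frac{n-1}2]}\left(n\binom{n-1}{2s}-\binom n{2s}\right)=\sum_{s=1}^{[\frac{n-1}2]}(n-2s-1)\binom n{2s}=\begin{cases}(n-2)2^{n-2}-n+2&\text{if }n\text{ is even},\\(n-2)2^{n-2}-n+1&\text{if }n\text{ is odd},\end{cases}$$ over $K$, i.e. the algebra of regular functions on $\Sigma'$ is a polynomial algebra over the ring $K$ in $\dim(\Sigma')$ variables.
   Context: $\Lambda_n=\Lambda_n(K)$ is the Grassmann $K$-algebra generated freely over $K$ by $x_1,\dots,x_n$ subject to $x_i^2=0$, $x_ix_j=-x_jx_i$ ($i\ne j$); it is free over $K$ with basis $x^\alpha=x_{i_1}\cdots x_{i_k}$, $\alpha=\{i_1<\dots<i_k\}$, graded by $|\alpha|$, with components $\Lambda_{n,d}$; $\mathfrak m=\bigoplus_{d\ge1}\Lambda_{n,d}$; $\Lambda_n^{od}$ is the sum of the odd degree components. $\Gamma$ is the group of $K$-algebra automorphisms $\sigma$ of $\Lambda_n$ with $\sigma(x_i)-x_i\in\Lambda_n^{od}\cap\mathfrak m^3$ for all $i$. The left skew derivation $\partial/\partial x_j$ is the $K$-linear map with $\frac{\partial x_k}{\partial x_j}=\delta_{jk}$ and $\frac{\partial (ab)}{\partial x_j}=\frac{\partial a}{\partial x_j}b+(-1)^i a\frac{\partial b}{\partial x_j}$ for $a\in\Lambda_{n,i}$. For $\sigma\in\Gamma$,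 $\mathcal J(\sigma)=\det(\partial\sigma(x_i)/\partial x_j)$; $\Sigma=\{\sigma\in\Gamma\mid\mathcal J(\sigma)=1\}$ is the Jacobian group, and $\Sigma'=\{\sigma\in\Sigma\mid\sigma(x_1)\in(x_1),\dots,\sigma(x_n)\in(x_n)\}$, where $(x_i)$ is the ideal generated by $x_i$; it is a subgroup of $\Sigma$. $[\cdot]$ is the integer part. $\Gamma$ is an algebraic group over $K$, an affine space with coordinates the coefficients of the elements $\sigma(x_i)-x_i$, and $\Sigma'$ is the closed subgroup given by polynomial equations over $K$ in these coordinates (understood compatibly with replacing $K$ by commutative $K$-algebras). An algebraic group over $K$ is called affine of dimension $d$ if its algebra of regular functions is a polynomial algebra over $K$ in $d$ variables. *)

theory Defs
  imports
    "HOL-Library.Poly_Mapping"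
    "HOL-Library.FuncSet"
    "HOL-Combinatorics.Permutations"
    "HOL-Algebra.QuotRing"
    "HOL-Algebra.Ideal_Product"
    "HOL-Algebra.Bij"
    "HOL-Algebra.Algebraic_Closure_Type"
begin

section \<open>The Grassmann algebra\<close>

text \<open>
  The generators are indexed by a finite linearly ordered type \<open>'n\<close> of cardinality \<open>n\<close>. An element is
  the family of its coefficients in the basis \<open>x\<^sup>\<alpha>\<close>, \<open>\<alpha>\<close> a subset of the index type. For disjoint
  \<open>\<alpha>\<close>, \<open>\<beta>\<close> one has \<open>x\<^sup>\<alpha> x\<^sup>\<beta> = \<plusminus> x\<^bsup>\<alpha> \<union> \<beta>\<^esup>\<close>, the sign being the parity of the number of pairs in
  \<open>\<alpha> \<times> \<beta>\<close> that are out of order; otherwise the product is \<open>0\<close>.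
\<close>

typedef ('n, 'k) grassmann = "UNIV :: ('n set \<Rightarrow> 'k) set"
  morphisms gcoeff Grassmann by simp

setup_lifting type_definition_grassmann

lemma grassmann_eqI: "(\<And>\<alpha>. gcoeff a \<alpha> = gcoeff b \<alpha>) \<Longrightarrow> a = b"
  by (metis ext gcoeff_inject)

definition gsign :: "'n::linorder set \<Rightarrow> 'n set \<Rightarrow> 'k::comm_ring_1" where
  "gsign \<alpha> \<beta> = (- 1) ^ card {(i, j). i \<in> \<alpha> \<and> j \<in> \<beta> \<and> j < i}"

instantiation grassmann :: ("{finite, linorder}", comm_ring_1) ring_1
begin

lift_definition zero_grassmann :: "('a, 'b) grassmann" is "\<lambda>_. 0" .
lift_definition one_grassmann :: "('a, 'b) grassmann" is "\<lambda>\<alpha>. if \<alpha> = {} then 1 else 0" .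
lift_definition plus_grassmann :: "('a, 'b) grassmann \<Rightarrow> ('a, 'b) grassmann \<Rightarrow> ('a, 'b) grassmann"
  is "\<lambda>f g \<alpha>. f \<alpha> + g \<alpha>" .
lift_definition minus_grassmann :: "('a, 'b) grassmann \<Rightarrow> ('a, 'b) grassmann \<Rightarrow> ('a, 'b) grassmann"
  is "\<lambda>f g \<alpha>. f \<alpha> - g \<alpha>" .
lift_definition uminus_grassmann :: "('a, 'b) grassmann \<Rightarrow> ('a, 'b) grassmann"
  is "\<lambda>f \<alpha>. - f \<alpha>" .
lift_definition times_grassmann :: "('a, 'b) grassmann \<Rightarrow> ('a, 'b) grassmann \<Rightarrow> ('a, 'b) grassmann"
  is "\<lambda>f g \<gamma>. \<Sum>\<alpha>\<in>Pow \<gamma>. gsign \<alpha> (\<gamma> - \<alpha>) * f \<alpha> * g (\<gamma> - \<alpha>)" .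

lemma gsign_Un_right:
  fixes \<alpha> \<beta> \<gamma> :: "'a::{finite,linorder} set"
  assumes "\<beta> \<inter> \<gamma> = {}"
  shows "gsign \<alpha> (\<beta> \<union> \<gamma>) = (gsign \<alpha> \<beta> * gsign \<alpha> \<gamma> :: 'c::comm_ring_1)"
proof -
  have "{(i, j). i \<in> \<alpha> \<and> j \<in> \<beta> \<union> \<gamma> \<and> j < i} =
      {(i, j). i \<in> \<alpha> \<and> j \<in> \<beta> \<and> j < i} \<union> {(i, j). i \<in> \<alpha> \<and> j \<in> \<gamma> \<and> j < i}" by auto
  then have "card {(i, j). i \<in> \<alpha> \<and> j \<in> \<beta> \<union> \<gamma> \<and> j < i} =
      card {(i, j). i \<in> \<alpha> \<and> j \<in> \<beta> \<and> j < i} + card {(i, j). i \<in> \<alpha> \<and> j \<in> \<gamma> \<and> j < i}"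
    using assms by (simp only:) (rule card_Un_disjoint, auto)
  then show ?thesis by (simp add: gsign_def power_add)
qed

lemma gsign_Un_left:
  fixes \<alpha> \<beta> \<gamma> :: "'a::{finite,linorder} set"
  assumes "\<alpha> \<inter> \<beta> = {}"
  shows "gsign (\<alpha> \<union> \<beta>) \<gamma> = (gsign \<alpha> \<gamma> * gsign \<beta> \<gamma> :: 'c::comm_ring_1)"
proof -
  have "{(i, j). i \<in> \<alpha> \<union> \<beta> \<and> j \<in> \<gamma> \<and> j < i} =
      {(i, j). i \<in> \<alpha> \<and> j \<in> \<gamma> \<and> j < i} \<union> {(i, j). i \<in> \<beta> \<and> j \<in> \<gamma> \<and> j < i}" by auto
  then have "card {(i, j). i \<in> \<alpha> \<union> \<beta> \<and> j \<in> \<gamma> \<and> j < i} =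
      card {(i, j). i \<in> \<alpha> \<and> j \<in> \<gamma> \<and> j < i} + card {(i, j). i \<in> \<beta> \<and> j \<in> \<gamma> \<and> j < i}"
    using assms by (simp only:) (rule card_Un_disjoint, auto)
  then show ?thesis by (simp add: gsign_def power_add)
qed

lemma gsign_empty [simp]: "gsign {} \<alpha> = 1" "gsign \<alpha> {} = 1"
  by (auto simp: gsign_def)

lemma grassmann_mult_assoc: "(a * b) * c = a * (b * c)" for a b c :: "('a, 'b) grassmann"
proof (rule grassmann_eqI)
  fix \<gamma> :: "'a set"
  have "gcoeff (a * b * c) \<gamma> = (\<Sum>\<delta>\<in>Pow \<gamma>. \<Sum>\<alpha>\<in>Pow \<delta>.
      gsign \<delta> (\<gamma> - \<delta>) * (gsign \<alpha> (\<delta> - \<alpha>) * gcoeff a \<alpha> * gcoeff b (\<delta> - \<alpha>)) * gcoeff c (\<gamma> - \<delta>))"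
    by (simp add: times_grassmann.rep_eq sum_distrib_left sum_distrib_right)
  also have "\<dots> = (\<Sum>(\<delta>, \<alpha>)\<in>Sigma (Pow \<gamma>) Pow.
      gsign \<delta> (\<gamma> - \<delta>) * (gsign \<alpha> (\<delta> - \<alpha>) * gcoeff a \<alpha> * gcoeff b (\<delta> - \<alpha>)) * gcoeff c (\<gamma> - \<delta>))"
    by (rule sum.Sigma) auto
  also have "\<dots> = (\<Sum>(\<alpha>, \<beta>)\<in>Sigma (Pow \<gamma>) (\<lambda>\<alpha>. Pow (\<gamma> - \<alpha>)). gsign \<alpha> (\<gamma> - \<alpha>) * gcoeff a \<alpha> *
      (gsign \<beta> (\<gamma> - \<alpha> - \<beta>) * gcoeff b \<beta> * gcoeff c (\<gamma> - \<alpha> - \<beta>)))"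
  proof (rule sum.reindex_bij_witness[of _ "\<lambda>(\<alpha>, \<beta>). (\<alpha> \<union> \<beta>, \<alpha>)" "\<lambda>(\<delta>, \<alpha>). (\<alpha>, \<delta> - \<alpha>)"])
    fix p :: "'a set \<times> 'a set"
    assume "p \<in> Sigma (Pow \<gamma>) Pow"
    then obtain \<delta> \<alpha> where p: "p = (\<delta>, \<alpha>)" and sub: "\<alpha> \<subseteq> \<delta>" "\<delta> \<subseteq> \<gamma>" by auto
    define \<beta> \<epsilon> where "\<beta> = \<delta> - \<alpha>" and "\<epsilon> = \<gamma> - \<delta>"
    have eqs: "\<delta> = \<alpha> \<union> \<beta>" "\<gamma> - \<alpha> = \<beta> \<union> \<epsilon>" "\<gamma> - \<alpha> - \<beta> = \<epsilon>" "\<delta> - \<alpha> = \<beta>" "\<gamma> - \<delta> = \<epsilon>"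
      and disj: "\<alpha> \<inter> \<beta> = {}" "\<beta> \<inter> \<epsilon> = {}"
      using sub by (auto simp: \<beta>_def \<epsilon>_def)
    have "gsign \<delta> \<epsilon> * (gsign \<alpha> \<beta> * gcoeff a \<alpha> * gcoeff b \<beta>) * gcoeff c \<epsilon> =
        gsign \<alpha> (\<beta> \<union> \<epsilon>) * gcoeff a \<alpha> * (gsign \<beta> \<epsilon> * gcoeff b \<beta> * gcoeff c \<epsilon>)"
      unfolding eqs(1) gsign_Un_right[OF disj(2)] gsign_Un_left[OF disj(1)]
      by (simp add: ac_simps)
    then show "(case case p of (\<delta>, \<alpha>) \<Rightarrow> (\<alpha>, \<delta> - \<alpha>) of (\<alpha>, \<beta>) \<Rightarrow> gsign \<alpha> (\<gamma> - \<alpha>) * gcoeff a \<alpha> *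
        (gsign \<beta> (\<gamma> - \<alpha> - \<beta>) * gcoeff b \<beta> * gcoeff c (\<gamma> - \<alpha> - \<beta>))) = (case p of (\<delta>, \<alpha>) \<Rightarrow>
        gsign \<delta> (\<gamma> - \<delta>) * (gsign \<alpha> (\<delta> - \<alpha>) * gcoeff a \<alpha> * gcoeff b (\<delta> - \<alpha>)) * gcoeff c (\<gamma> - \<delta>))"
      unfolding p prod.case eqs(4,5) unfolding eqs(3) unfolding eqs(2) ..
  qed auto
  also have "\<dots> = (\<Sum>\<alpha>\<in>Pow \<gamma>. \<Sum>\<beta>\<in>Pow (\<gamma> - \<alpha>). gsign \<alpha> (\<gamma> - \<alpha>) * gcoeff a \<alpha> *
      (gsign \<beta> (\<gamma> - \<alpha> - \<beta>) * gcoeff b \<beta> * gcoeff c (\<gamma> - \<alpha> - \<beta>)))"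
    by (rule sum.Sigma[symmetric]) auto
  also have "\<dots> = gcoeff (a * (b * c)) \<gamma>"
    by (simp add: times_grassmann.rep_eq sum_distrib_left)
  finally show "gcoeff (a * b * c) \<gamma> = gcoeff (a * (b * c)) \<gamma>" .
qed

instance
proof
  fix a b c :: "('a, 'b) grassmann"
  show "a + b + c = a + (b + c)" "a + b = b + a" "0 + a = a" "- a + a = 0" "a - b = a + - b"
    by (transfer, simp add: algebra_simps)+
  show "a * b * c = a * (b * c)" by (rule grassmann_mult_assoc)
  show "(a + b) * c = a * c + b * c" "a * (b + c) = a * b + a * c"
    by (transfer, simp add: algebra_simps sum.distrib)+
  show "1 * a = a"
  proof (rule grassmann_eqI)
    fix \<gamma> :: "'a set"
    have "gcoeff (1 * a) \<gamma> = (\<Sum>\<alpha>\<in>Pow \<gamma>. if \<alpha> = {} then gcoeff a \<gamma> else 0)"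
      unfolding times_grassmann.rep_eq one_grassmann.rep_eq by (rule sum.cong) auto
    then show "gcoeff (1 * a) \<gamma> = gcoeff a \<gamma>" by simp
  qed
  show "a * 1 = a"
  proof (rule grassmann_eqI)
    fix \<gamma> :: "'a set"
    have "gcoeff (a * 1) \<gamma> = (\<Sum>\<alpha>\<in>Pow \<gamma>. if \<alpha> = \<gamma> then gcoeff a \<gamma> else 0)"
      unfolding times_grassmann.rep_eq one_grassmann.rep_eq by (rule sum.cong) auto
    then show "gcoeff (a * 1) \<gamma> = gcoeff a \<gamma>" by simp
  qed
  show "(0 :: ('a, 'b) grassmann) \<noteq> 1"
    by (transfer, metis zero_neq_one)
qed

end

lift_definition gscale :: "'k::comm_ring_1 \<Rightarrow> ('n, 'k) grassmann \<Rightarrow> ('n, 'k) grassmann"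
  is "\<lambda>c f \<alpha>. c * f \<alpha>" .

lift_definition gmonom :: "'n set \<Rightarrow> ('n, 'k::comm_ring_1) grassmann"
  is "\<lambda>\<alpha> \<beta>. if \<beta> = \<alpha> then 1 else 0" .

definition gvar :: "'n \<Rightarrow> ('n, 'k::comm_ring_1) grassmann" where
  "gvar i = gmonom {i}"

definition homogeneous :: "nat \<Rightarrow> ('n, 'k::comm_ring_1) grassmann set" where
  "homogeneous d = {a. \<forall>\<alpha>. gcoeff a \<alpha> \<noteq> 0 \<longrightarrow> card \<alpha> = d}"

definition odd_part :: "('n, 'k::comm_ring_1) grassmann set" where
  "odd_part = {a. \<forall>\<alpha>. gcoeff a \<alpha> \<noteq> 0 \<longrightarrow> odd (card \<alpha>)}"

definition max_ideal :: "('n, 'k::comm_ring_1) grassmann set" where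
  "max_ideal = {a. \<forall>\<alpha>. gcoeff a \<alpha> \<noteq> 0 \<longrightarrow> 1 \<le> card \<alpha>}"

definition max_ideal_cubed :: "('n::{finite,linorder}, 'k::comm_ring_1) grassmann set" where
  "max_ideal_cubed = ideal_prod ring_of_type_algebra max_ideal
     (ideal_prod ring_of_type_algebra max_ideal max_ideal)"

definition gvar_ideal :: "'n::{finite,linorder} \<Rightarrow> ('n, 'k::comm_ring_1) grassmann set" where
  "gvar_ideal i = genideal ring_of_type_algebra {gvar i}"

lemma gvar_square: "gvar i * gvar i = (0 :: ('n::{finite,linorder}, 'k::comm_ring_1) grassmann)"
  unfolding gvar_def by (transfer, auto intro!: ext sum.neutral)

lemma gmonom_mult:
  "gmonom \<alpha> * gmonom \<beta> = (if \<alpha> \<inter> \<beta> = {} then gscale (gsign \<alpha> \<beta>) (gmonom (\<alpha> \<union> \<beta>)) else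
     (0 :: ('n::{finite,linorder}, 'k::comm_ring_1) grassmann))"
proof (rule grassmann_eqI)
  fix \<gamma> :: "'n set"
  have "gcoeff (gmonom \<alpha> * gmonom \<beta> :: ('n, 'k) grassmann) \<gamma> =
      (\<Sum>\<delta>\<in>Pow \<gamma>. if \<delta> = \<alpha> then (if \<gamma> - \<alpha> = \<beta> then gsign \<alpha> \<beta> else 0) else 0)"
    unfolding times_grassmann.rep_eq gmonom.rep_eq by (rule sum.cong) auto
  also have "\<dots> = (if \<alpha> \<subseteq> \<gamma> \<and> \<gamma> - \<alpha> = \<beta> then gsign \<alpha> \<beta> else 0)"
    by (subst sum.delta) auto
  also have "\<dots> = gcoeff (if \<alpha> \<inter> \<beta> = {} then gscale (gsign \<alpha> \<beta>) (gmonom (\<alpha> \<union> \<beta>)) else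
     (0 :: ('n, 'k) grassmann)) \<gamma>"
    by (auto simp: gscale.rep_eq gmonom.rep_eq zero_grassmann.rep_eq)
  finally show "gcoeff (gmonom \<alpha> * gmonom \<beta> :: ('n, 'k) grassmann) \<gamma> = \<dots>" .
qed

lemma gvar_anticommute:
  assumes "i \<noteq> j"
  shows "gvar i * gvar j = - (gvar j * gvar i :: ('n::{finite,linorder}, 'k::comm_ring_1) grassmann)"
proof (rule grassmann_eqI)
  fix \<gamma> :: "'n set"
  have 1: "gsign {i} {j} = (if j < i then - 1 else 1 :: 'k)" for i j :: 'n
  proof (cases "j < i")
    case True
    then have "{(a, b). a \<in> {i} \<and> b \<in> {j} \<and> b < a} = {(i, j)}" by auto
    with True show ?thesis by (simp add: gsign_def)
  next
    case False
    then have "{(a, b). a \<in> {i} \<and> b \<in> {j} \<and> b < a} = {}" by auto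
    with False show ?thesis by (simp only: gsign_def) simp
  qed
  show "gcoeff (gvar i * gvar j :: ('n, 'k) grassmann) \<gamma> = gcoeff (- (gvar j * gvar i)) \<gamma>"
    using assms unfolding gvar_def gmonom_mult
    by (auto simp: 1 gscale.rep_eq gmonom.rep_eq uminus_grassmann.rep_eq insert_commute)
qed

section \<open>Skew derivations and the Jacobian\<close>

definition klinear :: "(('n, 'k::comm_ring_1) grassmann \<Rightarrow> ('n::{finite,linorder}, 'k) grassmann) \<Rightarrow> bool" where
  "klinear D \<longleftrightarrow> (\<forall>a b. D (a + b) = D a + D b) \<and> (\<forall>c a. D (gscale c a) = gscale c (D a))"

definition is_left_skew_partial ::
  "'n::{finite,linorder} \<Rightarrow> (('n, 'k::comm_ring_1) grassmann \<Rightarrow> ('n, 'k) grassmann) \<Rightarrow> bool" where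
  "is_left_skew_partial j D \<longleftrightarrow> klinear D \<and>
     (\<forall>k. D (gvar k) = (if k = j then 1 else 0)) \<and>
     (\<forall>d. \<forall>a\<in>homogeneous d. \<forall>b. D (a * b) = D a * b + (- 1) ^ d * a * D b)"

definition gpartial ::
  "'n::{finite,linorder} \<Rightarrow> ('n, 'k::comm_ring_1) grassmann \<Rightarrow> ('n, 'k) grassmann" where
  "gpartial j = (THE D. is_left_skew_partial j D)"

text \<open>The description defining \<^const>\<open>gpartial\<close> is satisfied by exactly one map.\<close>

definition tsign :: "'n::linorder \<Rightarrow> 'n set \<Rightarrow> 'k::comm_ring_1" where
  "tsign j \<alpha> = (- 1) ^ card {k \<in> \<alpha>. k < j}"

lift_definition gpartial_explicit ::
  "'n::linorder \<Rightarrow> ('n, 'k::comm_ring_1) grassmann \<Rightarrow> ('n, 'k) grassmann"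
  is "\<lambda>j f \<alpha>. if j \<in> \<alpha> then 0 else tsign j \<alpha> * f (insert j \<alpha>)" .

lemma gsign_singleton_right: "gsign {j} \<beta> = (tsign j \<beta> :: 'k::comm_ring_1)"
proof -
  have "{(a, b). a \<in> {j} \<and> b \<in> \<beta> \<and> b < a} = Pair j ` {k \<in> \<beta>. k < j}" by auto
  then show ?thesis by (simp add: gsign_def tsign_def card_image inj_on_def)
qed

lemma gsign_singleton_left:
  fixes \<alpha> :: "'n::{finite,linorder} set"
  assumes "j \<notin> \<alpha>"
  shows "gsign \<alpha> {j} = (- 1) ^ card \<alpha> * (tsign j \<alpha> :: 'k::comm_ring_1)"
proof -
  have "{(a, b). a \<in> \<alpha> \<and> b \<in> {j} \<and> b < a} = (\<lambda>k. (k, j)) ` {k \<in> \<alpha>. j < k}" by auto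
  then have 1: "gsign \<alpha> {j} = ((- 1) ^ card {k \<in> \<alpha>. j < k} :: 'k)"
    by (simp add: gsign_def card_image inj_on_def)
  have "\<alpha> = {k \<in> \<alpha>. k < j} \<union> {k \<in> \<alpha>. j < k}"
    using assms by (auto simp: not_less order_less_le)
  then have "card \<alpha> = card ({k \<in> \<alpha>. k < j} \<union> {k \<in> \<alpha>. j < k})" by simp
  also have "\<dots> = card {k \<in> \<alpha>. k < j} + card {k \<in> \<alpha>. j < k}"
    by (rule card_Un_disjoint) auto
  finally have "card \<alpha> = card {k \<in> \<alpha>. k < j} + card {k \<in> \<alpha>. j < k}" .
  then show ?thesis
    unfolding 1 tsign_def by (simp add: power_add ac_simps flip: power_mult_distrib)
qed

lemma tsign_Un:
  fixes \<alpha> \<beta> :: "'n::{finite,linorder} set"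
  assumes "\<alpha> \<inter> \<beta> = {}"
  shows "tsign j (\<alpha> \<union> \<beta>) = (tsign j \<alpha> * tsign j \<beta> :: 'k::comm_ring_1)"
  using gsign_Un_right[OF assms, of "{j}"] by (simp add: gsign_singleton_right)

lemma tsign_square [simp]: "tsign j \<alpha> * tsign j \<alpha> = (1 :: 'k::comm_ring_1)"
  by (simp add: tsign_def flip: power_add)

lemma tsign_square' [simp]: "tsign j \<alpha> * (tsign j \<alpha> * z) = (z :: 'k::comm_ring_1)"
  by (simp flip: mult.assoc)

lemma is_left_skew_partial_explicit:
  "is_left_skew_partial j
     (gpartial_explicit j :: ('n::{finite,linorder}, 'k::comm_ring_1) grassmann \<Rightarrow> _)"
  unfolding is_left_skew_partial_def
proof (intro conjI allI ballI)
  show "klinear (gpartial_explicit j :: ('n, 'k) grassmann \<Rightarrow> _)"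
    unfolding klinear_def by (intro conjI allI; transfer) (auto simp: algebra_simps)
next
  fix k
  show "gpartial_explicit j (gvar k) = (if k = j then 1 else 0 :: ('n, 'k) grassmann)"
    by (rule grassmann_eqI)
      (auto simp: gpartial_explicit.rep_eq gvar_def gmonom.rep_eq one_grassmann.rep_eq
        zero_grassmann.rep_eq tsign_def doubleton_eq_iff)
next
  fix d :: nat and a b :: "('n, 'k) grassmann"
  assume "a \<in> homogeneous d"
  then have hom: "(- 1) ^ d * gcoeff a \<alpha> = (- 1) ^ card \<alpha> * gcoeff a \<alpha>" for \<alpha>
    by (cases "gcoeff a \<alpha> = 0") (auto simp: homogeneous_def)
  have scale: "(- 1) ^ d * a = gscale ((- 1) ^ d) a" 
    by (rule grassmann_eqI, cases "even d") (auto simp: gscale.rep_eq uminus_grassmann.rep_eq)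
  let ?D = "gpartial_explicit j :: ('n, 'k) grassmann \<Rightarrow> _"
  show "?D (a * b) = ?D a * b + (- 1) ^ d * a * ?D b"
  proof (rule grassmann_eqI)
    fix \<gamma> :: "'n set"
    have rhs: "gcoeff (?D a * b + (- 1) ^ d * a * ?D b) \<gamma> =
        (\<Sum>\<alpha>\<in>Pow \<gamma>. gsign \<alpha> (\<gamma> - \<alpha>) * gcoeff (?D a) \<alpha> * gcoeff b (\<gamma> - \<alpha>)) +
        (\<Sum>\<alpha>\<in>Pow \<gamma>. gsign \<alpha> (\<gamma> - \<alpha>) * ((- 1) ^ card \<alpha> * gcoeff a \<alpha>) * gcoeff (?D b) (\<gamma> - \<alpha>))"
      unfolding scale plus_grassmann.rep_eq times_grassmann.rep_eq gscale.rep_eq hom ..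
    show "gcoeff (?D (a * b)) \<gamma> = gcoeff (?D a * b + (- 1) ^ d * a * ?D b) \<gamma>"
    proof (cases "j \<in> \<gamma>")
      case False
      have img: "Pow (insert j \<gamma>) = Pow \<gamma> \<union> insert j ` Pow \<gamma>" by (rule Pow_insert)
      have "gcoeff (?D (a * b)) \<gamma> = tsign j \<gamma> *
          (\<Sum>\<alpha>\<in>Pow (insert j \<gamma>). gsign \<alpha> (insert j \<gamma> - \<alpha>) * gcoeff a \<alpha> * gcoeff b (insert j \<gamma> - \<alpha>))"
        using False by (simp add: gpartial_explicit.rep_eq times_grassmann.rep_eq)
      also have "\<dots> = tsign j \<gamma> *
          ((\<Sum>\<alpha>\<in>Pow \<gamma>. gsign \<alpha> (insert j \<gamma> - \<alpha>) * gcoeff a \<alpha> * gcoeff b (insert j \<gamma> - \<alpha>)) +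
           (\<Sum>\<alpha>\<in>insert j ` Pow \<gamma>. gsign \<alpha> (insert j \<gamma> - \<alpha>) * gcoeff a \<alpha> * gcoeff b (insert j \<gamma> - \<alpha>)))"
        unfolding img by (subst sum.union_disjoint) (use False in auto)
      also have "(\<Sum>\<alpha>\<in>insert j ` Pow \<gamma>. gsign \<alpha> (insert j \<gamma> - \<alpha>) * gcoeff a \<alpha> * gcoeff b (insert j \<gamma> - \<alpha>)) =
          (\<Sum>\<alpha>\<in>Pow \<gamma>. gsign (insert j \<alpha>) (insert j \<gamma> - insert j \<alpha>) * gcoeff a (insert j \<alpha>) *
            gcoeff b (insert j \<gamma> - insert j \<alpha>))"
        by (subst sum.reindex) (use False in \<open>auto simp: inj_on_def\<close>)
      also have "tsign j \<gamma> *
          ((\<Sum>\<alpha>\<in>Pow \<gamma>. gsign \<alpha> (insert j \<gamma> - \<alpha>) * gcoeff a \<alpha> * gcoeff b (insert j \<gamma> - \<alpha>)) + \<dots>) =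
          (\<Sum>\<alpha>\<in>Pow \<gamma>. gsign \<alpha> (\<gamma> - \<alpha>) * gcoeff (?D a) \<alpha> * gcoeff b (\<gamma> - \<alpha>)) +
          (\<Sum>\<alpha>\<in>Pow \<gamma>. gsign \<alpha> (\<gamma> - \<alpha>) * ((- 1) ^ card \<alpha> * gcoeff a \<alpha>) * gcoeff (?D b) (\<gamma> - \<alpha>))"
        unfolding distrib_left sum_distrib_left
      proof (subst add.commute, rule arg_cong2[where f = "(+)"]; rule sum.cong[OF refl])
        fix \<alpha> assume "\<alpha> \<in> Pow \<gamma>"
        then have sub: "\<alpha> \<subseteq> \<gamma>" by simp
        define \<beta> where "\<beta> = \<gamma> - \<alpha>"
        have eqs: "\<gamma> = \<alpha> \<union> \<beta>" "insert j \<gamma> - insert j \<alpha> = \<beta>" "insert j \<gamma> - \<alpha> = \<beta> \<union> {j}"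
            "insert j \<alpha> = \<alpha> \<union> {j}" "\<gamma> - \<alpha> = \<beta>"
          and disj: "\<alpha> \<inter> \<beta> = {}" "\<alpha> \<inter> {j} = {}" "\<beta> \<inter> {j} = {}" "j \<notin> \<alpha>" "j \<notin> \<beta>"
          using sub False by (auto simp: \<beta>_def)
        have ts: "tsign j \<gamma> = (tsign j \<alpha> * tsign j \<beta> :: 'k)"
          unfolding eqs(1) by (rule tsign_Un[OF disj(1)])
        show "tsign j \<gamma> * (gsign (insert j \<alpha>) (insert j \<gamma> - insert j \<alpha>) * gcoeff a (insert j \<alpha>) *
            gcoeff b (insert j \<gamma> - insert j \<alpha>)) =
            gsign \<alpha> (\<gamma> - \<alpha>) * gcoeff (?D a) \<alpha> * gcoeff b (\<gamma> - \<alpha>)"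
          unfolding eqs(2) eqs(5) ts gpartial_explicit.rep_eq unfolding eqs(4) gsign_Un_left[OF disj(2)]
            gsign_singleton_right
          using disj by (simp add: ac_simps)
        show "tsign j \<gamma> * (gsign \<alpha> (insert j \<gamma> - \<alpha>) * gcoeff a \<alpha> * gcoeff b (insert j \<gamma> - \<alpha>)) =
            gsign \<alpha> (\<gamma> - \<alpha>) * ((- 1) ^ card \<alpha> * gcoeff a \<alpha>) * gcoeff (?D b) (\<gamma> - \<alpha>)"
          unfolding eqs(3) eqs(5) ts gpartial_explicit.rep_eq gsign_Un_right[OF disj(3)]
            gsign_singleton_left[OF disj(4)]
          using disj by (simp add: ac_simps)
      qed
      finally show ?thesis unfolding rhs .
    next
      case True
      define \<delta> where "\<delta> = \<gamma> - {j}"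
      have \<gamma>: "\<gamma> = insert j \<delta>" and j: "j \<notin> \<delta>" using True by (auto simp: \<delta>_def)
      have "(\<Sum>\<alpha>\<in>Pow \<gamma>. gsign \<alpha> (\<gamma> - \<alpha>) * gcoeff (?D a) \<alpha> * gcoeff b (\<gamma> - \<alpha>)) =
          (\<Sum>\<alpha>\<in>Pow \<delta>. gsign \<alpha> (\<gamma> - \<alpha>) * gcoeff (?D a) \<alpha> * gcoeff b (\<gamma> - \<alpha>))"
        by (rule sum.mono_neutral_right) (auto simp: \<gamma> gpartial_explicit.rep_eq)
      moreover have "(\<Sum>\<alpha>\<in>Pow \<gamma>. gsign \<alpha> (\<gamma> - \<alpha>) * ((- 1) ^ card \<alpha> * gcoeff a \<alpha>) * gcoeff (?D b) (\<gamma> - \<alpha>)) =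
          (\<Sum>\<alpha>\<in>insert j ` Pow \<delta>. gsign \<alpha> (\<gamma> - \<alpha>) * ((- 1) ^ card \<alpha> * gcoeff a \<alpha>) * gcoeff (?D b) (\<gamma> - \<alpha>))"
        by (rule sum.mono_neutral_right) (auto simp: \<gamma> Pow_insert gpartial_explicit.rep_eq)
      moreover have "\<dots> = (\<Sum>\<alpha>\<in>Pow \<delta>. gsign (insert j \<alpha>) (\<gamma> - insert j \<alpha>) *
          ((- 1) ^ card (insert j \<alpha>) * gcoeff a (insert j \<alpha>)) * gcoeff (?D b) (\<gamma> - insert j \<alpha>))"
        by (subst sum.reindex) (use j in \<open>auto simp: inj_on_def\<close>)
      moreover have "(\<Sum>\<alpha>\<in>Pow \<delta>. gsign \<alpha> (\<gamma> - \<alpha>) * gcoeff (?D a) \<alpha> * gcoeff b (\<gamma> - \<alpha>)) +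
          (\<Sum>\<alpha>\<in>Pow \<delta>. gsign (insert j \<alpha>) (\<gamma> - insert j \<alpha>) *
          ((- 1) ^ card (insert j \<alpha>) * gcoeff a (insert j \<alpha>)) * gcoeff (?D b) (\<gamma> - insert j \<alpha>)) = 0"
        unfolding sum.distrib[symmetric]
      proof (rule sum.neutral, rule ballI)
        fix \<alpha> assume "\<alpha> \<in> Pow \<delta>"
        then have sub: "\<alpha> \<subseteq> \<delta>" by simp
        define \<beta> where "\<beta> = \<delta> - \<alpha>"
        have eqs: "\<gamma> - insert j \<alpha> = \<beta>" "\<gamma> - \<alpha> = \<beta> \<union> {j}" "insert j \<alpha> = \<alpha> \<union> {j}" "insert j \<beta> = \<beta> \<union> {j}"
          and disj: "\<alpha> \<inter> \<beta> = {}" "\<alpha> \<inter> {j} = {}" "\<beta> \<inter> {j} = {}" "j \<notin> \<alpha>" "j \<notin> \<beta>"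
          using sub j by (auto simp: \<beta>_def \<gamma>)
        have card: "card (\<alpha> \<union> {j}) = Suc (card \<alpha>)" using disj by simp
        have sq: "(- 1) ^ card \<alpha> * ((- 1) ^ card \<alpha> * z) = (z :: 'k)" for z
          by (simp flip: mult.assoc power_add)
        show "gsign \<alpha> (\<gamma> - \<alpha>) * gcoeff (?D a) \<alpha> * gcoeff b (\<gamma> - \<alpha>) +
          gsign (insert j \<alpha>) (\<gamma> - insert j \<alpha>) *
          ((- 1) ^ card (insert j \<alpha>) * gcoeff a (insert j \<alpha>)) * gcoeff (?D b) (\<gamma> - insert j \<alpha>) = 0"
          unfolding eqs(1) eqs(2) gpartial_explicit.rep_eq
          unfolding eqs(3,4) card gsign_Un_left[OF disj(2)] gsign_Un_right[OF disj(3)]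
            gsign_singleton_right gsign_singleton_left[OF disj(4)]
          using disj by (simp add: ac_simps sq)
      qed
      ultimately show ?thesis
        using True unfolding rhs by (simp add: gpartial_explicit.rep_eq)
    qed
  qed
qed

lemma gmonom_insert_Min:
  fixes \<alpha> :: "'n::{finite,linorder} set"
  assumes "\<And>k. k \<in> \<alpha> \<Longrightarrow> i < k"
  shows "gmonom (insert i \<alpha>) = (gvar i * gmonom \<alpha> :: ('n, 'k::comm_ring_1) grassmann)"
proof -
  have "{k \<in> \<alpha>. k < i} = {}" using assms by fastforce
  then have "gsign {i} \<alpha> = (1 :: 'k)" by (simp only: gsign_singleton_right tsign_def) simp
  moreover have "i \<notin> \<alpha>" using assms by blast
  ultimately show ?thesis
    by (simp add: gvar_def gmonom_mult) (simp add: gmonom_def gscale_def Grassmann_inverse)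
qed

lemma klinear_sum:
  assumes "klinear D" "finite A"
  shows "D (\<Sum>x\<in>A. gscale (c x) (f x)) = (\<Sum>x\<in>A. gscale (c x) (D (f x)))"
  using assms(2)
proof induction
  case empty
  have "D 0 + D 0 = D 0 + 0" using assms(1) unfolding klinear_def by (metis add.right_neutral)
  then show ?case by (metis sum.empty add_left_cancel)
next
  case (insert x F)
  then show ?case using assms(1) by (simp add: klinear_def)
qed

lemma gcoeff_sum: "gcoeff (\<Sum>x\<in>A. f x) \<alpha> = (\<Sum>x\<in>A. gcoeff (f x) \<alpha>)"
  by (induction A rule: infinite_finite_induct) (auto simp: zero_grassmann.rep_eq plus_grassmann.rep_eq)

lemma grassmann_expand:
  "a = (\<Sum>\<alpha>\<in>UNIV. gscale (gcoeff a \<alpha>) (gmonom \<alpha> :: ('n::{finite,linorder}, 'k::comm_ring_1) grassmann))"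
  by (rule grassmann_eqI) (simp add: gcoeff_sum gscale.rep_eq gmonom.rep_eq if_distrib cong: if_cong)

theorem ex1_is_left_skew_partial:
  "\<exists>!D :: ('n::{finite,linorder}, 'k::comm_ring_1) grassmann \<Rightarrow> _. is_left_skew_partial j D"
proof (rule ex1I[of _ "gpartial_explicit j"])
  show "is_left_skew_partial j (gpartial_explicit j :: ('n, 'k) grassmann \<Rightarrow> _)"
    by (rule is_left_skew_partial_explicit)
next
  fix D :: "('n, 'k) grassmann \<Rightarrow> ('n, 'k) grassmann"
  let ?E = "gpartial_explicit j :: ('n, 'k) grassmann \<Rightarrow> _"
  assume D: "is_left_skew_partial j D"
  have E: "is_left_skew_partial j ?E" by (rule is_left_skew_partial_explicit)
  have one: "F 1 = 0" if "is_left_skew_partial j F" for F :: "('n, 'k) grassmann \<Rightarrow> ('n, 'k) grassmann"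
  proof -
    have "(1 :: ('n, 'k) grassmann) \<in> homogeneous 0"
      by (simp add: homogeneous_def one_grassmann.rep_eq)
    then have "F (1 * 1) = F 1 * 1 + (- 1) ^ 0 * 1 * F 1"
      using that unfolding is_left_skew_partial_def by blast
    then show ?thesis by simp
  qed
  have hom1: "gvar i \<in> homogeneous 1" for i :: 'n
    by (simp add: homogeneous_def gvar_def gmonom.rep_eq)
  have monom: "D (gmonom \<alpha>) = ?E (gmonom \<alpha>)" for \<alpha> :: "'n set"
  proof (induction "card \<alpha>" arbitrary: \<alpha>)
    case 0
    then have "\<alpha> = {}" by simp
    moreover have "gmonom {} = (1 :: ('n, 'k) grassmann)" by transfer (rule refl)
    ultimately show ?case using one[OF D] one[OF E] by simp
  next
    case (Suc m)
    define i where "i = Min \<alpha>"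
    have ne: "\<alpha> \<noteq> {}" using Suc(2) by auto
    have i: "i \<in> \<alpha>" unfolding i_def using ne by (intro Min_in) auto
    have lt: "i < k" if "k \<in> \<alpha> - {i}" for k
      using that Min_le[of \<alpha> k] by (auto simp: i_def order_less_le)
    have eq: "gmonom \<alpha> = (gvar i * gmonom (\<alpha> - {i}) :: ('n, 'k) grassmann)"
      using gmonom_insert_Min[of "\<alpha> - {i}" i, OF lt] i by (simp add: insert_absorb)
    have "D (gmonom (\<alpha> - {i})) = ?E (gmonom (\<alpha> - {i}))"
      by (rule Suc(1)) (use Suc(2) i in simp)
    then show ?case
      using D E hom1[of i] unfolding eq is_left_skew_partial_def by metis
  qed
  show "D = ?E"
  proof
    fix a :: "('n, 'k) grassmann"
    have lin: "klinear D" "klinear ?E" using D E by (auto simp: is_left_skew_partial_def)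
    show "D a = ?E a"
      by (subst (1 2) grassmann_expand[of a]) (simp add: klinear_sum lin monom)
  qed
qed

text \<open>
  For the automorphisms considered here the entries of the Jacobian matrix are even, hence commute,
  so the order of the factors is irrelevant; the library determinant needs a commutative ring type.
\<close>

definition gjacobian ::
  "(('n::{finite,linorder}, 'k::comm_ring_1) grassmann \<Rightarrow> ('n, 'k) grassmann) \<Rightarrow> ('n, 'k) grassmann" where
  "gjacobian \<sigma> = (\<Sum>p | p permutes (UNIV :: 'n set). of_int (sign p) *
     prod_list (map (\<lambda>i. gpartial (p i) (\<sigma> (gvar i))) (sorted_list_of_set (UNIV :: 'n set))))"

section \<open>The groups of automorphisms\<close>

definition is_algebra_automorphism ::
  "(('n::{finite,linorder}, 'k::comm_ring_1) grassmann \<Rightarrow> ('n, 'k) grassmann) \<Rightarrow> bool" where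
  "is_algebra_automorphism \<sigma> \<longleftrightarrow>
     bij \<sigma> \<and> klinear \<sigma> \<and> \<sigma> 1 = 1 \<and> (\<forall>a b. \<sigma> (a * b) = \<sigma> a * \<sigma> b)"

definition Gamma_group ::
  "(('n::{finite,linorder}, 'k::comm_ring_1) grassmann \<Rightarrow> ('n, 'k) grassmann) set" where
  "Gamma_group = {\<sigma>. is_algebra_automorphism \<sigma> \<and>
     (\<forall>i. \<sigma> (gvar i) - gvar i \<in> odd_part \<inter> max_ideal_cubed)}"

definition Sigma_group ::
  "(('n::{finite,linorder}, 'k::comm_ring_1) grassmann \<Rightarrow> ('n, 'k) grassmann) set" where
  "Sigma_group = {\<sigma> \<in> Gamma_group. gjacobian \<sigma> = 1}"

definition Sigma'_group ::
  "(('n::{finite,linorder}, 'k::comm_ring_1) grassmann \<Rightarrow> ('n, 'k) grassmann) set" where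
  "Sigma'_group = {\<sigma> \<in> Sigma_group. \<forall>i. \<sigma> (gvar i) \<in> gvar_ideal i}"

section \<open>Polynomial algebras\<close>

type_synonym ('v, 'k) mpoly = "('v \<Rightarrow>\<^sub>0 nat) \<Rightarrow>\<^sub>0 'k"

definition Const :: "'k::comm_ring_1 \<Rightarrow> ('v, 'k) mpoly" where
  "Const c = Poly_Mapping.single 0 c"

definition Var :: "'v \<Rightarrow> ('v, 'k::comm_ring_1) mpoly" where
  "Var v = Poly_Mapping.single (Poly_Mapping.single v 1) 1"

definition poly_vars :: "('v, 'k::comm_ring_1) mpoly \<Rightarrow> 'v set" where
  "poly_vars p = (\<Union>m\<in>Poly_Mapping.keys p. Poly_Mapping.keys m)"

definition poly_eval ::
  "('k::comm_ring_1 \<Rightarrow> 'r::comm_ring_1) \<Rightarrow> ('v \<Rightarrow> 'r) \<Rightarrow> ('v, 'k) mpoly \<Rightarrow> 'r" where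
  "poly_eval \<phi> c p = (\<Sum>m\<in>Poly_Mapping.keys p. \<phi> (Poly_Mapping.lookup p m) *
     (\<Prod>v\<in>Poly_Mapping.keys m. c v ^ Poly_Mapping.lookup m v))"

definition poly_ring :: "'v set \<Rightarrow> ('v, 'k::comm_ring_1) mpoly ring" where
  "poly_ring V = ring_of_type_algebra \<lparr>carrier := {p. poly_vars p \<subseteq> V}\<rparr>"

text \<open>
  An affine group over \<open>'k\<close> is given by a set \<open>V\<close> of coordinates, an ideal \<open>I\<close> of \<open>K[V]\<close> (the
  algebra of regular functions being \<open>K[V]/I\<close>) and polynomials \<open>\<Delta>\<close> expressing the coordinates of a
  product \<open>gh\<close> in those of \<open>g\<close> (\<open>Inl\<close>) and \<open>h\<close> (\<open>Inr\<close>). It is affine of dimension \<open>d\<close> if \<open>K[V]/I\<close>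
  and \<open>K[t\<^sub>0, \<dots>, t\<^bsub>d-1\<^esub>]\<close> are isomorphic as \<open>K\<close>-algebras.
\<close>

definition is_affine_of_dim :: "'v set \<Rightarrow> ('v, 'k::comm_ring_1) mpoly set \<Rightarrow> nat \<Rightarrow> bool" where
  "is_affine_of_dim V I d \<longleftrightarrow>
     (\<exists>h \<in> ring_iso (poly_ring V Quot I) (poly_ring {..<d} :: (nat, 'k) mpoly ring).
        \<forall>c. h (I +>\<^bsub>poly_ring V\<^esub> Const c) = Const c)"

text \<open>
  The group is unipotent if it is isomorphic to a closed subgroup of the group of upper unitriangular
  \<open>N \<times> N\<close> matrices for some \<open>N\<close>. Such an embedding is a matrix of regular functions \<open>u r s\<close> that
  is unitriangular modulo \<open>I\<close>, is multiplicative, i.e. \<open>u(gh) = u(g) u(h)\<close> as regular functions on the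
  square of the group, and whose entries generate the algebra of regular functions.
\<close>

definition is_unipotent_group ::
  "'v set \<Rightarrow> ('v, 'k::comm_ring_1) mpoly set \<Rightarrow> ('v \<Rightarrow> ('v + 'v, 'k) mpoly) \<Rightarrow> bool" where
  "is_unipotent_group V I \<Delta> \<longleftrightarrow> (\<exists>N. \<exists>u :: nat \<Rightarrow> nat \<Rightarrow> ('v, 'k) mpoly.
     (\<forall>r<N. \<forall>s<N. u r s \<in> carrier (poly_ring V)) \<and>
     (\<forall>r<N. u r r - 1 \<in> I) \<and>
     (\<forall>r<N. \<forall>s<r. u r s \<in> I) \<and>
     (let left = poly_eval Const (\<lambda>v. Var (Inl v)); right = poly_eval Const (\<lambda>v. Var (Inr v)) in
       \<forall>r<N. \<forall>s<N. poly_eval Const \<Delta> (u r s) - (\<Sum>t<N. left (u r t) * right (u t s))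
         \<in> genideal (poly_ring (V <+> V)) (left ` I \<union> right ` I)) \<and>
     (\<forall>p \<in> carrier (poly_ring V). \<exists>q \<in> carrier (poly_ring ({..<N} \<times> {..<N})).
        p - poly_eval Const (\<lambda>(r, s). u r s) q \<in> I))"

section \<open>Regular functions\<close>

text \<open>
  The coordinate \<open>(i, \<beta>)\<close> on the group \<open>\<Gamma>\<close> is the coefficient of \<open>x\<^sup>\<beta>\<close> in \<open>\<sigma>(x\<^sub>i) - x\<^sub>i\<close>, and
  \<open>Gamma_elem c\<close> is the element with coordinates \<open>c\<close>. For \<open>c = Var\<close> it is the generic element of
  \<open>\<Gamma>\<close>, an endomorphism of the Grassmann algebra over the polynomial ring in the coordinates.
\<close>

definition Gamma_coords :: "('n::{finite,linorder} \<times> 'n set) set" where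
  "Gamma_coords = {(i, \<beta>). odd (card \<beta>) \<and> 3 \<le> card \<beta>}"

definition gcoord ::
  "(('n::{finite,linorder}, 'k::comm_ring_1) grassmann \<Rightarrow> ('n, 'k) grassmann) \<Rightarrow> 'n \<times> 'n set \<Rightarrow> 'k" where
  "gcoord \<sigma> = (\<lambda>(i, \<beta>). gcoeff (\<sigma> (gvar i) - gvar i) \<beta>)"

definition Gamma_elem ::
  "('n::{finite,linorder} \<times> 'n set \<Rightarrow> 'k::comm_ring_1) \<Rightarrow> ('n, 'k) grassmann \<Rightarrow> ('n, 'k) grassmann" where
  "Gamma_elem c a = (\<Sum>\<alpha>\<in>UNIV. gscale (gcoeff a \<alpha>) (prod_list (map
     (\<lambda>i. gvar i + (\<Sum>\<beta> | (i, \<beta>) \<in> Gamma_coords. gscale (c (i, \<beta>)) (gmonom \<beta>)))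
     (sorted_list_of_set \<alpha>))))"

definition Gamma_comult ::
  "'n::{finite,linorder} \<times> 'n set \<Rightarrow> (('n \<times> 'n set) + ('n \<times> 'n set), 'k::comm_ring_1) mpoly" where
  "Gamma_comult = gcoord (Gamma_elem (\<lambda>v. Var (Inl v)) \<circ> Gamma_elem (\<lambda>v. Var (Inr v)))"

text \<open>
  The equations of the subgroup \<open>\<Sigma>'\<close>: all coefficients of \<open>J(\<sigma>) - 1\<close>, and the coefficients of
  \<open>\<sigma>(x\<^sub>i)\<close> at the monomials not divisible by \<open>x\<^sub>i\<close>, for the generic \<open>\<sigma>\<close>.
\<close>

definition Sigma'_ideal :: "('n::{finite,linorder} \<times> 'n set, 'k::comm_ring_1) mpoly set" where
  "Sigma'_ideal = genideal (poly_ring Gamma_coords)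
     ({gcoeff (gjacobian (Gamma_elem Var) - 1) \<alpha> | \<alpha>. True} \<union>
      {gcoeff (Gamma_elem Var (gvar i)) \<alpha> | i \<alpha>. i \<notin> \<alpha>})"

end

theory Submission
  imports Defs "HOL-Analysis.Determinants"
begin

text \<open>
  The elements of \<open>\<Gamma>\<close> are the substitutions \<open>x\<^sub>i \<mapsto> f\<^sub>i\<close> with \<open>f\<^sub>i - x\<^sub>i\<close> odd of
  degree at least \<open>3\<close>. If \<open>\<sigma>(x\<^sub>i) \<in> (x\<^sub>i)\<close> for all \<open>i\<close>, the coefficient of \<open>J(\<sigma>)\<close> at
  \<open>x\<^sup>\<alpha>\<close>, \<open>|\<alpha>| = 2s\<close>, is \<open>\<Sum>\<^bsub>i \<notin> \<alpha>\<^esub> \<plusminus> c\<^bsub>i, \<alpha> \<union> {i}\<^esub>\<close> plus a polynomial in coordinates of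
  lower degree. Hence for each \<open>\<alpha> \<noteq> {1, \<dots>, n}\<close> the equation at \<open>\<alpha>\<close> can be solved for one chosen
  coordinate \<open>c\<^bsub>i, \<alpha> \<union> {i}\<^esub>\<close>, and the remaining coordinates are free. The equation at the top monomial
  (for even \<open>n\<close>) is a consequence of the others: the top coefficient of \<open>J(\<sigma>)\<^sup>-\<^sup>1\<close> vanishes by
  the change of variables formula for the Berezin integral.
\<close>

text \<open>The ring \<open>K\<close> is arbitrary. Nothing can be tested on points, 2 may be zero,
  and equality of functions on the group has to be shown modulo the ideal itself. Solving the
  equations therefore splits in two: existence gives a solution over a polynomial ring whose
  variables are the free coordinates, uniqueness is a congruence for the generic point. Together
  they exhibit the ideal as the kernel of a surjective evaluation map. The change of variables
  formula settles the top equation as follows: once the other coefficients of positive degree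
  vanish, J = 1 + c x^top has the inverse 1 - c x^top, whose top coefficient is -c. The condition
  that each x_i goes into its own ideal makes the formula elementary: the substitution factors into
  steps x_k to x_k u with u free of x_k, and such a step has Jacobian u. Equations at monomials of
  odd degree are void by parity. At a proper nonempty even \<alpha> with 2s elements there are n -
  2s coordinates, one of which is eliminated; this is the factor n - 2s - 1 in the
  dimension.\<close>

section \<open>Supports, degrees and parity\<close>

lemmas gcoeff_simps = zero_grassmann.rep_eq one_grassmann.rep_eq plus_grassmann.rep_eq
  minus_grassmann.rep_eq uminus_grassmann.rep_eq gscale.rep_eq gmonom.rep_eq gcoeff_sum

lemma gscale_add_left: "gscale (c + d) a = gscale c a + gscale d a"
  and gscale_gscale [simp]: "gscale c (gscale d a) = gscale (c * d) a"
  and gscale_one [simp]: "gscale 1 a = a"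
  and gscale_zero_left [simp]: "gscale 0 a = 0"
  and gscale_zero_right [simp]: "gscale c 0 = 0"
  and gscale_minus_left: "gscale (- c) a = - gscale c a"
  and gscale_diff_right: "gscale c (a - b) = gscale c a - gscale c b"
  for a b :: "('n::{finite,linorder}, 'k::comm_ring_1) grassmann"
  by (rule grassmann_eqI; simp add: gcoeff_simps algebra_simps)+

lemma gscale_sum_right: "gscale c (\<Sum>x\<in>A. f x) = (\<Sum>x\<in>A. gscale c (f x))"
  for f :: "'b \<Rightarrow> ('n::{finite,linorder}, 'k::comm_ring_1) grassmann"
  by (rule grassmann_eqI) (simp add: gcoeff_simps sum_distrib_left)

lemma gscale_mult_left [simp]: "gscale c a * b = gscale c (a * b)"
  and gscale_mult_right [simp]: "a * gscale c b = gscale c (a * b)"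
  for a b :: "('n::{finite,linorder}, 'k::comm_ring_1) grassmann"
  by (rule grassmann_eqI; simp add: gcoeff_simps times_grassmann.rep_eq sum_distrib_left ac_simps)+

lemma gmonom_empty: "gmonom {} = (1 :: ('n::{finite,linorder}, 'k::comm_ring_1) grassmann)"
  by (rule grassmann_eqI) (simp add: gcoeff_simps)

text \<open>Degree filtration, parity and membership in the ideal of a generator are all conditions
  on the support, so their closure properties can be proved once.\<close>

definition gsupp :: "'n set set \<Rightarrow> ('n, 'k::comm_ring_1) grassmann set" where
  "gsupp S = {a. \<forall>\<alpha>. gcoeff a \<alpha> \<noteq> 0 \<longrightarrow> \<alpha> \<in> S}"

lemma gsuppI: "(\<And>\<alpha>. \<alpha> \<notin> S \<Longrightarrow> gcoeff a \<alpha> = 0) \<Longrightarrow> a \<in> gsupp S"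
  by (auto simp: gsupp_def)

lemma gsuppD: "a \<in> gsupp S \<Longrightarrow> \<alpha> \<notin> S \<Longrightarrow> gcoeff a \<alpha> = 0"
  by (auto simp: gsupp_def)

lemma gsupp_mono: "a \<in> gsupp S \<Longrightarrow> S \<subseteq> T \<Longrightarrow> a \<in> gsupp T"
  by (auto simp: gsupp_def)

lemma gsupp_UNIV [simp]: "gsupp UNIV = UNIV"
  by (simp add: gsupp_def)

lemma gsupp_zero [simp]: "0 \<in> gsupp S"
  and gsupp_add: "a \<in> gsupp S \<Longrightarrow> b \<in> gsupp S \<Longrightarrow> a + b \<in> gsupp S"
  and gsupp_diff: "a \<in> gsupp S \<Longrightarrow> b \<in> gsupp S \<Longrightarrow> a - b \<in> gsupp S"
  and gsupp_uminus: "a \<in> gsupp S \<Longrightarrow> - a \<in> gsupp S"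
  and gsupp_gscale: "a \<in> gsupp S \<Longrightarrow> gscale c a \<in> gsupp S"
  for a b :: "('n::{finite,linorder}, 'k::comm_ring_1) grassmann"
  by (auto intro!: gsuppI simp: gcoeff_simps gsuppD[of a] gsuppD[of b])

lemma gsupp_sum: "(\<And>x. x \<in> A \<Longrightarrow> f x \<in> gsupp S) \<Longrightarrow> (\<Sum>x\<in>A. f x) \<in> gsupp S"
  for f :: "'b \<Rightarrow> ('n::{finite,linorder}, 'k::comm_ring_1) grassmann"
  by (induction A rule: infinite_finite_induct) (auto intro: gsupp_add)

lemma gsupp_of_int_mult: "a \<in> gsupp S \<Longrightarrow> of_int c * a \<in> gsupp S"
  for a :: "('n::{finite,linorder}, 'k::comm_ring_1) grassmann"
proof -
  assume a: "a \<in> gsupp S"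
  have nat: "of_nat m * a \<in> gsupp S" for m
    by (induction m) (auto simp: distrib_right intro: gsupp_add a)
  show ?thesis
    by (cases c) (use nat gsupp_uminus[OF nat] in \<open>auto simp del: of_nat_Suc\<close>)
qed

lemma gsupp_gmonom: "\<alpha> \<in> S \<Longrightarrow> gmonom \<alpha> \<in> gsupp S"
  by (auto intro!: gsuppI simp: gmonom.rep_eq)

lemma gsupp_mult:
  fixes a b :: "('n::{finite,linorder}, 'k::comm_ring_1) grassmann"
  assumes "a \<in> gsupp S" "b \<in> gsupp T"
    and U: "\<And>\<alpha> \<beta>. \<alpha> \<in> S \<Longrightarrow> \<beta> \<in> T \<Longrightarrow> \<alpha> \<inter> \<beta> = {} \<Longrightarrow> \<alpha> \<union> \<beta> \<in> U"
  shows "a * b \<in> gsupp U"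
proof (rule gsuppI)
  fix \<gamma> assume "\<gamma> \<notin> U"
  then have "gcoeff a \<alpha> * gcoeff b (\<gamma> - \<alpha>) = 0" if "\<alpha> \<subseteq> \<gamma>" for \<alpha>
    using U[of \<alpha> "\<gamma> - \<alpha>"] assms(1,2) that gsuppD[of a S \<alpha>] gsuppD[of b T "\<gamma> - \<alpha>"]
    by (cases "\<alpha> \<in> S"; cases "\<gamma> - \<alpha> \<in> T") (auto simp: Un_absorb1)
  then show "gcoeff (a * b) \<gamma> = 0"
    unfolding times_grassmann.rep_eq by (intro sum.neutral) (auto simp: mult.assoc)
qed

section \<open>Degree filtration and parity\<close>

definition gfil :: "nat \<Rightarrow> ('n, 'k::comm_ring_1) grassmann set" where
  "gfil k = gsupp {\<alpha>. k \<le> card \<alpha>}"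

definition gparity :: "nat \<Rightarrow> ('n, 'k::comm_ring_1) grassmann set" where
  "gparity d = gsupp {\<alpha>. even (card \<alpha>) = even d}"

lemma odd_part_eq: "odd_part = gparity 1"
  by (simp add: odd_part_def gparity_def gsupp_def)

text \<open>The slack in \<open>m \<le> k + l\<close> allows target degrees that are not literally
  sums.\<close>

lemma gfil_mult: "a \<in> gfil k \<Longrightarrow> b \<in> gfil l \<Longrightarrow> m \<le> k + l \<Longrightarrow> a * b \<in> gfil m"
  for a b :: "('n::{finite,linorder}, 'k::comm_ring_1) grassmann"
  unfolding gfil_def by (rule gsupp_mult) (auto simp: card_Un_disjoint)

lemma gparity_mult: "a \<in> gparity k \<Longrightarrow> b \<in> gparity l \<Longrightarrow> a * b \<in> gparity (k + l)"
  for a b :: "('n::{finite,linorder}, 'k::comm_ring_1) grassmann"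
  unfolding gparity_def by (rule gsupp_mult) (auto simp: card_Un_disjoint)

lemma gfil_0 [simp]: "a \<in> gfil 0"
  by (simp add: gfil_def)

lemma gfil_mono: "a \<in> gfil k \<Longrightarrow> l \<le> k \<Longrightarrow> a \<in> gfil l"
  unfolding gfil_def by (erule gsupp_mono) auto

lemma gfil_zero [simp]: "0 \<in> gfil k"
  and gfil_add: "a \<in> gfil k \<Longrightarrow> b \<in> gfil k \<Longrightarrow> a + b \<in> gfil k"
  and gfil_diff: "a \<in> gfil k \<Longrightarrow> b \<in> gfil k \<Longrightarrow> a - b \<in> gfil k"
  and gfil_uminus: "a \<in> gfil k \<Longrightarrow> - a \<in> gfil k"
  and gfil_gscale: "a \<in> gfil k \<Longrightarrow> gscale c a \<in> gfil k"
  and gfil_of_int_mult: "a \<in> gfil k \<Longrightarrow> of_int m * a \<in> gfil k"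
  and gfil_sum: "(\<And>x. x \<in> A \<Longrightarrow> f x \<in> gfil k) \<Longrightarrow> (\<Sum>x\<in>A. f x) \<in> gfil k"
  for a b :: "('n::{finite,linorder}, 'k::comm_ring_1) grassmann" and f :: "'b \<Rightarrow> ('n, 'k) grassmann"
  unfolding gfil_def
  by (auto intro: gsupp_add gsupp_diff gsupp_uminus gsupp_gscale gsupp_of_int_mult gsupp_sum)

lemma gparity_zero [simp]: "0 \<in> gparity d"
  and gparity_add: "a \<in> gparity d \<Longrightarrow> b \<in> gparity d \<Longrightarrow> a + b \<in> gparity d"
  and gparity_diff: "a \<in> gparity d \<Longrightarrow> b \<in> gparity d \<Longrightarrow> a - b \<in> gparity d"
  and gparity_uminus: "a \<in> gparity d \<Longrightarrow> - a \<in> gparity d"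
  and gparity_of_int_mult: "a \<in> gparity d \<Longrightarrow> of_int m * a \<in> gparity d"
  and gparity_sum: "(\<And>x. x \<in> A \<Longrightarrow> f x \<in> gparity d) \<Longrightarrow> (\<Sum>x\<in>A. f x) \<in> gparity d"
  for a b :: "('n::{finite,linorder}, 'k::comm_ring_1) grassmann" and f :: "'b \<Rightarrow> ('n, 'k) grassmann"
  unfolding gparity_def
  by (auto intro: gsupp_add gsupp_diff gsupp_uminus gsupp_gscale gsupp_of_int_mult gsupp_sum)

lemma gvar_gfil: "gvar i \<in> gfil 1" and gvar_gparity: "gvar i \<in> gparity 1"
  by (auto simp: gvar_def gfil_def gparity_def intro!: gsupp_gmonom)

lemma one_gparity: "1 \<in> (gparity 0 :: ('n::{finite,linorder}, 'k::comm_ring_1) grassmann set)"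
  unfolding gmonom_empty[symmetric] gparity_def by (rule gsupp_gmonom) simp

text \<open>Degrees are bounded by the number of generators; inductions along the filtration end
  here.\<close>

lemma gfil_eq_zero:
  fixes a :: "('n::{finite,linorder}, 'k::comm_ring_1) grassmann"
  assumes "a \<in> gfil (Suc (card (UNIV :: 'n set)))"
  shows "a = 0"
proof (rule grassmann_eqI)
  fix \<alpha> :: "'n set"
  have "card \<alpha> \<le> card (UNIV :: 'n set)" by (rule card_mono) auto
  then show "gcoeff a \<alpha> = gcoeff 0 \<alpha>"
    using gsuppD[OF assms[unfolded gfil_def], of \<alpha>] by (simp add: gcoeff_simps)
qed

section \<open>Graded commutativity\<close>

lemma gsign_swap:
  fixes \<alpha> \<beta> :: "'n::{finite,linorder} set"
  assumes "\<alpha> \<inter> \<beta> = {}"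
  shows "gsign \<alpha> \<beta> = (- 1) ^ (card \<alpha> * card \<beta>) * (gsign \<beta> \<alpha> :: 'k::comm_ring_1)"
proof -
  let ?A = "{(i, j). i \<in> \<alpha> \<and> j \<in> \<beta> \<and> j < i}" and ?B = "{(i, j). i \<in> \<beta> \<and> j \<in> \<alpha> \<and> j < i}"
  \<comment> \<open>Each pair is out of order for exactly one of the two orders of the factors, so
    the two inversion counts add up to \<open>card \<alpha> * card \<beta>\<close>.\<close>
  have "\<alpha> \<times> \<beta> = ?A \<union> prod.swap ` ?B"
    using assms by (auto simp: image_iff not_less order_less_le)
  moreover have "?A \<inter> prod.swap ` ?B = {}" by auto
  ultimately have "card (\<alpha> \<times> \<beta>) = card ?A + card (prod.swap ` ?B)"
    by (metis (no_types, lifting) card_Un_disjoint finite)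
  moreover have "card (prod.swap ` ?B) = card ?B" by (rule card_image) auto
  ultimately have "card \<alpha> * card \<beta> = card ?A + card ?B" by (simp add: card_cartesian_product)
  then have "(- 1) ^ (card \<alpha> * card \<beta>) * (- 1 :: 'k) ^ card ?B = (- 1) ^ card ?A * ((- 1) ^ card ?B * (- 1) ^ card ?B)"
    by (simp add: power_add mult.assoc)
  also have "(- 1) ^ card ?B * (- 1) ^ card ?B = (1 :: 'k)" by (simp flip: power_add)
  finally show ?thesis unfolding gsign_def by simp
qed

lemma gparity_commute:
  fixes a b :: "('n::{finite,linorder}, 'k::comm_ring_1) grassmann"
  assumes a: "a \<in> gparity d" and b: "b \<in> gparity e"
  shows "a * b = gscale ((- 1) ^ (d * e)) (b * a)"
proof (rule grassmann_eqI)
  fix \<gamma> :: "'n set"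
  have "(\<Sum>\<alpha>\<in>Pow \<gamma>. gsign \<alpha> (\<gamma> - \<alpha>) * gcoeff a \<alpha> * gcoeff b (\<gamma> - \<alpha>)) =
      (\<Sum>\<alpha>\<in>Pow \<gamma>. (- 1) ^ (d * e) * (gsign \<alpha> (\<gamma> - \<alpha>) * gcoeff b \<alpha> * gcoeff a (\<gamma> - \<alpha>)))"
  proof (rule sum.reindex_bij_witness[of _ "\<lambda>\<alpha>. \<gamma> - \<alpha>" "\<lambda>\<alpha>. \<gamma> - \<alpha>"])
    fix \<alpha> assume "\<alpha> \<in> Pow \<gamma>"
    then have \<alpha>: "\<gamma> - (\<gamma> - \<alpha>) = \<alpha>" by auto
    show "(- 1) ^ (d * e) * (gsign (\<gamma> - \<alpha>) (\<gamma> - (\<gamma> - \<alpha>)) * gcoeff b (\<gamma> - \<alpha>) * gcoeff a (\<gamma> - (\<gamma> - \<alpha>))) =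
        gsign \<alpha> (\<gamma> - \<alpha>) * gcoeff a \<alpha> * gcoeff b (\<gamma> - \<alpha>)"
    proof (cases "gcoeff a \<alpha> = 0 \<or> gcoeff b (\<gamma> - \<alpha>) = 0")
      case False
      then have "even (card \<alpha>) = even d" "even (card (\<gamma> - \<alpha>)) = even e"
        using a b by (auto simp: gparity_def gsupp_def)
      then have "even (card \<alpha> * card (\<gamma> - \<alpha>)) = even (d * e)" by simp
      then have "(- 1 :: 'k) ^ (card \<alpha> * card (\<gamma> - \<alpha>)) = (- 1) ^ (d * e)"
        by (metis neg_one_even_power neg_one_odd_power)
      moreover have "gsign \<alpha> (\<gamma> - \<alpha>) = (- 1) ^ (card \<alpha> * card (\<gamma> - \<alpha>)) * (gsign (\<gamma> - \<alpha>) \<alpha> :: 'k)"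
        by (rule gsign_swap) auto
      ultimately show ?thesis unfolding \<alpha> by (simp add: ac_simps)
    qed (auto simp: \<alpha>)
  qed auto
  then show "gcoeff (a * b) \<gamma> = gcoeff (gscale ((- 1) ^ (d * e)) (b * a)) \<gamma>"
    by (simp add: times_grassmann.rep_eq gscale.rep_eq sum_distrib_left)
qed

text \<open>The factor \<open>b\<close> may have mixed parity; it is split into monomials, and
  \<open>a\<close> commutes with each of them.\<close>

lemma even_central: "a \<in> gparity 0 \<Longrightarrow> a * b = b * a"
  for a b :: "('n::{finite,linorder}, 'k::comm_ring_1) grassmann"
proof -
  assume a: "a \<in> gparity 0"
  have "(gmonom \<alpha> :: ('n, 'k) grassmann) \<in> gparity (card \<alpha>)" for \<alpha> :: "'n set"
    unfolding gparity_def by (rule gsupp_gmonom) simp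
  then have "a * gmonom \<alpha> = gmonom \<alpha> * a" for \<alpha>
    using gparity_commute[OF a, of "gmonom \<alpha>" "card \<alpha>"] by simp
  then show ?thesis
    by (subst (1 2) grassmann_expand[of b]) (simp add: sum_distrib_left sum_distrib_right)
qed

lemma odd_anticommute: "a \<in> gparity 1 \<Longrightarrow> b \<in> gparity 1 \<Longrightarrow> a * b = - (b * a)"
  for a b :: "('n::{finite,linorder}, 'k::comm_ring_1) grassmann"
  using gparity_commute[of a 1 b 1] by (simp add: gscale_minus_left)

text \<open>Anticommutation only yields 2 a a = 0, which is too weak when 2 is not invertible.
  Expanding into monomials works in general: cross terms cancel in pairs, and the square of an odd
  monomial vanishes because its index set is nonempty and meets itself.\<close>

lemma odd_square:
  fixes a :: "('n::{finite,linorder}, 'k::comm_ring_1) grassmann"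
  assumes "a \<in> gparity 1"
  shows "a * a = 0"
proof -
  define t :: "'n set \<Rightarrow> ('n, 'k) grassmann" where "t \<alpha> = gscale (gcoeff a \<alpha>) (gmonom \<alpha>)" for \<alpha>
  have t: "t \<alpha> \<in> gparity 1" for \<alpha>
    using gsuppD[OF assms[unfolded gparity_def], of \<alpha>] unfolding t_def gparity_def
    by (cases "odd (card \<alpha>)") (auto intro!: gsupp_gscale gsupp_gmonom)
  have sq: "t \<alpha> * t \<alpha> = 0" for \<alpha>
    using gsuppD[OF assms[unfolded gparity_def], of \<alpha>] unfolding t_def
    by (cases "\<alpha> = {}") (auto simp: gmonom_mult)
  have "(\<Sum>\<alpha>\<in>A. t \<alpha>) * (\<Sum>\<alpha>\<in>A. t \<alpha>) = 0" if "finite A" for A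
    using that
  proof induction
    case (insert \<alpha> A)
    have "(\<Sum>\<alpha>\<in>A. t \<alpha>) \<in> gparity 1" by (intro gparity_sum t)
    from odd_anticommute[OF t this] show ?case
      using insert by (simp add: distrib_left distrib_right sq)
  qed simp
  from this[of UNIV] show ?thesis
    unfolding t_def using grassmann_expand[of a] by simp
qed

section \<open>Substitution endomorphisms\<close>

definition gprod :: "('n::{finite,linorder} \<Rightarrow> ('n, 'k::comm_ring_1) grassmann) \<Rightarrow> 'n set \<Rightarrow> ('n, 'k) grassmann"
  where "gprod f \<alpha> = prod_list (map f (sorted_list_of_set \<alpha>))"

text \<open>The candidate for the endomorphism x_i to \<open>f i\<close>, given on the monomial
  basis. This makes it linear for every \<open>f\<close>; multiplicativity requires the images to be
  odd.\<close>

definition gsubst :: "('n::{finite,linorder} \<Rightarrow> ('n, 'k::comm_ring_1) grassmann) \<Rightarrow>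
    ('n, 'k) grassmann \<Rightarrow> ('n, 'k) grassmann"
  where "gsubst f a = (\<Sum>\<alpha>\<in>UNIV. gscale (gcoeff a \<alpha>) (gprod f \<alpha>))"

lemma gprod_empty [simp]: "gprod f {} = 1"
  by (simp add: gprod_def)

lemma gprod_insert_Min:
  assumes "\<And>k. k \<in> \<alpha> \<Longrightarrow> i < k"
  shows "gprod f (insert i \<alpha>) = f i * gprod f \<alpha>"
proof -
  have "Min (insert i \<alpha>) = i" using assms by (intro Min_eqI) (auto intro: less_imp_le)
  moreover have "insert i \<alpha> - {i} = \<alpha>" using assms by auto
  ultimately show ?thesis
    using sorted_list_of_set_nonempty[of "insert i \<alpha>"] by (simp add: gprod_def)
qed

lemma gprod_gvar: "gprod gvar \<alpha> = gmonom \<alpha>"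
proof -
  have "finite \<alpha>" by simp
  then show ?thesis
    by (induction \<alpha> rule: finite_linorder_min_induct)
      (auto simp: gmonom_empty gprod_insert_Min gmonom_insert_Min)
qed

lemma klinear_gsubst: "klinear (gsubst f)"
  by (auto simp: klinear_def gsubst_def gcoeff_simps gscale_add_left sum.distrib gscale_sum_right)

lemma gsubst_gmonom [simp]: "gsubst f (gmonom \<alpha>) = gprod f \<alpha>"
proof -
  have "gsubst f (gmonom \<alpha>) = (\<Sum>\<beta>\<in>UNIV. if \<beta> = \<alpha> then gprod f \<beta> else 0)"
    unfolding gsubst_def by (rule sum.cong) (auto simp: gcoeff_simps)
  then show ?thesis by simp
qed

lemma gsubst_gvar [simp]: "gsubst f (gvar i) = f i"
  by (simp add: gvar_def gprod_def)

lemma gsubst_one [simp]: "gsubst f 1 = 1"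
  using gsubst_gmonom[of f "{}"] by (simp add: gmonom_empty)

lemma gsubst_add: "gsubst f (a + b) = gsubst f a + gsubst f b"
  and gsubst_gscale: "gsubst f (gscale c a) = gscale c (gsubst f a)"
  using klinear_gsubst[of f] by (auto simp: klinear_def)

lemma gsubst_id: "gsubst gvar a = a"
  unfolding gsubst_def gprod_gvar by (rule grassmann_expand[symmetric])

text \<open>\<open>f i\<close> moves past the smaller factors of the sorted product, each of which
  contributes a sign; if it meets another \<open>f i\<close>, the product vanishes by
  \<open>odd_square\<close>.\<close>

lemma mult_gprod:
  assumes f: "\<And>i. f i \<in> gparity 1"
  shows "f i * gprod f \<alpha> = (if i \<in> \<alpha> then 0 else gscale (tsign i \<alpha>) (gprod f (insert i \<alpha>)))"
proof -
  have "finite \<alpha>" by simp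
  then show ?thesis
  proof (induction \<alpha> rule: finite_linorder_min_induct)
    case empty
    show ?case using gprod_insert_Min[of "{}" i f] by (simp add: tsign_def)
  next
    case (insert b A)
    have P: "gprod f (insert b A) = f b * gprod f A" using insert by (simp add: gprod_insert_Min)
    consider "i = b" | "i < b" | "b < i" by fastforce
    then show ?case
    proof cases
      case 1
      then show ?thesis by (simp add: P odd_square[OF f] flip: mult.assoc)
    next
      case 2
      then have lt: "i < k" if "k \<in> insert b A" for k using insert that by fastforce
      then have "{k \<in> insert b A. k < i} = {}" by fastforce
      then have "tsign i (insert b A) = (1 :: 'b)" by (simp only: tsign_def) simp
      then show ?thesis using lt gprod_insert_Min[of "insert b A" i f] by auto
    next
      case 3
      have "b \<notin> A" using insert by auto
      moreover have "{k \<in> insert b A. k < i} = insert b {k \<in> A. k < i}" using 3 by auto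
      ultimately have ts: "tsign i (insert b A) = (- tsign i A :: 'b)" by (simp add: tsign_def)
      have "f i * gprod f (insert b A) = - (f b * (f i * gprod f A))"
        unfolding P using odd_anticommute[OF f f, of i b] by (simp flip: mult.assoc)
      also have "\<dots> = (if i \<in> A then 0 else gscale (tsign i (insert b A)) (f b * gprod f (insert i A)))"
        unfolding insert.IH ts by (simp add: gscale_minus_left)
      also have "f b * gprod f (insert i A) = gprod f (insert i (insert b A))"
        using insert 3 by (subst gprod_insert_Min[symmetric]) (auto simp: insert_commute)
      finally show ?thesis using 3 by auto
    qed
  qed
qed

text \<open>These are the structure constants of \<open>gmonom_mult\<close>: odd elements obey the
  defining relations of the generators, which is why the substitution is multiplicative.\<close>

lemma gprod_mult:
  assumes f: "\<And>i. f i \<in> gparity 1"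
  shows "gprod f \<alpha> * gprod f \<beta> =
    (if \<alpha> \<inter> \<beta> = {} then gscale (gsign \<alpha> \<beta>) (gprod f (\<alpha> \<union> \<beta>)) else 0)"
proof -
  have "finite \<alpha>" by simp
  then show ?thesis
  proof (induction \<alpha> rule: finite_linorder_min_induct)
    case (insert i A)
    have iA: "i \<notin> A" using insert by auto
    have P: "gprod f (insert i A) = f i * gprod f A" using insert by (simp add: gprod_insert_Min)
    have "{k \<in> A. k < i} = {}" using insert by fastforce
    then have ts: "tsign i A = (1 :: 'b)" by (simp only: tsign_def) simp
    have gs: "gsign (insert i A) \<beta> = gsign A \<beta> * (tsign i \<beta> :: 'b)"
      using gsign_Un_left[of A "{i}" \<beta>] iA by (simp add: gsign_singleton_right)
    have "A \<inter> \<beta> = {} \<Longrightarrow> tsign i (A \<union> \<beta>) = (tsign i \<beta> :: 'b)"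
      by (simp add: tsign_Un ts)
    then show ?case
      unfolding P mult.assoc insert.IH gs using iA by (auto simp: mult_gprod[of f, OF f])
  qed simp
qed

lemma gsubst_mult:
  assumes f: "\<And>i. f i \<in> gparity 1"
  shows "gsubst f (a * b) = gsubst f a * gsubst f b"
proof -
  have mon: "gsubst f (gmonom \<alpha> * gmonom \<beta>) = gprod f \<alpha> * gprod f \<beta>" for \<alpha> \<beta>
    unfolding gmonom_mult gprod_mult[of f, OF f]
    by (auto simp: gsubst_gscale) (simp add: gsubst_def gcoeff_simps)
  have "a * b = (\<Sum>p\<in>UNIV \<times> UNIV. gscale (gcoeff a (fst p) * gcoeff b (snd p)) (gmonom (fst p) * gmonom (snd p)))"
    by (subst grassmann_expand[of a], subst grassmann_expand[of b])
      (simp add: sum_product sum.cartesian_product case_prod_beta mult.commute)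
  also have "gsubst f \<dots> =
      (\<Sum>p\<in>UNIV \<times> UNIV. gscale (gcoeff a (fst p) * gcoeff b (snd p)) (gprod f (fst p) * gprod f (snd p)))"
    by (subst klinear_sum[OF klinear_gsubst]) (simp_all add: mon)
  also have "\<dots> = gsubst f a * gsubst f b"
    unfolding gsubst_def
    by (simp add: sum_product sum.cartesian_product case_prod_beta mult.commute)
  finally show ?thesis .
qed

lemma endomorphism_eq_gsubst:
  assumes "klinear \<sigma>" "\<sigma> 1 = 1" "\<And>a b. \<sigma> (a * b) = \<sigma> a * \<sigma> b"
  shows "\<sigma> = gsubst (\<lambda>i. \<sigma> (gvar i))"
proof
  fix a
  have "\<sigma> (gmonom \<alpha>) = gprod (\<lambda>i. \<sigma> (gvar i)) \<alpha>" for \<alpha>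
  proof -
    have "finite \<alpha>" by simp
    then show ?thesis
      by (induction \<alpha> rule: finite_linorder_min_induct)
        (auto simp: gmonom_empty gprod_insert_Min gmonom_insert_Min assms)
  qed
  then show "\<sigma> a = gsubst (\<lambda>i. \<sigma> (gvar i)) a"
    unfolding gsubst_def by (subst grassmann_expand[of a]) (simp add: klinear_sum[OF assms(1)])
qed

section \<open>Partial derivatives and division by a generator\<close>

lemma gpartial_eq: "gpartial j = (gpartial_explicit j :: ('n::{finite,linorder}, 'k::comm_ring_1) grassmann \<Rightarrow> _)"
  unfolding gpartial_def
  by (rule the_equality) (use ex1_is_left_skew_partial is_left_skew_partial_explicit in blast)+

lemma gcoeff_gpartial: "gcoeff (gpartial j a) \<alpha> = (if j \<in> \<alpha> then 0 else tsign j \<alpha> * gcoeff a (insert j \<alpha>))"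
  for a :: "('n::{finite,linorder}, 'k::comm_ring_1) grassmann"
  by (simp add: gpartial_eq gpartial_explicit.rep_eq)

lemma gcoeff_gvar_mult:
  "gcoeff (gvar i * a) \<gamma> = (if i \<in> \<gamma> then tsign i (\<gamma> - {i}) * gcoeff a (\<gamma> - {i}) else 0)"
  for a :: "('n::{finite,linorder}, 'k::comm_ring_1) grassmann"
proof -
  have "gcoeff (gvar i * a) \<gamma> =
      (\<Sum>\<alpha>\<in>Pow \<gamma>. if \<alpha> = {i} then tsign i (\<gamma> - {i}) * gcoeff a (\<gamma> - {i}) else 0)"
    unfolding times_grassmann.rep_eq gvar_def gmonom.rep_eq
    by (rule sum.cong) (auto simp: gsign_singleton_right)
  then show ?thesis by (simp add: sum.delta)
qed

text \<open>On elements whose monomials all contain x_i, the derivative is left division by x_i: the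
  same sign occurs twice and cancels. This supplies the cofactor whenever an element of the ideal of
  x_i has to be factored.\<close>

lemma gvar_mult_gpartial:
  assumes "a \<in> gsupp {\<alpha>. i \<in> \<alpha>}"
  shows "gvar i * gpartial i a = (a :: ('n::{finite,linorder}, 'k::comm_ring_1) grassmann)"
  by (rule grassmann_eqI)
    (auto simp: gcoeff_gvar_mult gcoeff_gpartial insert_absorb gsuppD[OF assms])

lemma gsupp_containing_mult:
  fixes a b :: "('n::{finite,linorder}, 'k::comm_ring_1) grassmann"
  assumes "a \<in> gsupp {\<alpha>. i \<in> \<alpha>}"
  shows "a * b \<in> gsupp {\<alpha>. i \<in> \<alpha>}" "b * a \<in> gsupp {\<alpha>. i \<in> \<alpha>}"
  using gsupp_mult[of a "{\<alpha>. i \<in> \<alpha>}" b UNIV] gsupp_mult[of b UNIV a "{\<alpha>. i \<in> \<alpha>}"] assms by auto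

lemma ring_of_type_algebra_ring: "Ring.ring (ring_of_type_algebra :: 'a::ring_1 ring)"
proof -
  have "\<exists>y. x + y = 0" for x :: 'a using add.right_inverse by blast
  then show ?thesis
    unfolding ring_of_type_algebra_def using add.right_inverse
    by unfold_locales (auto simp: algebra_simps Units_def)
qed

text \<open>The support condition is stable under multiplication on both sides and holds for x_i,
  which gives one inclusion; left division by x_i gives the other.\<close>

lemma gvar_ideal_eq:
  "gvar_ideal i = (gsupp {\<alpha>. i \<in> \<alpha>} :: ('n::{finite,linorder}, 'k::comm_ring_1) grassmann set)"
proof -
  interpret R: ring "ring_of_type_algebra :: ('n, 'k) grassmann ring"
    by (rule ring_of_type_algebra_ring)
  have carr: "carrier (ring_of_type_algebra :: ('n, 'k) grassmann ring) = UNIV"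
    and mult: "monoid.mult (ring_of_type_algebra :: ('n, 'k) grassmann ring) = (*)"
    by (auto simp: ring_of_type_algebra_def)
  have inv: "\<ominus>\<^bsub>ring_of_type_algebra\<^esub> a = - a" for a :: "('n, 'k) grassmann"
    by (rule R.minus_equality) (auto simp: ring_of_type_algebra_def)
  have id: "ideal (gsupp {\<alpha>. i \<in> \<alpha>} :: ('n, 'k) grassmann set) ring_of_type_algebra"
  proof (rule idealI[OF R.ring_axioms])
    show "subgroup (gsupp {\<alpha>. i \<in> \<alpha>} :: ('n, 'k) grassmann set) (add_monoid ring_of_type_algebra)"
    proof (rule group.subgroupI[OF R.a_group])
      show "(gsupp {\<alpha>. i \<in> \<alpha>} :: ('n, 'k) grassmann set) \<noteq> {}" using gsupp_zero by blast
    next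
      fix a assume "a \<in> (gsupp {\<alpha>. i \<in> \<alpha>} :: ('n, 'k) grassmann set)"
      then show "inv\<^bsub>add_monoid ring_of_type_algebra\<^esub> a \<in> gsupp {\<alpha>. i \<in> \<alpha>}"
        using inv[of a] unfolding a_inv_def by (simp add: gsupp_uminus)
    qed (auto simp: ring_of_type_algebra_def gsupp_add)
  qed (auto simp: ring_of_type_algebra_def gsupp_containing_mult)
  show ?thesis
  proof
    show "gvar_ideal i \<subseteq> (gsupp {\<alpha>. i \<in> \<alpha>} :: ('n, 'k) grassmann set)"
      unfolding gvar_ideal_def using id
      by (rule R.genideal_minimal) (auto simp: gvar_def intro: gsupp_gmonom)
  next
    have id': "ideal (gvar_ideal i :: ('n, 'k) grassmann set) ring_of_type_algebra"
      unfolding gvar_ideal_def by (rule R.genideal_ideal) (simp add: carr)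
    have "gvar i \<in> (gvar_ideal i :: ('n, 'k) grassmann set)"
      unfolding gvar_ideal_def by (rule R.genideal_self') (simp add: carr)
    then have "gvar i * b \<in> gvar_ideal i" for b :: "('n, 'k) grassmann"
      using ideal.I_r_closed[OF id', of "gvar i" b] by (simp add: carr mult)
    then show "(gsupp {\<alpha>. i \<in> \<alpha>} :: ('n, 'k) grassmann set) \<subseteq> gvar_ideal i"
      using gvar_mult_gpartial by (metis subsetI)
  qed
qed

text \<open>A monomial of degree at least 3 is x_i x_j b with b of positive degree, hence a product
  of three elements of the maximal ideal; sums of such products remain in the inductively generated
  \<open>ideal_prod\<close>.\<close>

lemma max_ideal_cubed_eq:
  "max_ideal_cubed = (gfil 3 :: ('n::{finite,linorder}, 'k::comm_ring_1) grassmann set)"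
proof -
  have mult: "monoid.mult (ring_of_type_algebra :: ('n, 'k) grassmann ring) = (*)"
    and add: "ring.add (ring_of_type_algebra :: ('n, 'k) grassmann ring) = (+)"
    by (auto simp: ring_of_type_algebra_def)
  have m: "max_ideal = (gfil 1 :: ('n, 'k) grassmann set)"
    by (simp add: max_ideal_def gfil_def gsupp_def)
  let ?P = "ideal_prod (ring_of_type_algebra :: ('n, 'k) grassmann ring)"
  have sub2: "a \<in> gfil 2" if "a \<in> ?P max_ideal max_ideal" for a
    using that by induction (auto simp: mult add m intro: gfil_add gfil_mult)
  have sub3: "a \<in> gfil 3" if "a \<in> ?P max_ideal (?P max_ideal max_ideal)" for a
    using that
  proof induction
    case (prod i j)
    with gfil_mult[of i 1 j 2 3] sub2[of j] show ?case by (simp add: mult m)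
  qed (simp add: add gfil_add)
  have zero: "0 \<in> ?P max_ideal (?P max_ideal max_ideal)"
  proof -
    have 0: "(0 :: ('n, 'k) grassmann) \<in> max_ideal" by (simp add: m)
    show ?thesis using ideal_prod.prod[OF 0 ideal_prod.prod[OF 0 0], of ring_of_type_algebra ring_of_type_algebra]
      by (simp add: mult)
  qed
  have "gscale c (gmonom \<alpha>) \<in> ?P max_ideal (?P max_ideal max_ideal)" if "3 \<le> card \<alpha>" for c \<alpha>
  proof -
    have "\<alpha> \<noteq> {}" using that by auto
    then obtain i where i: "i \<in> \<alpha>" by auto
    have "card (\<alpha> - {i}) \<ge> 2" using that i by simp
    then have "\<alpha> - {i} \<noteq> {}" by (metis card.empty not_numeral_le_zero)
    then obtain j where j: "j \<in> \<alpha> - {i}" by blast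
    have c1: "card (\<alpha> - {i} - {j}) \<ge> 1" using that i j by (simp add: card_Diff_singleton)
    \<comment> \<open>Dividing on the left by x_i and then by x_j leaves the third factor, with the
      right sign built in.\<close>
    define b :: "('n, 'k) grassmann" where "b = gscale c (gpartial j (gpartial i (gmonom \<alpha>)))"
    have gi: "gpartial i (gmonom \<alpha> :: ('n, 'k) grassmann) \<in> gsupp {\<beta>. \<beta> = \<alpha> - {i}}"
      using i by (auto intro!: gsuppI simp: gcoeff_gpartial gmonom.rep_eq split: if_splits)
    have b1: "b \<in> gfil 1"
      unfolding b_def gfil_def using c1 i j
      by (intro gsupp_gscale gsuppI) (auto simp: gcoeff_gpartial gmonom.rep_eq)
    have "gvar i * (gvar j * b) = gscale c (gvar i * (gvar j * gpartial j (gpartial i (gmonom \<alpha>))))"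
      by (simp add: b_def)
    also have "gvar j * gpartial j (gpartial i (gmonom \<alpha>)) = (gpartial i (gmonom \<alpha>) :: ('n, 'k) grassmann)"
      using gsupp_mono[OF gi] j by (intro gvar_mult_gpartial) auto
    also have "gvar i * (gpartial i (gmonom \<alpha>)) = (gmonom \<alpha> :: ('n, 'k) grassmann)"
      using i by (intro gvar_mult_gpartial gsupp_gmonom) auto
    finally have "gscale c (gmonom \<alpha>) = gvar i * (gvar j * b)" by simp
    moreover have "gvar i * (gvar j * b) \<in> ?P max_ideal (?P max_ideal max_ideal)"
      using ideal_prod.prod[of "gvar i" max_ideal "gvar j * b" "?P max_ideal max_ideal" ring_of_type_algebra]
        ideal_prod.prod[of "gvar j" max_ideal b max_ideal ring_of_type_algebra] b1
      by (simp add: mult m gvar_gfil del: One_nat_def)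
    ultimately show ?thesis by simp
  qed
  then have mono: "gscale (gcoeff a \<alpha>) (gmonom \<alpha>) \<in> ?P max_ideal (?P max_ideal max_ideal)"
    if "a \<in> gfil 3" for a \<alpha>
    using gsuppD[OF that[unfolded gfil_def], of \<alpha>] zero by (cases "3 \<le> card \<alpha>") auto
  have "a \<in> ?P max_ideal (?P max_ideal max_ideal)" if a: "a \<in> gfil 3" for a
  proof -
    have "(\<Sum>\<alpha>\<in>A. gscale (gcoeff a \<alpha>) (gmonom \<alpha>)) \<in> ?P max_ideal (?P max_ideal max_ideal)" for A
    proof (induction A rule: infinite_finite_induct)
      case (insert \<alpha> A)
      from ideal_prod.sum[OF mono[OF a, of \<alpha>] insert.IH] insert(1,2) show ?case by (simp add: add)
    qed (simp_all add: zero)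
    from this[of UNIV] show ?thesis by (simp flip: grassmann_expand)
  qed
  with sub3 show ?thesis unfolding max_ideal_cubed_def by blast
qed

text \<open>Successive approximation: replacing x by x - (\<sigma> x - y) moves the error one degree
  up, and the filtration is finite. The set \<open>A\<close> carries side conditions, such as parity
  or membership in an ideal, over to the solution. The lemma serves both for substitutions and for
  multiplication by a unit.\<close>

lemma degree_raising_surj:
  fixes \<sigma> :: "('n::{finite,linorder}, 'k::comm_ring_1) grassmann \<Rightarrow> ('n, 'k) grassmann"
  assumes diff: "\<And>a b. \<sigma> (a - b) = \<sigma> a - \<sigma> b"
    and A: "0 \<in> A" "\<And>a b. a \<in> A \<Longrightarrow> b \<in> A \<Longrightarrow> a - b \<in> A" "\<And>a. a \<in> A \<Longrightarrow> \<sigma> a \<in> A"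
    and raise: "\<And>k a. a \<in> gfil k \<Longrightarrow> \<sigma> a - a \<in> gfil (Suc k)"
    and y: "y \<in> A"
  shows "\<exists>x\<in>A. \<sigma> x = y"
proof -
  have "\<exists>x\<in>A. \<sigma> x - y \<in> gfil k" for k
  proof (induction k)
    case 0
    then show ?case using A(1) by auto
  next
    case (Suc k)
    then obtain x where x: "x \<in> A" "\<sigma> x - y \<in> gfil k" by blast
    have "\<sigma> (x - (\<sigma> x - y)) - y = - (\<sigma> (\<sigma> x - y) - (\<sigma> x - y))" by (simp add: diff)
    then have "\<sigma> (x - (\<sigma> x - y)) - y \<in> gfil (Suc k)" using gfil_uminus[OF raise[OF x(2)]] by (simp only:)
    moreover have "x - (\<sigma> x - y) \<in> A" using x A y by blast
    ultimately show ?case by blast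
  qed
  then obtain x where "x \<in> A" "\<sigma> x - y \<in> gfil (Suc (card (UNIV :: 'n set)))" by blast
  moreover from this(2) have "\<sigma> x - y = 0" by (rule gfil_eq_zero)
  ultimately show ?thesis by (intro bexI[of _ x]) auto
qed

text \<open>If \<sigma> z = 0 then z = -(\<sigma> z - z), so z lies one step deeper in the
  filtration, again and again.\<close>

lemma degree_raising_inj:
  fixes \<sigma> :: "('n::{finite,linorder}, 'k::comm_ring_1) grassmann \<Rightarrow> ('n, 'k) grassmann"
  assumes diff: "\<And>a b. \<sigma> (a - b) = \<sigma> a - \<sigma> b"
    and raise: "\<And>k a. a \<in> gfil k \<Longrightarrow> \<sigma> a - a \<in> gfil (Suc k)"
  shows "inj \<sigma>"
proof (rule injI)
  fix x y assume "\<sigma> x = \<sigma> y"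
  then have zero: "\<sigma> (x - y) = 0" by (simp add: diff)
  have "x - y \<in> gfil k" for k
  proof (induction k)
    case (Suc k)
    from gfil_uminus[OF raise[OF this]] show ?case by (simp only: zero) simp
  qed simp
  then have "x - y = 0" by (rule gfil_eq_zero)
  then show "x = y" by simp
qed

section \<open>The group \<open>\<Gamma>\<close> as a group of substitutions\<close>

definition admissible :: "('n::{finite,linorder} \<Rightarrow> ('n, 'k::comm_ring_1) grassmann) \<Rightarrow> bool" where
  "admissible f \<longleftrightarrow> (\<forall>i. f i - gvar i \<in> gparity 1 \<and> f i - gvar i \<in> gfil 3)"

lemma admissible_gvar: "admissible gvar"
  by (simp add: admissible_def)

lemma admissible_odd: "admissible f \<Longrightarrow> f i \<in> gparity 1"
  using gparity_add[OF _ gvar_gparity, of "f i - gvar i" i] by (auto simp: admissible_def)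

lemma gsubst_diff: "gsubst f (a - b) = gsubst f a - gsubst f b"
  using gsubst_add[of f "a - b" b] by simp

lemma gprod_gparity: "(\<And>i. f i \<in> gparity 1) \<Longrightarrow> gprod f \<alpha> \<in> gparity (card \<alpha>)"
proof -
  assume f: "\<And>i. f i \<in> gparity 1"
  have "finite \<alpha>" by simp
  then show ?thesis
  proof (induction \<alpha> rule: finite_linorder_min_induct)
    case (insert b A)
    then have "b \<notin> A" by auto
    then show ?case using gparity_mult[OF f insert.IH, of b] insert by (simp add: gprod_insert_Min)
  qed (simp add: one_gparity)
qed

lemma gsubst_gparity:
  assumes "\<And>i. f i \<in> gparity 1" "a \<in> gparity d"
  shows "gsubst f a \<in> gparity d"
  unfolding gsubst_def
proof (rule gparity_sum)
  fix \<alpha>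
  have "even (card \<alpha>) = even d" if "gcoeff a \<alpha> \<noteq> 0"
    using that assms(2) by (auto simp: gparity_def gsupp_def)
  then show "gscale (gcoeff a \<alpha>) (gprod f \<alpha>) \<in> gparity d"
    using gprod_gparity[of f, OF assms(1), of \<alpha>]
    by (cases "gcoeff a \<alpha> = 0") (auto intro: gsupp_gscale simp: gparity_def)
qed

lemma gmonom_gfil: "gmonom \<alpha> \<in> gfil (card \<alpha>)"
  by (auto simp: gfil_def intro: gsupp_gmonom)

lemma gprod_gfil:
  assumes f: "\<And>i. f i - gvar i \<in> gfil 2"
  shows "gprod f \<alpha> - gmonom \<alpha> \<in> gfil (Suc (card \<alpha>))"
proof -
  have "finite \<alpha>" by simp
  then show ?thesis
  proof (induction \<alpha> rule: finite_linorder_min_induct)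
    case (insert b A)
    then have "b \<notin> A" by auto
    then have card: "card (insert b A) = Suc (card A)" by simp
    \<comment> \<open>Both factors are expanded around their leading parts; each summand contains a
      correction and has gained at least one degree.\<close>
    have "gprod f (insert b A) - gmonom (insert b A) =
        (f b - gvar b) * (gprod f A - gmonom A) + (f b - gvar b) * gmonom A + gvar b * (gprod f A - gmonom A)"
      using insert by (simp add: gprod_insert_Min gmonom_insert_Min algebra_simps)
    also have "\<dots> \<in> gfil (Suc (card (insert b A)))"
      unfolding card
      by (intro gfil_add gfil_mult[OF f insert.IH] gfil_mult[OF f gmonom_gfil]
          gfil_mult[OF gvar_gfil insert.IH]) auto
    finally show ?case .
  qed (simp add: gmonom_empty)
qed

lemma gsubst_raise:
  assumes f: "\<And>i. f i - gvar i \<in> gfil 2" and a: "a \<in> gfil k"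
  shows "gsubst f a - a \<in> gfil (Suc k)"
proof -
  have "gsubst f a - a = (\<Sum>\<alpha>\<in>UNIV. gscale (gcoeff a \<alpha>) (gprod f \<alpha> - gmonom \<alpha>))"
    unfolding gsubst_def by (subst (2) grassmann_expand[of a]) (simp add: gscale_diff_right sum_subtractf)
  also have "\<dots> \<in> gfil (Suc k)"
  proof (rule gfil_sum)
    fix \<alpha>
    have "k \<le> card \<alpha>" if "gcoeff a \<alpha> \<noteq> 0"
      using that a by (auto simp: gfil_def gsupp_def)
    then show "gscale (gcoeff a \<alpha>) (gprod f \<alpha> - gmonom \<alpha>) \<in> gfil (Suc k)"
      using gprod_gfil[of f, OF f, of \<alpha>]
      by (cases "gcoeff a \<alpha> = 0") (auto intro!: gfil_gscale intro: gfil_mono)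
  qed
  finally show ?thesis .
qed

lemma admissible_gfil2: "admissible f \<Longrightarrow> f i - gvar i \<in> gfil 2"
  by (auto simp: admissible_def intro: gfil_mono)

lemma gsubst_gfil: "admissible f \<Longrightarrow> a \<in> gfil k \<Longrightarrow> gsubst f a \<in> gfil k"
  using gfil_add[of "gsubst f a - a" k a] gsubst_raise[of f a k] admissible_gfil2[of f]
    gfil_mono[of "gsubst f a - a" "Suc k" k] by auto

lemma gsubst_surj_on:
  assumes f: "admissible f"
    and A: "0 \<in> A" "\<And>a b. a \<in> A \<Longrightarrow> b \<in> A \<Longrightarrow> a - b \<in> A" "\<And>a. a \<in> A \<Longrightarrow> gsubst f a \<in> A"
    and y: "y \<in> A"
  shows "\<exists>x\<in>A. gsubst f x = y"
  by (rule degree_raising_surj[of "gsubst f", OF gsubst_diff A gsubst_raise[OF admissible_gfil2[OF f]] y])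

lemma bij_gsubst: "admissible f \<Longrightarrow> bij (gsubst f)"
proof -
  assume f: "admissible f"
  have "inj (gsubst f)"
    by (rule degree_raising_inj[OF gsubst_diff gsubst_raise[OF admissible_gfil2[OF f]]])
  moreover have "\<exists>x\<in>UNIV. gsubst f x = y" for y
    by (rule gsubst_surj_on[OF f]) auto
  ultimately show ?thesis unfolding bij_def surj_def by (metis)
qed

lemma admissible_comp: "admissible f \<Longrightarrow> admissible g \<Longrightarrow> admissible (\<lambda>i. gsubst f (g i))"
  unfolding admissible_def[of "\<lambda>i. gsubst f (g i)"]
proof (intro allI)
  fix i
  assume f: "admissible f" and g: "admissible g"
  have eq: "gsubst f (g i) - gvar i = gsubst f (g i - gvar i) + (f i - gvar i)" by (simp add: gsubst_diff)
  show "gsubst f (g i) - gvar i \<in> gparity 1 \<and> gsubst f (g i) - gvar i \<in> gfil 3"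
    unfolding eq using f g
    by (auto simp: admissible_def intro!: gparity_add gfil_add gsubst_gparity admissible_odd gsubst_gfil)
qed

text \<open>Both sides are algebra endomorphisms with the same values on the generators. The images
  of the inner map are substituted into by the outer one.\<close>

lemma gsubst_comp:
  assumes "\<And>i. f i \<in> gparity 1" "\<And>i. g i \<in> gparity 1"
  shows "gsubst f \<circ> gsubst g = gsubst (\<lambda>i. gsubst f (g i))"
proof -
  have "gsubst f \<circ> gsubst g = gsubst (\<lambda>i. (gsubst f \<circ> gsubst g) (gvar i))"
    by (rule endomorphism_eq_gsubst)
      (auto simp: klinear_def gsubst_add gsubst_gscale gsubst_mult[of f, OF assms(1)] gsubst_mult[of g, OF assms(2)])
  then show ?thesis by simp
qed

section \<open>Substitutions that preserve the ideal of each generator\<close>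

definition principal :: "('n::{finite,linorder} \<Rightarrow> ('n, 'k::comm_ring_1) grassmann) \<Rightarrow> bool" where
  "principal f \<longleftrightarrow> (\<forall>i. f i \<in> gsupp {\<alpha>. i \<in> \<alpha>})"

lemma principal_gvar: "principal gvar"
  by (auto simp: principal_def gvar_def intro: gsupp_gmonom)

text \<open>Such an \<open>a\<close> is x_i times a cofactor, so its image is a multiple of
  \<open>f i\<close>.\<close>

lemma gsubst_gsupp_containing:
  assumes "\<And>i. f i \<in> gparity 1" "principal f" "a \<in> gsupp {\<alpha>. i \<in> \<alpha>}"
  shows "gsubst f a \<in> gsupp {\<alpha>. i \<in> \<alpha>}"
proof -
  have "gsubst f a = f i * gsubst f (gpartial i a)"
    by (subst gvar_mult_gpartial[OF assms(3), symmetric]) (simp only: gsubst_mult[of f, OF assms(1)] gsubst_gvar)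
  then show ?thesis using assms(2) by (simp add: principal_def gsupp_containing_mult)
qed

text \<open>With z_i solving \<open>gsubst f (z i) = gvar i - f i\<close>, the choice g_i = x_i +
  z_i gives a right inverse; injectivity of \<open>gsubst f\<close> makes it two-sided.
  \<open>Y\<close> is a condition that the corrections z_i inherit from
  \<open>gvar i - f i\<close>.\<close>

lemma gsubst_inverse_aux:
  assumes f: "admissible f"
    and Y: "\<And>i. 0 \<in> Y i" "\<And>i a b. a \<in> Y i \<Longrightarrow> b \<in> Y i \<Longrightarrow> a - b \<in> Y i"
      "\<And>i a. a \<in> Y i \<Longrightarrow> gsubst f a \<in> Y i" "\<And>i. gvar i - f i \<in> Y i"
  shows "\<exists>g. admissible g \<and> (\<forall>i. g i - gvar i \<in> Y i) \<and> gsubst f \<circ> gsubst g = id \<and> gsubst g \<circ> gsubst f = id"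
proof -
  have "\<exists>z\<in>gparity 1 \<inter> gfil 3 \<inter> Y i. gsubst f z = gvar i - f i" for i
  proof (rule gsubst_surj_on[OF f])
    have "gvar i - f i = - (f i - gvar i)" by simp
    moreover have "- (f i - gvar i) \<in> gparity 1" "- (f i - gvar i) \<in> gfil 3"
      using f unfolding admissible_def by (blast intro: gparity_uminus gfil_uminus)+
    ultimately show "gvar i - f i \<in> gparity 1 \<inter> gfil 3 \<inter> Y i" using Y(4) by auto
  qed (use f Y(1-3) in \<open>auto intro: gparity_diff gfil_diff gsubst_gparity admissible_odd gsubst_gfil\<close>)
  then obtain z where z: "\<And>i. z i \<in> gparity 1" "\<And>i. z i \<in> gfil 3" "\<And>i. z i \<in> Y i"
      "\<And>i. gsubst f (z i) = gvar i - f i"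
    by (metis IntD1 IntD2)
  define g where "g i = gvar i + z i" for i
  have g: "admissible g" using z by (simp add: admissible_def g_def)
  have "gsubst f (g i) = gvar i" for i by (simp add: g_def gsubst_add z)
  then have fg: "gsubst f \<circ> gsubst g = id"
    using gsubst_comp[of f g] admissible_odd[OF f] admissible_odd[OF g] by (auto simp: gsubst_id)
  moreover have "gsubst g \<circ> gsubst f = id"
  proof
    fix a
    have "gsubst f (gsubst g (gsubst f a)) = gsubst f a" using fg by (metis comp_apply id_apply)
    then show "(gsubst g \<circ> gsubst f) a = id a" using bij_gsubst[OF f] by (simp add: bij_def inj_def)
  qed
  ultimately show ?thesis using g z(3) by (intro exI[of _ g]) (simp add: g_def)
qed

lemma gsubst_inverse:
  assumes f: "admissible f" "principal f"
  shows "\<exists>g. admissible g \<and> principal g \<and> gsubst f \<circ> gsubst g = id \<and> gsubst g \<circ> gsubst f = id"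
proof -
  have gv: "gvar i \<in> gsupp {\<alpha>. i \<in> \<alpha>}" for i
    unfolding gvar_def by (intro gsupp_gmonom) simp
  have img: "gsubst f a \<in> gsupp {\<alpha>. i \<in> \<alpha>}" if "a \<in> gsupp {\<alpha>. i \<in> \<alpha>}" for i a
    by (rule gsubst_gsupp_containing[of f, OF admissible_odd[OF f(1)] f(2) that])
  have sub: "gvar i - f i \<in> gsupp {\<alpha>. i \<in> \<alpha>}" for i
    by (rule gsupp_diff[OF gv f(2)[unfolded principal_def, rule_format]])
  have "\<exists>g. admissible g \<and> (\<forall>i. g i - gvar i \<in> gsupp {\<alpha>. i \<in> \<alpha>}) \<and>
      gsubst f \<circ> gsubst g = id \<and> gsubst g \<circ> gsubst f = id"
    by (rule gsubst_inverse_aux[OF f(1)]) (rule gsupp_zero gsupp_diff img sub | assumption)+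
  then obtain g where g: "admissible g" "\<And>i. g i - gvar i \<in> gsupp {\<alpha>. i \<in> \<alpha>}"
      "gsubst f \<circ> gsubst g = id" "gsubst g \<circ> gsubst f = id" by (elim exE conjE) metis
  then have "principal g" using gsupp_add[OF g(2) gv] by (auto simp: principal_def)
  with g show ?thesis by blast
qed

text \<open>An automorphism is determined by the images of the generators. Conversely an admissible
  substitution is bijective because it is the identity up to higher degree.\<close>

lemma Gamma_group_eq: "Gamma_group = {gsubst f | f. admissible f}"
proof (intro Set.set_eqI iffI)
  fix \<sigma> :: "('a, 'b) grassmann \<Rightarrow> ('a, 'b) grassmann"
  assume "\<sigma> \<in> Gamma_group"
  then have *: "is_algebra_automorphism \<sigma>" "\<And>i. \<sigma> (gvar i) - gvar i \<in> gparity 1 \<inter> gfil 3"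
    by (auto simp: Gamma_group_def odd_part_eq max_ideal_cubed_eq)
  then have "\<sigma> = gsubst (\<lambda>i. \<sigma> (gvar i))"
    by (intro endomorphism_eq_gsubst) (auto simp: is_algebra_automorphism_def)
  moreover have "admissible (\<lambda>i. \<sigma> (gvar i))" using * by (auto simp: admissible_def)
  ultimately show "\<sigma> \<in> {gsubst f | f. admissible f}" by blast
next
  fix \<sigma> :: "('a, 'b) grassmann \<Rightarrow> ('a, 'b) grassmann"
  assume "\<sigma> \<in> {gsubst f | f. admissible f}"
  then obtain f where f: "admissible f" "\<sigma> = gsubst f" by blast
  then show "\<sigma> \<in> Gamma_group"
    using bij_gsubst[OF f(1)] gsubst_mult[of f, OF admissible_odd[OF f(1)]] klinear_gsubst[of f]
    by (auto simp: Gamma_group_def odd_part_eq max_ideal_cubed_eq is_algebra_automorphism_def admissible_def)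
qed

lemma Sigma'_group_eq:
  "Sigma'_group = {gsubst f | f. admissible f \<and> principal f \<and> gjacobian (gsubst f) = 1}"
  by (auto simp: Sigma'_group_def Sigma_group_def Gamma_group_eq gvar_ideal_eq principal_def)

section \<open>Determinants of even matrices\<close>

text \<open>A commutative ring type, so that the library determinant applies.\<close>

typedef (overloaded) ('n::"{finite,linorder}", 'k::comm_ring_1) geven = "gparity 0 :: ('n, 'k) grassmann set"
  using one_gparity by blast

setup_lifting type_definition_geven

instantiation geven :: ("{finite,linorder}", comm_ring_1) comm_ring_1
begin

lift_definition zero_geven :: "('a, 'b) geven" is 0 by simp
lift_definition one_geven :: "('a, 'b) geven" is 1 by (rule one_gparity)
lift_definition plus_geven :: "('a, 'b) geven \<Rightarrow> ('a, 'b) geven \<Rightarrow> ('a, 'b) geven" is "(+)"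
  by (rule gparity_add)
lift_definition minus_geven :: "('a, 'b) geven \<Rightarrow> ('a, 'b) geven \<Rightarrow> ('a, 'b) geven" is "(-)"
  by (rule gparity_diff)
lift_definition uminus_geven :: "('a, 'b) geven \<Rightarrow> ('a, 'b) geven" is uminus
  by (rule gparity_uminus)
lift_definition times_geven :: "('a, 'b) geven \<Rightarrow> ('a, 'b) geven \<Rightarrow> ('a, 'b) geven" is "(*)"
  using gparity_mult[of _ 0 _ 0] by simp

instance
  by standard (transfer; simp add: algebra_simps even_central)+

end

text \<open>The Leibniz sum with factors in a fixed order, which makes sense in the noncommutative
  Grassmann algebra; the Jacobian has this shape.\<close>

definition gdet :: "('n \<Rightarrow> 'n \<Rightarrow> ('n::{finite,linorder}, 'k::comm_ring_1) grassmann) \<Rightarrow> ('n, 'k) grassmann" where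
  "gdet A = (\<Sum>p | p permutes UNIV. of_int (sign p) *
     prod_list (map (\<lambda>i. A i (p i)) (sorted_list_of_set UNIV)))"

lemma gjacobian_gsubst: "gjacobian (gsubst f) = gdet (\<lambda>i j. gpartial j (f i))"
  by (simp add: gjacobian_def gdet_def)

lemma Rep_geven_sum: "Rep_geven (\<Sum>x\<in>A. f x) = (\<Sum>x\<in>A. Rep_geven (f x))"
  by (induction A rule: infinite_finite_induct) (simp_all add: zero_geven.rep_eq plus_geven.rep_eq)

lemma Rep_geven_prod_list: "Rep_geven (prod_list xs) = prod_list (map Rep_geven xs)"
  by (induction xs) (simp_all add: one_geven.rep_eq times_geven.rep_eq)

lemma Rep_geven_of_int: "Rep_geven (of_int m) = of_int m"
proof -
  have "Rep_geven (of_nat n) = of_nat n" for n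
    by (induction n) (simp_all add: zero_geven.rep_eq one_geven.rep_eq plus_geven.rep_eq)
  then show ?thesis
    by (cases m) (simp_all add: uminus_geven.rep_eq minus_geven.rep_eq one_geven.rep_eq plus_geven.rep_eq)
qed

lemma Rep_geven_det:
  fixes M :: "((('n::{finite,linorder}, 'k::comm_ring_1) geven, 'n) vec, 'n) vec"
  shows "Rep_geven (det M) = gdet (\<lambda>i j. Rep_geven (M $ i $ j))"
proof -
  have "(\<Prod>i\<in>UNIV. M $ i $ p i) = prod_list (map (\<lambda>i. M $ i $ p i) (sorted_list_of_set UNIV))" for p
    using prod.distinct_set_conv_list[of "sorted_list_of_set (UNIV :: 'n set)" "\<lambda>i. M $ i $ p i"] by simp
  then show ?thesis
    by (simp add: det_def gdet_def Rep_geven_sum times_geven.rep_eq Rep_geven_of_int Rep_geven_prod_list o_def)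
qed

text \<open>Even entries lift to the commutative ring \<open>geven\<close>, where
  \<open>det_mul\<close> applies.\<close>

lemma gdet_mult:
  fixes A B :: "'n \<Rightarrow> 'n \<Rightarrow> ('n::{finite,linorder}, 'k::comm_ring_1) grassmann"
  assumes A: "\<And>i j. A i j \<in> gparity 0" and B: "\<And>i j. B i j \<in> gparity 0"
  shows "gdet (\<lambda>i j. \<Sum>k\<in>UNIV. A i k * B k j) = gdet A * gdet B"
proof -
  define M N :: "((('n, 'k) geven, 'n) vec, 'n) vec"
    where "M = (\<chi> i j. Abs_geven (A i j))" and "N = (\<chi> i j. Abs_geven (B i j))"
  have M: "Rep_geven (M $ i $ j) = A i j" and N: "Rep_geven (N $ i $ j) = B i j" for i j
    by (simp_all add: M_def N_def Abs_geven_inverse A B)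
  have "Rep_geven (det (M ** N)) = Rep_geven (det M) * Rep_geven (det N)"
    by (simp add: det_mul times_geven.rep_eq)
  then show ?thesis
    unfolding Rep_geven_det M N by (simp add: matrix_matrix_mult_def Rep_geven_sum times_geven.rep_eq M N)
qed

lemma gdet_gsubst:
  assumes f: "\<And>i. f i \<in> gparity 1"
  shows "gsubst f (gdet A) = gdet (\<lambda>i j. gsubst f (A i j))"
proof -
  have zero: "gsubst f 0 = 0" using gsubst_diff[of f 0 0] by simp
  have sum: "gsubst f (\<Sum>x\<in>S. h x) = (\<Sum>x\<in>S. gsubst f (h x))" for S :: "('a \<Rightarrow> 'a) set" and h
    by (induction S rule: infinite_finite_induct) (simp_all add: zero gsubst_add)
  have neg: "gsubst f (- a) = - gsubst f a" for a using gsubst_diff[of f 0 a] by (simp add: zero)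
  have sgn: "gsubst f (of_int (sign p) * a) = of_int (sign p) * gsubst f a" for p :: "'a \<Rightarrow> 'a" and a
    by (simp add: sign_def neg)
  have prod: "gsubst f (prod_list (map h xs)) = prod_list (map (\<lambda>i. gsubst f (h i)) xs)" for h and xs :: "'a list"
    by (induction xs) (simp_all add: gsubst_mult[of f, OF f])
  show ?thesis by (simp add: gdet_def sum sgn prod)
qed

section \<open>The chain rule\<close>

lemma gpartial_diff: "gpartial j (a - b) = gpartial j a - gpartial j b"
  and gpartial_gscale: "gpartial j (gscale c a) = gscale c (gpartial j a)"
  for a b :: "('n::{finite,linorder}, 'k::comm_ring_1) grassmann"
  by (rule grassmann_eqI; simp add: gcoeff_simps gcoeff_gpartial algebra_simps)+

lemma gpartial_gvar:
  "gpartial j (gvar i) = (if i = j then 1 else 0 :: ('n::{finite,linorder}, 'k::comm_ring_1) grassmann)"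
proof -
  have "is_left_skew_partial j (gpartial j :: ('n, 'k) grassmann \<Rightarrow> _)"
    by (simp add: gpartial_eq is_left_skew_partial_explicit)
  then show ?thesis by (simp add: is_left_skew_partial_def)
qed

lemma gpartial_homogeneous_mult:
  fixes a b :: "('n::{finite,linorder}, 'k::comm_ring_1) grassmann"
  assumes "a \<in> homogeneous d"
  shows "gpartial j (a * b) = gpartial j a * b + (- 1) ^ d * a * gpartial j b"
proof -
  have "is_left_skew_partial j (gpartial j :: ('n, 'k) grassmann \<Rightarrow> _)"
    by (simp add: gpartial_eq is_left_skew_partial_explicit)
  then show ?thesis using assms by (simp add: is_left_skew_partial_def)
qed

lemma gpartial_gvar_mult:
  "gpartial j (gvar i * a) = (if i = j then a else 0) - gvar i * gpartial j a"
  for a :: "('n::{finite,linorder}, 'k::comm_ring_1) grassmann"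
proof -
  have "(gvar i :: ('n, 'k) grassmann) \<in> homogeneous 1" by (simp add: homogeneous_def gvar_def gmonom.rep_eq)
  from gpartial_homogeneous_mult[OF this, of j a] show ?thesis by (auto simp: gpartial_gvar)
qed

lemma gpartial_sum: "gpartial j (\<Sum>x\<in>A. f x) = (\<Sum>x\<in>A. gpartial j (f x))"
  for f :: "'b \<Rightarrow> ('n::{finite,linorder}, 'k::comm_ring_1) grassmann"
  by (rule grassmann_eqI) (simp add: gcoeff_simps gcoeff_gpartial sum_distrib_left)

text \<open>The sign in the Leibniz rule depends on the parity of the degree only, so the
  homogeneous rule extends to all odd elements by linearity.\<close>

lemma gpartial_odd_mult:
  fixes a b :: "('n::{finite,linorder}, 'k::comm_ring_1) grassmann"
  assumes "a \<in> gparity 1"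
  shows "gpartial j (a * b) = gpartial j a * b - a * gpartial j b"
proof -
  have mon: "gpartial j (gmonom \<alpha> * b) = gpartial j (gmonom \<alpha>) * b - gmonom \<alpha> * gpartial j b"
    if "odd (card \<alpha>)" for \<alpha>
  proof -
    have "(gmonom \<alpha> :: ('n, 'k) grassmann) \<in> homogeneous (card \<alpha>)" by (simp add: homogeneous_def gmonom.rep_eq)
    from gpartial_homogeneous_mult[OF this, of j b] that show ?thesis by simp
  qed
  have "gpartial j (gscale (gcoeff a \<alpha>) (gmonom \<alpha>) * b) =
      gpartial j (gscale (gcoeff a \<alpha>) (gmonom \<alpha>)) * b - gscale (gcoeff a \<alpha>) (gmonom \<alpha>) * gpartial j b" for \<alpha>
    using mon[of \<alpha>] gsuppD[OF assms[unfolded gparity_def], of \<alpha>]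
    by (cases "odd (card \<alpha>)") (auto simp: gpartial_gscale gscale_diff_right gpartial_gscale[of j 0 0, simplified])
  then show ?thesis
    by (subst (1 2 3) grassmann_expand[of a])
      (simp add: sum_distrib_right gpartial_sum sum_subtractf)
qed

lemma gpartial_gfil: "a \<in> gfil (Suc k) \<Longrightarrow> gpartial j a \<in> gfil k"
  for a :: "('n::{finite,linorder}, 'k::comm_ring_1) grassmann"
proof -
  assume a: "a \<in> gfil (Suc k)"
  show ?thesis
    unfolding gfil_def
  proof (rule gsuppI)
    fix \<alpha> assume "\<alpha> \<notin> {\<alpha> :: 'n set. k \<le> card \<alpha>}"
    then show "gcoeff (gpartial j a) \<alpha> = 0"
      using gsuppD[OF a[unfolded gfil_def], of "insert j \<alpha>"] by (simp add: gcoeff_gpartial)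
  qed
qed

lemma gpartial_gparity: "a \<in> gparity 1 \<Longrightarrow> gpartial j a \<in> gparity 0"
  for a :: "('n::{finite,linorder}, 'k::comm_ring_1) grassmann"
proof -
  assume a: "a \<in> gparity 1"
  show ?thesis
    unfolding gparity_def
  proof (rule gsuppI)
    fix \<alpha> assume "\<alpha> \<notin> {\<alpha> :: 'n set. even (card \<alpha>) = even (0 :: nat)}"
    then show "gcoeff (gpartial j a) \<alpha> = 0"
      using gsuppD[OF a[unfolded gparity_def], of "insert j \<alpha>"] by (simp add: gcoeff_gpartial)
  qed
qed

text \<open>The chain rule. On monomials it follows by splitting off the smallest generator: the odd
  Leibniz rule before and after the substitution has the same signs because \<open>f i\<close> is as
  odd as \<open>gvar i\<close>.\<close>

lemma gpartial_gsubst: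
  fixes f :: "'n \<Rightarrow> ('n::{finite,linorder}, 'k::comm_ring_1) grassmann"
  assumes f: "\<And>i. f i \<in> gparity 1"
  shows "gpartial j (gsubst f a) = (\<Sum>k\<in>UNIV. gpartial j (f k) * gsubst f (gpartial k a))"
proof -
  have zero: "gsubst f 0 = 0" using gsubst_diff[of f 0 0] by simp
  have mon: "gpartial j (gprod f \<alpha>) = (\<Sum>k\<in>UNIV. gpartial j (f k) * gsubst f (gpartial k (gmonom \<alpha>)))" for \<alpha>
  proof -
    have "finite \<alpha>" by simp
    then show ?thesis
    proof (induction \<alpha> rule: finite_linorder_min_induct)
      case empty
      have "gpartial k (1 :: ('n, 'k) grassmann) = 0" for k
        by (rule grassmann_eqI) (simp add: gcoeff_gpartial gcoeff_simps)
      then show ?case by (simp add: gmonom_empty zero)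
    next
      case (insert i A)
      \<comment> \<open>Derivatives of odd elements are even, so they pass \<open>f i\<close>
        without a sign.\<close>
      have swap: "f i * (gpartial j (f k) * b) = gpartial j (f k) * (f i * b)" for k b
        using even_central[OF gpartial_gparity[OF f[of k]], of j "f i"] by (simp flip: mult.assoc)
      have if_gsubst: "gsubst f (if i = k then b else 0) = (if i = k then gsubst f b else 0)" for k b
        by (simp add: zero)
      have "gpartial j (gprod f (insert i A)) = gpartial j (f i) * gprod f A - f i * gpartial j (gprod f A)"
        using insert by (simp add: gprod_insert_Min gpartial_odd_mult[OF f])
      also have "\<dots> = gpartial j (f i) * gprod f A -
          (\<Sum>k\<in>UNIV. gpartial j (f k) * (f i * gsubst f (gpartial k (gmonom A))))"
        unfolding insert.IH by (simp add: sum_distrib_left swap)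
      also have "\<dots> = (\<Sum>k\<in>UNIV. gpartial j (f k) * (if i = k then gprod f A else 0) -
          gpartial j (f k) * (f i * gsubst f (gpartial k (gmonom A))))"
        by (simp add: sum_subtractf if_distrib[of "\<lambda>b. _ * b"] cong: if_cong)
      also have "\<dots> = (\<Sum>k\<in>UNIV. gpartial j (f k) * gsubst f (gpartial k (gmonom (insert i A))))"
        using insert
        by (simp add: gmonom_insert_Min gpartial_gvar_mult gsubst_diff gsubst_mult[of f, OF f] if_gsubst
          right_diff_distrib cong: if_cong)
      finally show ?case .
    qed
  qed
  have lin: "(\<Sum>\<alpha>\<in>UNIV. gscale (gcoeff a \<alpha>) (gsubst f (gpartial k (gmonom \<alpha>)))) = gsubst f (gpartial k a)" for k
  proof -
    have "gpartial k a = (\<Sum>\<alpha>\<in>UNIV. gscale (gcoeff a \<alpha>) (gpartial k (gmonom \<alpha>)))"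
      by (subst grassmann_expand[of a]) (simp add: gpartial_sum gpartial_gscale)
    then show ?thesis by (simp add: klinear_sum[OF klinear_gsubst])
  qed
  have "gpartial j (gsubst f a) = (\<Sum>\<alpha>\<in>UNIV. gscale (gcoeff a \<alpha>) (gpartial j (gprod f \<alpha>)))"
    unfolding gsubst_def by (simp add: gpartial_sum gpartial_gscale)
  also have "\<dots> = (\<Sum>k\<in>UNIV. gpartial j (f k) *
      (\<Sum>\<alpha>\<in>UNIV. gscale (gcoeff a \<alpha>) (gsubst f (gpartial k (gmonom \<alpha>)))))"
    unfolding mon by (simp add: gscale_sum_right sum_distrib_left) (rule sum.swap)
  finally show ?thesis by (simp only: lin)
qed

text \<open>The chain rule in matrix form. Its two factors may be exchanged because derivatives of
  odd elements are even; this produces a matrix product in the order required by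
  \<open>gdet_mult\<close>.\<close>

lemma gjacobian_comp:
  fixes f g :: "'n \<Rightarrow> ('n::{finite,linorder}, 'k::comm_ring_1) grassmann"
  assumes f: "\<And>i. f i \<in> gparity 1" and g: "\<And>i. g i \<in> gparity 1"
  shows "gjacobian (gsubst f \<circ> gsubst g) = gsubst f (gjacobian (gsubst g)) * gjacobian (gsubst f)"
proof -
  have comm: "gpartial j (f k) * b = b * gpartial j (f k)" for j k b
    by (rule even_central[OF gpartial_gparity[OF f]])
  have "gjacobian (gsubst f \<circ> gsubst g) = gdet (\<lambda>i j. \<Sum>k\<in>UNIV. gsubst f (gpartial k (g i)) * gpartial j (f k))"
    unfolding gsubst_comp[of f g, OF f g] gjacobian_gsubst gpartial_gsubst[of f, OF f] comm ..
  also have "\<dots> = gdet (\<lambda>i j. gsubst f (gpartial j (g i))) * gdet (\<lambda>i j. gpartial j (f i))"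
    by (rule gdet_mult) (auto intro: gsubst_gparity gpartial_gparity f g)
  finally show ?thesis by (simp add: gjacobian_gsubst gdet_gsubst[of f, OF f])
qed

text \<open>A permutation other than the identity moves at least two points, so its term in the
  Leibniz sum has two off-diagonal factors.\<close>

lemma permutes_neq_id:
  assumes "p permutes UNIV" "p \<noteq> id"
  shows "\<exists>i. p i \<noteq> i \<and> p (p i) \<noteq> p i"
proof -
  obtain i where "p i \<noteq> i" using assms(2) by (auto simp: fun_eq_iff)
  then show ?thesis using permutes_inj[OF assms(1)] by (metis injD)
qed

lemma gdet_remove_id:
  "gdet A = prod_list (map (\<lambda>i. A i i) (sorted_list_of_set UNIV)) +
    (\<Sum>p | p permutes UNIV \<and> p \<noteq> id. of_int (sign p) * prod_list (map (\<lambda>i. A i (p i)) (sorted_list_of_set UNIV)))"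
proof -
  have "{p. p permutes (UNIV :: 'a set)} = insert id {p. p permutes UNIV \<and> p \<noteq> id}"
    by (auto simp: permutes_id)
  moreover have "finite {p :: 'a \<Rightarrow> 'a. p permutes UNIV \<and> p \<noteq> id}" by simp
  ultimately show ?thesis unfolding gdet_def by (simp add: sign_id)
qed

lemma prod_list_eq_zero: "x \<in> set xs \<Longrightarrow> h x = 0 \<Longrightarrow> prod_list (map h xs) = (0 :: 'a::ring_1)"
  by (induction xs) auto

lemma prod_list_single_factor:
  "distinct xs \<Longrightarrow> prod_list (map (\<lambda>i. if i = k then u else 1) xs) = (if k \<in> set xs then u else (1 :: 'a::ring_1))"
  by (induction xs) auto

lemma gdet_single_row:
  assumes "\<And>i j. i \<noteq> k \<Longrightarrow> A i j = (if i = j then 1 else 0)"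
  shows "gdet A = A k k"
proof -
  have "prod_list (map (\<lambda>i. A i (p i)) (sorted_list_of_set UNIV)) = 0"
    if p: "p permutes UNIV" "p \<noteq> id" for p
  proof -
    obtain i where i: "p i \<noteq> i" "p (p i) \<noteq> p i" using permutes_neq_id[OF p] by blast
    \<comment> \<open>At most one of the two moved points is the exceptional row \<open>k\<close>;
      the other one selects an off-diagonal zero.\<close>
    define l where "l = (if i = k then p i else i)"
    have "l \<noteq> k" "p l \<noteq> l" using i by (auto simp: l_def)
    then have "A l (p l) = 0" using assms by simp
    then show ?thesis by (intro prod_list_eq_zero[of l]) auto
  qed
  moreover have "(\<lambda>i. A i i) = (\<lambda>i. if i = k then A k k else 1)" using assms by auto
  ultimately show ?thesis unfolding gdet_remove_id by (simp add: prod_list_single_factor)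
qed

section \<open>First order expansion of the Jacobian\<close>

lemma prod_list_gfil:
  "i \<in> set xs \<Longrightarrow> h i \<in> gfil 1 \<Longrightarrow> prod_list (map h xs) \<in> gfil 1"
  for h :: "'b \<Rightarrow> ('n::{finite,linorder}, 'k::comm_ring_1) grassmann"
proof (induction xs)
  case (Cons x xs)
  then show ?case
    using gfil_mult[of "h x" 1 "prod_list (map h xs)" 0 1] gfil_mult[of "h x" 0 "prod_list (map h xs)" 1 1] by auto
qed simp

lemma prod_list_diff_gfil:
  fixes h g :: "'b \<Rightarrow> ('n::{finite,linorder}, 'k::comm_ring_1) grassmann"
  assumes d: "\<And>i. h i - g i \<in> gfil k"
  shows "prod_list (map h xs) - prod_list (map g xs) \<in> gfil k"
proof (induction xs)
  case (Cons x xs)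
  have "prod_list (map h (x # xs)) - prod_list (map g (x # xs)) =
      (h x - g x) * prod_list (map h xs) + g x * (prod_list (map h xs) - prod_list (map g xs))"
    by (simp add: algebra_simps)
  also have "\<dots> \<in> gfil k"
    by (intro gfil_add gfil_mult[OF d gfil_0] gfil_mult[OF gfil_0 Cons.IH]) auto
  finally show ?case .
qed simp

text \<open>The telescoped difference has a factor in \<open>gfil k\<close>. As two positions of the
  product have positive degree, one of them survives next to that factor and adds a degree.\<close>

lemma prod_list_diff_off_diagonal:
  fixes h g :: "'b \<Rightarrow> ('n::{finite,linorder}, 'k::comm_ring_1) grassmann"
  assumes d: "\<And>i. h i - g i \<in> gfil k"
  shows "distinct xs \<Longrightarrow> i \<in> set xs \<Longrightarrow> j \<in> set xs \<Longrightarrow> i \<noteq> j \<Longrightarrow>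
    \<forall>l\<in>{i, j}. h l \<in> gfil 1 \<and> g l \<in> gfil 1 \<Longrightarrow>
    prod_list (map h xs) - prod_list (map g xs) \<in> gfil (Suc k)"
proof (induction xs)
  case (Cons x xs)
  have eq: "prod_list (map h (x # xs)) - prod_list (map g (x # xs)) =
      (h x - g x) * prod_list (map h xs) + g x * (prod_list (map h xs) - prod_list (map g xs))"
    by (simp add: algebra_simps)
  have "prod_list (map h xs) \<in> gfil 1"
    using Cons.prems prod_list_gfil[of i xs h] prod_list_gfil[of j xs h] by auto
  then have 1: "(h x - g x) * prod_list (map h xs) \<in> gfil (Suc k)"
    by (rule gfil_mult[OF d]) simp
  have 2: "g x * (prod_list (map h xs) - prod_list (map g xs)) \<in> gfil (Suc k)"
  proof (cases "x = i \<or> x = j")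
    case True
    then have "g x \<in> gfil 1" using Cons.prems by auto
    then show ?thesis by (rule gfil_mult[OF _ prod_list_diff_gfil[of h g, OF d]]) simp
  next
    case False
    then have "prod_list (map h xs) - prod_list (map g xs) \<in> gfil (Suc k)" using Cons by auto
    from gfil_mult[OF gfil_0 this] show ?thesis by simp
  qed
  show ?case unfolding eq by (rule gfil_add[OF 1 2])
qed simp

text \<open>All factors are 1 up to positive degree. Replacing the companions of a difference by 1
  therefore costs terms of degree at least \<open>Suc k\<close>, and only the sum of the differences
  is left.\<close>

lemma prod_list_diff_diagonal:
  fixes h g :: "'b \<Rightarrow> ('n::{finite,linorder}, 'k::comm_ring_1) grassmann"
  assumes d: "\<And>i. h i - g i \<in> gfil k" and 1: "\<And>i. h i - 1 \<in> gfil 1" "\<And>i. g i - 1 \<in> gfil 1"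
  shows "prod_list (map h xs) - prod_list (map g xs) - sum_list (map (\<lambda>i. h i - g i) xs) \<in> gfil (Suc k)"
proof (induction xs)
  case (Cons x xs)
  have one: "prod_list (map h xs) - 1 \<in> gfil 1"
    using prod_list_diff_gfil[of h "\<lambda>_. 1" 1 xs, OF 1(1)] by (simp add: map_replicate_const)
  have eq: "prod_list (map h (x # xs)) - prod_list (map g (x # xs)) - sum_list (map (\<lambda>i. h i - g i) (x # xs)) =
      (h x - g x) * (prod_list (map h xs) - 1) + (g x - 1) * (prod_list (map h xs) - prod_list (map g xs)) +
      (prod_list (map h xs) - prod_list (map g xs) - sum_list (map (\<lambda>i. h i - g i) xs))"
    by (simp add: algebra_simps)
  show ?case
    unfolding eq
    by (intro gfil_add Cons.IH gfil_mult[OF d one] gfil_mult[OF 1(2) prod_list_diff_gfil[of h g, OF d]]) auto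
qed simp

text \<open>Near the identity matrix the determinant is the trace to first order. Differentiation
  lowers the degree \<open>Suc k\<close> to \<open>k\<close>, so the trace sits in degree at least
  \<open>k\<close> and the error one degree above it.\<close>

lemma gjacobian_first_order:
  fixes f g :: "'n \<Rightarrow> ('n::{finite,linorder}, 'k::comm_ring_1) grassmann"
  assumes f: "\<And>i. f i - gvar i \<in> gfil 2" and g: "\<And>i. g i - gvar i \<in> gfil 2"
    and fg: "\<And>i. f i - g i \<in> gfil (Suc k)"
  shows "gjacobian (gsubst f) - gjacobian (gsubst g) - (\<Sum>i\<in>UNIV. gpartial i (f i - g i)) \<in> gfil (Suc k)"
proof -
  let ?L = "sorted_list_of_set (UNIV :: 'n set)"
  let ?P = "\<lambda>f p. prod_list (map (\<lambda>i. gpartial (p i) (f i)) ?L)"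
  have d: "gpartial (p i) (f i) - gpartial (p i) (g i) \<in> gfil k" for p :: "'n \<Rightarrow> 'n" and i
    using gpartial_gfil[OF fg[of i], of "p i"] by (simp add: gpartial_diff)
  have off: "gpartial j (h i) \<in> gfil 1" if "j \<noteq> i" "\<And>i. h i - gvar i \<in> gfil 2"
    for h :: "'n \<Rightarrow> ('n, 'k) grassmann" and i j
    using gpartial_gfil[of "h i - gvar i" 1 j] that
    by (simp add: gpartial_diff gpartial_gvar numeral_2_eq_2)
  have diag: "gpartial i (h i) - 1 \<in> gfil 1" if "\<And>i. h i - gvar i \<in> gfil 2"
    for h :: "'n \<Rightarrow> ('n, 'k) grassmann" and i
    using gpartial_gfil[of "h i - gvar i" 1 i] that
    by (simp add: gpartial_diff gpartial_gvar numeral_2_eq_2)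
  have 1: "?P f p - ?P g p \<in> gfil (Suc k)" if p: "p permutes UNIV" "p \<noteq> id" for p
  proof -
    obtain i where i: "p i \<noteq> i" "p (p i) \<noteq> p i" using permutes_neq_id[OF p] by blast
    show ?thesis
      by (rule prod_list_diff_off_diagonal[of "\<lambda>i. gpartial (p i) (f i)" "\<lambda>i. gpartial (p i) (g i)" k ?L i "p i"])
        (use d[of p] i off[of _ _ f, OF _ f] off[of _ _ g, OF _ g] in auto)
  qed
  have 2: "?P f id - ?P g id - (\<Sum>i\<in>UNIV. gpartial i (f i - g i)) \<in> gfil (Suc k)"
  proof -
    have "sum_list (map (\<lambda>i. gpartial i (f i) - gpartial i (g i)) ?L) = (\<Sum>i\<in>UNIV. gpartial i (f i - g i))"
      by (simp add: sum_list_distinct_conv_sum_set gpartial_diff)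
    then show ?thesis
      using prod_list_diff_diagonal[of "\<lambda>i. gpartial i (f i)" "\<lambda>i. gpartial i (g i)", OF d[of id, simplified]
        diag[of f, OF f] diag[of g, OF g], of ?L] by simp
  qed
  have eq: "gjacobian (gsubst f) - gjacobian (gsubst g) - (\<Sum>i\<in>UNIV. gpartial i (f i - g i)) =
      (?P f id - ?P g id - (\<Sum>i\<in>UNIV. gpartial i (f i - g i))) +
      (\<Sum>p | p permutes UNIV \<and> p \<noteq> id. of_int (sign p) * (?P f p - ?P g p))"
    unfolding gjacobian_gsubst gdet_remove_id by (simp add: right_diff_distrib sum_subtractf)
  show ?thesis
    unfolding eq by (intro gfil_add 2 gfil_sum gfil_of_int_mult 1) auto
qed

lemma gjacobian_id: "gjacobian (gsubst gvar) = (1 :: ('n::{finite,linorder}, 'k::comm_ring_1) grassmann)"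
  unfolding gjacobian_gsubst by (subst gdet_single_row) (auto simp: gpartial_gvar)

lemma gjacobian_even:
  assumes "\<And>i. f i \<in> gparity 1"
  shows "gjacobian (gsubst f) \<in> gparity 0"
proof -
  have "prod_list (map (\<lambda>i. gpartial (p i) (f i)) xs) \<in> gparity 0" for p and xs :: "'a list"
    by (induction xs) (use gparity_mult[of _ 0 _ 0] gpartial_gparity[OF assms] in \<open>auto simp: one_gparity\<close>)
  then show ?thesis unfolding gjacobian_gsubst gdet_def by (intro gparity_sum gparity_of_int_mult)
qed

lemma gjacobian_minus_one_gfil:
  assumes f: "\<And>i. f i - gvar i \<in> gfil 2"
  shows "gjacobian (gsubst f) - 1 \<in> gfil 1"
proof -
  have s: "(\<Sum>i\<in>UNIV. gpartial i (f i - gvar i)) \<in> gfil 1"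
    using f by (intro gfil_sum gpartial_gfil) (simp add: numeral_2_eq_2)
  have "f i - gvar i \<in> gfil (Suc 0)" for i using f by (rule gfil_mono) simp
  from gfil_add[OF gjacobian_first_order[of f gvar 0, OF f _ this, simplified gjacobian_id] s[simplified]]
  show ?thesis by simp
qed

section \<open>The top coefficient of the Jacobian\<close>

text \<open>Multiplication by \<open>u\<close> is the identity up to higher degree. Working inside
  the elements free of x_k keeps the inverse free of x_k, which \<open>berezin_single\<close> relies
  on.\<close>

lemma exists_inverse:
  fixes u :: "('n::{finite,linorder}, 'k::comm_ring_1) grassmann"
  assumes u: "u \<in> gsupp {\<alpha>. k \<notin> \<alpha>}" "u - 1 \<in> gfil 1"
  shows "\<exists>v\<in>gsupp {\<alpha>. k \<notin> \<alpha>}. v * u = 1"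
proof (rule degree_raising_surj[of "\<lambda>a. a * u"])
  show "a * u \<in> gsupp {\<alpha>. k \<notin> \<alpha>}" if "a \<in> gsupp {\<alpha>. k \<notin> \<alpha>}" for a
    by (rule gsupp_mult[OF that u(1)]) auto
  show "1 \<in> (gsupp {\<alpha>. k \<notin> \<alpha>} :: ('n, 'k) grassmann set)"
    unfolding gmonom_empty[symmetric] by (rule gsupp_gmonom) simp
  show "a * u - a \<in> gfil (Suc l)" if "a \<in> gfil l" for a l
    using gfil_mult[OF that u(2), of "Suc l"] by (simp add: right_diff_distrib)
qed (auto intro: gsupp_diff simp: left_diff_distrib)

text \<open>
  Odd variables transform with the inverse of the Jacobian: the Berezin integral, i.e. the top
  coefficient, satisfies \<open>\<integral> J(\<sigma>)\<^sup>-\<^sup>1 \<sigma>(a) = \<integral> a\<close>. Here \<open>v\<close> is the inverse of \<open>J(\<sigma>)\<close>.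
\<close>

definition berezin :: "(('n::{finite,linorder}, 'k::comm_ring_1) grassmann \<Rightarrow> ('n, 'k) grassmann) \<Rightarrow> bool" where
  "berezin \<sigma> \<longleftrightarrow> (\<exists>v. v * gjacobian \<sigma> = 1 \<and> (\<forall>a. gcoeff (v * \<sigma> a) UNIV = gcoeff a UNIV))"

text \<open>By the chain rule the inverse Jacobian of the composite is
  \<open>v * gsubst f w\<close>, so the two formulas can be applied one after the other.\<close>

lemma berezin_comp:
  fixes f g :: "'n \<Rightarrow> ('n::{finite,linorder}, 'k::comm_ring_1) grassmann"
  assumes odd: "\<And>i. f i \<in> gparity 1" "\<And>i. g i \<in> gparity 1"
    and "berezin (gsubst f)" "berezin (gsubst g)"
  shows "berezin (gsubst f \<circ> gsubst g)"
proof -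
  obtain v w where v: "v * gjacobian (gsubst f) = 1" "\<And>a. gcoeff (v * gsubst f a) UNIV = gcoeff a UNIV"
    and w: "w * gjacobian (gsubst g) = 1" "\<And>a. gcoeff (w * gsubst g a) UNIV = gcoeff a UNIV"
    using assms(3,4) by (auto simp: berezin_def)
  note mult = gsubst_mult[of f, OF odd(1)]
  have "v * gsubst f w * gjacobian (gsubst f \<circ> gsubst g) =
      v * gsubst f (w * gjacobian (gsubst g)) * gjacobian (gsubst f)"
    unfolding gjacobian_comp[of f g, OF odd] mult by (simp add: mult.assoc)
  also have "\<dots> = 1" by (simp add: v w)
  finally have 1: "v * gsubst f w * gjacobian (gsubst f \<circ> gsubst g) = 1" .
  have "v * gsubst f w * (gsubst f \<circ> gsubst g) a = v * gsubst f (w * gsubst g a)" for a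
    unfolding mult by (simp add: mult.assoc)
  then have "gcoeff (v * gsubst f w * (gsubst f \<circ> gsubst g) a) UNIV = gcoeff a UNIV" for a
    using v(2) w(2) by simp
  with 1 show ?thesis unfolding berezin_def by blast
qed

lemma gprod_cong: "(\<And>i. i \<in> \<alpha> \<Longrightarrow> f i = g i) \<Longrightarrow> gprod f \<alpha> = gprod g \<alpha>"
  unfolding gprod_def by (intro arg_cong[where f = prod_list] map_cong) auto

text \<open>Only row \<open>k\<close> of the Jacobian matrix differs from the identity, and its
  diagonal entry is \<open>u\<close>. A monomial without x_k is fixed, and multiplied by
  \<open>v\<close> it still lacks x_k, so its top coefficient is 0. A monomial with x_k acquires the
  factor \<open>u\<close>, which \<open>v\<close> cancels.\<close>

lemma berezin_single:
  fixes u :: "('n::{finite,linorder}, 'k::comm_ring_1) grassmann"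
  assumes u: "u \<in> gsupp {\<alpha>. k \<notin> \<alpha>}" "u \<in> gparity 0" "u - 1 \<in> gfil 2"
  shows "berezin (gsubst (gvar(k := gvar k * u)))"
proof -
  let ?f = "gvar(k := gvar k * u)"
  have odd: "?f i \<in> gparity 1" for i
    using gvar_gparity[of i] gparity_mult[OF gvar_gparity u(2)] by auto
  have u1: "u - 1 \<in> gfil 1" using u(3) by (rule gfil_mono) simp
  obtain v where v: "v \<in> gsupp {\<alpha>. k \<notin> \<alpha>}" "v * u = 1" using exists_inverse[OF u(1) u1] by blast
  have "gpartial k u = 0"
    by (rule grassmann_eqI) (auto simp: gcoeff_gpartial gcoeff_simps gsuppD[OF u(1)])
  then have J: "gjacobian (gsubst ?f) = u"
    unfolding gjacobian_gsubst by (subst gdet_single_row[of k]) (auto simp: gpartial_gvar gpartial_gvar_mult)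
  have mon: "gcoeff (v * gprod ?f \<alpha>) UNIV = gcoeff (gmonom \<alpha>) UNIV" for \<alpha>
  proof (cases "k \<in> \<alpha>")
    case False
    then have "gprod ?f \<alpha> = gmonom \<alpha>" unfolding gprod_gvar[symmetric] by (intro gprod_cong) auto
    moreover have "v * gmonom \<alpha> \<in> gsupp {\<alpha>. k \<notin> \<alpha>}"
      using False by (intro gsupp_mult[OF v(1) gsupp_gmonom[of \<alpha> "{\<alpha>. k \<notin> \<alpha>}"]]) auto
    ultimately show ?thesis using gsuppD[of _ "{\<alpha>. k \<notin> \<alpha>}" UNIV] False by (auto simp: gmonom.rep_eq)
  next
    case True
    have "gmonom {k} * gmonom (\<alpha> - {k}) = gscale (gsign {k} (\<alpha> - {k})) (gmonom \<alpha> :: ('n, 'k) grassmann)"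
      using True by (simp add: gmonom_mult insert_absorb)
    then have gm: "gvar k * gmonom (\<alpha> - {k}) = gscale (gsign {k} (\<alpha> - {k})) (gmonom \<alpha> :: ('n, 'k) grassmann)"
      by (simp add: gvar_def)
    have gp: "gprod ?f {k} * gprod ?f (\<alpha> - {k}) = gscale (gsign {k} (\<alpha> - {k})) (gprod ?f \<alpha>)"
      using True gprod_mult[of ?f "{k}" "\<alpha> - {k}", OF odd] by (simp add: insert_absorb)
    have "gprod ?f {k} = gvar k * u" by (simp add: gprod_def)
    moreover have "gprod ?f (\<alpha> - {k}) = gmonom (\<alpha> - {k})"
      unfolding gprod_gvar[symmetric] by (intro gprod_cong) auto
    ultimately have "v * gscale (gsign {k} (\<alpha> - {k})) (gprod ?f \<alpha>) = v * (gvar k * u * gmonom (\<alpha> - {k}))"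
      using gp by simp
    also have "\<dots> = v * u * (gvar k * gmonom (\<alpha> - {k}))"
      using even_central[OF u(2), of "gvar k"] by (simp add: mult.assoc) (simp flip: mult.assoc)
    also have "\<dots> = gscale (gsign {k} (\<alpha> - {k})) (gmonom \<alpha>)" by (simp add: v(2) gm)
    finally have "gscale (gsign {k} (\<alpha> - {k})) (v * gprod ?f \<alpha>) = gscale (gsign {k} (\<alpha> - {k})) (gmonom \<alpha>)"
      by simp
    \<comment> \<open>The equation holds up to the sign of moving x_k to the front; a sign is its
      own inverse.\<close>
    then have "gscale (tsign k (\<alpha> - {k})) (gscale (tsign k (\<alpha> - {k})) (v * gprod ?f \<alpha>)) =
        gscale (tsign k (\<alpha> - {k})) (gscale (tsign k (\<alpha> - {k})) (gmonom \<alpha>))"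
      unfolding gsign_singleton_right by (rule arg_cong)
    then show ?thesis by simp
  qed
  have "gcoeff (v * gsubst ?f a) UNIV = gcoeff a UNIV" for a
  proof -
    have "v * gsubst ?f a = (\<Sum>\<alpha>\<in>UNIV. gscale (gcoeff a \<alpha>) (v * gprod ?f \<alpha>))"
      by (simp add: gsubst_def sum_distrib_left)
    then have "gcoeff (v * gsubst ?f a) UNIV = gcoeff (\<Sum>\<alpha>\<in>UNIV. gscale (gcoeff a \<alpha>) (gmonom \<alpha>)) UNIV"
      by (simp add: gcoeff_sum gscale.rep_eq mon)
    then show ?thesis by (simp flip: grassmann_expand)
  qed
  with v(2) show ?thesis unfolding berezin_def J by blast
qed

text \<open>Substitutions are peeled off one variable at a time.\<close>

lemma berezin_principal:
  fixes f :: "'n \<Rightarrow> ('n::{finite,linorder}, 'k::comm_ring_1) grassmann"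
  assumes "admissible f" "principal f"
  shows "berezin (gsubst f)"
proof -
  \<comment> \<open>\<open>S\<close> contains all variables that the substitution may move.\<close>
  have "finite S \<Longrightarrow> admissible f \<Longrightarrow> principal f \<Longrightarrow> (\<And>i. i \<notin> S \<Longrightarrow> f i = gvar i) \<Longrightarrow> berezin (gsubst f)"
    for S and f :: "'n \<Rightarrow> ('n, 'k) grassmann"
  proof (induction S arbitrary: f rule: finite_induct)
    case empty
    then have "f = gvar" by auto
    then show ?case unfolding berezin_def by (intro exI[of _ 1]) (simp add: gjacobian_id gsubst_id)
  next
    case (insert k S)
    define u where "u = gpartial k (f k)"
    define t where "t = gvar(k := gvar k * u)"
    have fk: "f k = gvar k * u"
      using insert.prems(2) gvar_mult_gpartial[of "f k" k] by (simp add: u_def principal_def)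
    have u1: "u \<in> gsupp {\<alpha>. k \<notin> \<alpha>}" unfolding u_def by (rule gsuppI) (simp add: gcoeff_gpartial)
    have u2: "u \<in> gparity 0" unfolding u_def by (intro gpartial_gparity admissible_odd insert.prems)
    have "f k - gvar k \<in> gfil (Suc 2)" using insert.prems(1) by (simp add: admissible_def)
    from gpartial_gfil[OF this, of k] have u3: "u - 1 \<in> gfil 2"
      by (simp add: u_def gpartial_diff gpartial_gvar)
    have t: "admissible t" "principal t"
      using insert.prems(1,2) admissible_gvar principal_gvar
      by (auto simp: t_def admissible_def principal_def simp flip: fk)
    obtain s where s: "admissible s" "principal s" "gsubst t \<circ> gsubst s = id" "gsubst s \<circ> gsubst t = id"
      using gsubst_inverse[OF t] by blast
    have st: "gsubst s (gsubst t a) = a" "gsubst t (gsubst s a) = a" for a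
      using s(3,4) by (metis comp_apply id_apply)+
    \<comment> \<open>As \<open>t\<close> already sends x_k to \<open>f k\<close>, undoing it leaves
      a substitution \<open>g\<close> that fixes x_k and everything outside \<open>S\<close>; and
      \<open>gsubst f\<close> is \<open>gsubst t\<close> after \<open>gsubst g\<close>.\<close>
    define g where "g i = gsubst s (f i)" for i
    have g: "admissible g" "principal g"
      using admissible_comp[OF s(1) insert.prems(1)] insert.prems(2) s(2)
        gsubst_gsupp_containing[of s, OF admissible_odd[OF s(1)] s(2)]
      by (auto simp: g_def[abs_def] principal_def)
    have "g i = gvar i" if "i \<notin> S" for i
    proof (cases "i = k")
      case True
      then show ?thesis using st(1)[of "gvar k"] by (simp add: g_def fk t_def)
    next
      case False
      then have "f i = gvar i" using insert.prems(3) that by auto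
      with False show ?thesis using st(1)[of "gvar i"] by (simp add: g_def t_def)
    qed
    then have "berezin (gsubst g)" using insert.IH g by blast
    moreover have "berezin (gsubst t)" unfolding t_def by (rule berezin_single[OF u1 u2 u3])
    ultimately have "berezin (gsubst t \<circ> gsubst g)"
      by (intro berezin_comp admissible_odd t g)
    moreover have "gsubst t \<circ> gsubst g = gsubst f"
      unfolding gsubst_comp[of t g, OF admissible_odd[OF t(1)] admissible_odd[OF g(1)]] by (simp add: g_def st)
    ultimately show ?case by simp
  qed
  from this[of UNIV f] assms show ?thesis by simp
qed

lemma gcoeff_mult_top: "gcoeff (a * gmonom UNIV) \<gamma> = (if \<gamma> = UNIV then gcoeff a {} else 0)"
  for a :: "('n::{finite,linorder}, 'k::comm_ring_1) grassmann"
proof -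
  have "gcoeff (a * gmonom UNIV) \<gamma> = (\<Sum>\<alpha>\<in>Pow \<gamma>. if \<alpha> = {} then (if \<gamma> = UNIV then gcoeff a {} else 0) else 0)"
    unfolding times_grassmann.rep_eq gmonom.rep_eq by (rule sum.cong) auto
  then show ?thesis by (simp add: sum.delta)
qed

lemma gjacobian_eq_one:
  fixes f :: "'n \<Rightarrow> ('n::{finite,linorder}, 'k::comm_ring_1) grassmann"
  assumes f: "admissible f" "principal f"
    and J: "\<And>\<alpha>. \<alpha> \<noteq> {} \<Longrightarrow> \<alpha> \<noteq> UNIV \<Longrightarrow> gcoeff (gjacobian (gsubst f)) \<alpha> = 0"
  shows "gjacobian (gsubst f) = 1"
proof -
  define c where "c = gcoeff (gjacobian (gsubst f)) UNIV"
  have "gjacobian (gsubst f) - 1 \<in> gfil 1"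
    by (rule gjacobian_minus_one_gfil[of f, OF admissible_gfil2[OF f(1)]])
  from gsuppD[OF this[unfolded gfil_def], of "{}"] have J0: "gcoeff (gjacobian (gsubst f)) {} = 1"
    by (simp add: gcoeff_simps)
  have eq: "gjacobian (gsubst f) = 1 + gscale c (gmonom UNIV)"
    by (rule grassmann_eqI) (auto simp: gcoeff_simps c_def J0 J)
  obtain v where v: "v * gjacobian (gsubst f) = 1" "\<And>a. gcoeff (v * gsubst f a) UNIV = gcoeff a UNIV"
    using berezin_principal[OF f] by (auto simp: berezin_def)
  \<comment> \<open>The formula for the constant 1, whose own top coefficient is 0 since the set of
    generators is nonempty. It says that the inverse of J has no top term.\<close>
  have v0: "gcoeff v UNIV = 0" using v(2)[of 1] by (simp add: gcoeff_simps)
  have vc: "gcoeff v \<alpha> + c * gcoeff (v * gmonom UNIV) \<alpha> = gcoeff 1 \<alpha>" for \<alpha>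
    using arg_cong[OF v(1), of "\<lambda>x. gcoeff x \<alpha>"] by (simp add: eq distrib_left gcoeff_simps)
  have "gcoeff v {} = 1" using vc[of "{}"] by (simp add: gcoeff_mult_top gcoeff_simps)
  then have "c = 0" using vc[of UNIV] by (simp add: gcoeff_mult_top gcoeff_simps v0)
  then show ?thesis by (simp add: eq)
qed

section \<open>Relations compatible with the ring operations\<close>

text \<open>
  Three instances are used: the graph of a ring homomorphism (base change), congruence modulo an
  ideal of a subring, and membership in a subring.
\<close>

locale ring_relation =
  fixes E :: "'k::comm_ring_1 \<Rightarrow> 'l::comm_ring_1 \<Rightarrow> bool"
  assumes E_zero: "E 0 0" and E_one: "E 1 1"
    and E_add: "E a b \<Longrightarrow> E c d \<Longrightarrow> E (a + c) (b + d)"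
    and E_mult: "E a b \<Longrightarrow> E c d \<Longrightarrow> E (a * c) (b * d)"
    and E_uminus: "E a b \<Longrightarrow> E (- a) (- b)"
begin

lemma E_diff: "E a b \<Longrightarrow> E c d \<Longrightarrow> E (a - c) (b - d)"
  using E_add[OF _ E_uminus, of a b c d] by simp

lemma E_sum: "(\<And>x. x \<in> A \<Longrightarrow> E (f x) (g x)) \<Longrightarrow> E (\<Sum>x\<in>A. f x) (\<Sum>x\<in>A. g x)"
  by (induction A rule: infinite_finite_induct) (auto intro: E_zero E_add)

lemma E_prod: "(\<And>x. x \<in> A \<Longrightarrow> E (f x) (g x)) \<Longrightarrow> E (\<Prod>x\<in>A. f x) (\<Prod>x\<in>A. g x)"
  by (induction A rule: infinite_finite_induct) (auto intro: E_one E_mult)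

lemma E_power: "E a b \<Longrightarrow> E (a ^ n) (b ^ n)"
  by (induction n) (auto intro: E_one E_mult)

lemma E_poly_eval:
  assumes "\<And>a. E (\<phi> a) (\<psi> a)" "\<And>v. v \<in> poly_vars p \<Longrightarrow> E (c v) (d v)"
  shows "E (poly_eval \<phi> c p) (poly_eval \<psi> d p)"
  unfolding poly_eval_def
  by (intro E_sum E_mult E_prod E_power assms) (auto simp: poly_vars_def)

text \<open>Substitution, derivatives and Jacobian are polynomials with integer coefficients in the
  coefficients of their data, so they all preserve this relation.\<close>

definition grel :: "('n, 'k) grassmann \<Rightarrow> ('n, 'l) grassmann \<Rightarrow> bool" where
  "grel a b \<longleftrightarrow> (\<forall>\<alpha>. E (gcoeff a \<alpha>) (gcoeff b \<alpha>))"

lemma grelD: "grel a b \<Longrightarrow> E (gcoeff a \<alpha>) (gcoeff b \<alpha>)"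
  by (simp add: grel_def)

lemma E_minus_one_power: "E ((- 1) ^ n) ((- 1) ^ n)"
  by (intro E_power E_uminus E_one)

lemma grel_zero: "grel (0 :: ('n::{finite,linorder}, 'k) grassmann) 0"
  and grel_one: "grel (1 :: ('n::{finite,linorder}, 'k) grassmann) 1"
  and grel_gmonom: "grel (gmonom \<alpha> :: ('n::{finite,linorder}, 'k) grassmann) (gmonom \<alpha>)"
  by (auto simp: grel_def gcoeff_simps intro: E_zero E_one)

lemma grel_add: "grel a b \<Longrightarrow> grel a' b' \<Longrightarrow> grel (a + a') (b + b')"
  and grel_diff: "grel a b \<Longrightarrow> grel a' b' \<Longrightarrow> grel (a - a') (b - b')"
  and grel_uminus: "grel a b \<Longrightarrow> grel (- a) (- b)"
  and grel_gscale: "E x y \<Longrightarrow> grel a b \<Longrightarrow> grel (gscale x a) (gscale y b)"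
  and grel_mult: "grel a b \<Longrightarrow> grel a' b' \<Longrightarrow> grel (a * a') (b * b')"
  and grel_gpartial: "grel a b \<Longrightarrow> grel (gpartial j a) (gpartial j b)"
  for a a' :: "('n::{finite,linorder}, 'k) grassmann" and b b' :: "('n, 'l) grassmann"
  unfolding grel_def
  by (auto simp: gcoeff_simps times_grassmann.rep_eq gcoeff_gpartial gsign_def tsign_def
      intro!: E_sum E_minus_one_power intro: E_zero E_add E_diff E_uminus E_mult)

lemma grel_sum: "(\<And>x. x \<in> A \<Longrightarrow> grel (f x) (g x)) \<Longrightarrow> grel (\<Sum>x\<in>A. f x) (\<Sum>x\<in>A. g x)"
  for f :: "'b \<Rightarrow> ('n::{finite,linorder}, 'k) grassmann"
  by (induction A rule: infinite_finite_induct) (auto intro: grel_zero grel_add)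

lemma grel_prod_list: "(\<And>x. grel (f x) (g x)) \<Longrightarrow> grel (prod_list (map f xs)) (prod_list (map g xs))"
  for f :: "'b \<Rightarrow> ('n::{finite,linorder}, 'k) grassmann"
  by (induction xs) (auto intro: grel_one grel_mult)

lemma grel_gsubst: "(\<And>i. grel (f i) (g i)) \<Longrightarrow> grel a b \<Longrightarrow> grel (gsubst f a) (gsubst g b)"
  for a :: "('n::{finite,linorder}, 'k) grassmann"
  unfolding gsubst_def gprod_def by (intro grel_sum grel_gscale grelD grel_prod_list)

lemma grel_gjacobian: "(\<And>i. grel (f i) (g i)) \<Longrightarrow> grel (gjacobian (gsubst f)) (gjacobian (gsubst g))"
  for f :: "'n \<Rightarrow> ('n::{finite,linorder}, 'k) grassmann"
proof -
  assume fg: "\<And>i. grel (f i) (g i)"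
  have sgn: "grel (of_int (sign p) * a) (of_int (sign p) * b)" if "grel a b"
    for p :: "'n \<Rightarrow> 'n" and a :: "('n::{finite,linorder}, 'k) grassmann" and b
    using that grel_uminus[OF that] by (simp add: sign_def)
  show ?thesis
    unfolding gjacobian_gsubst gdet_def by (intro grel_sum sgn grel_prod_list grel_gpartial fg)
qed

end

section \<open>Polynomials\<close>

definition is_ring_hom :: "('a::comm_ring_1 \<Rightarrow> 'b::comm_ring_1) \<Rightarrow> bool" where
  "is_ring_hom h \<longleftrightarrow> h 1 = 1 \<and> (\<forall>a b. h (a + b) = h a + h b) \<and> (\<forall>a b. h (a * b) = h a * h b)"

lemma is_ring_hom_zero: "is_ring_hom h \<Longrightarrow> h 0 = 0"
  unfolding is_ring_hom_def by (metis add.right_neutral add_left_cancel)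

lemma is_ring_hom_uminus: "is_ring_hom h \<Longrightarrow> h (- a) = - h a"
  using is_ring_hom_zero[of h] unfolding is_ring_hom_def by (metis add.right_inverse minus_unique)

lemma ring_relation_hom: "is_ring_hom h \<Longrightarrow> ring_relation (\<lambda>a b. b = h a)"
  by standard (auto simp: is_ring_hom_zero is_ring_hom_uminus, auto simp: is_ring_hom_def)

lemma is_ring_hom_iff:
  "h \<in> ring_hom ring_of_type_algebra ring_of_type_algebra \<longleftrightarrow> is_ring_hom h"
  for h :: "'a::comm_ring_1 \<Rightarrow> 'b::comm_ring_1"
  by (auto simp: ring_hom_def ring_of_type_algebra_def is_ring_hom_def)

lemma is_ring_hom_Const: "is_ring_hom (Const :: 'k::comm_ring_1 \<Rightarrow> ('v, 'k) mpoly)"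
  by (auto simp: is_ring_hom_def Const_def single_add mult_single single_one)

definition mon_eval :: "('v \<Rightarrow> 'r::comm_ring_1) \<Rightarrow> ('v \<Rightarrow>\<^sub>0 nat) \<Rightarrow> 'r" where
  "mon_eval c m = (\<Prod>v\<in>Poly_Mapping.keys m. c v ^ Poly_Mapping.lookup m v)"

lemma mon_eval_superset:
  assumes "finite A" "Poly_Mapping.keys m \<subseteq> A"
  shows "mon_eval c m = (\<Prod>v\<in>A. c v ^ Poly_Mapping.lookup m v)"
  unfolding mon_eval_def using assms
  by (intro prod.mono_neutral_left) (auto simp: in_keys_iff)

lemma mon_eval_add: "mon_eval c (m + m') = mon_eval c m * mon_eval c m'"
proof -
  let ?A = "Poly_Mapping.keys m \<union> Poly_Mapping.keys m'"
  have "mon_eval c x = (\<Prod>v\<in>?A. c v ^ Poly_Mapping.lookup x v)" if "x = m \<or> x = m' \<or> x = m + m'" for x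
    using that keys_add[of m m'] by (intro mon_eval_superset) auto
  then show ?thesis by (simp add: lookup_add power_add prod.distrib)
qed

lemma poly_eval_superset:
  assumes "is_ring_hom \<phi>" "finite A" "Poly_Mapping.keys p \<subseteq> A"
  shows "poly_eval \<phi> c p = (\<Sum>m\<in>A. \<phi> (Poly_Mapping.lookup p m) * mon_eval c m)"
  unfolding poly_eval_def mon_eval_def using assms is_ring_hom_zero[OF assms(1)]
  by (intro sum.mono_neutral_left) (auto simp: in_keys_iff)

lemma poly_eval_single:
  "is_ring_hom \<phi> \<Longrightarrow> poly_eval \<phi> c (Poly_Mapping.single m a) = \<phi> a * mon_eval c m"
  by (subst poly_eval_superset[of \<phi> "{m}"]) auto

lemma poly_eval_add:
  assumes "is_ring_hom \<phi>"
  shows "poly_eval \<phi> c (p + q) = poly_eval \<phi> c p + poly_eval \<phi> c q"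
proof -
  let ?A = "Poly_Mapping.keys p \<union> Poly_Mapping.keys q"
  have "poly_eval \<phi> c x = (\<Sum>m\<in>?A. \<phi> (Poly_Mapping.lookup x m) * mon_eval c m)"
    if "x = p \<or> x = q \<or> x = p + q" for x
    using that keys_add[of p q] by (intro poly_eval_superset[OF assms]) auto
  then show ?thesis using assms by (simp add: lookup_add is_ring_hom_def distrib_right sum.distrib)
qed

lemma poly_eval_zero [simp]: "poly_eval \<phi> c 0 = 0"
  by (simp add: poly_eval_def)

lemma poly_eval_sum:
  "is_ring_hom \<phi> \<Longrightarrow> poly_eval \<phi> c (\<Sum>x\<in>A. f x) = (\<Sum>x\<in>A. poly_eval \<phi> c (f x))"
  by (induction A rule: infinite_finite_induct) (simp_all add: poly_eval_add)

lemma poly_mapping_eq_sum_single: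
  "(p :: 'm \<Rightarrow>\<^sub>0 'k::comm_monoid_add) = (\<Sum>m\<in>Poly_Mapping.keys p. Poly_Mapping.single m (Poly_Mapping.lookup p m))"
  by (rule poly_mapping_eqI) (auto simp: lookup_sum lookup_single when_def in_keys_iff)

lemma is_ring_hom_poly_eval:
  assumes \<phi>: "is_ring_hom \<phi>"
  shows "is_ring_hom (poly_eval \<phi> c)"
  unfolding is_ring_hom_def
proof (intro conjI allI)
  have "poly_eval \<phi> c (Poly_Mapping.single 0 1) = 1"
    by (subst poly_eval_single[OF \<phi>]) (use \<phi> in \<open>simp add: mon_eval_def is_ring_hom_def\<close>)
  then show "poly_eval \<phi> c 1 = 1" by simp
next
  fix p q
  have \<phi>m: "\<phi> (a * b) = \<phi> a * \<phi> b" for a b using \<phi> by (simp add: is_ring_hom_def)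
  show "poly_eval \<phi> c (p + q) = poly_eval \<phi> c p + poly_eval \<phi> c q" by (rule poly_eval_add[OF \<phi>])
  have "p * q = (\<Sum>m\<in>Poly_Mapping.keys p. Poly_Mapping.single m (Poly_Mapping.lookup p m)) *
      (\<Sum>m\<in>Poly_Mapping.keys q. Poly_Mapping.single m (Poly_Mapping.lookup q m))"
    by (simp flip: poly_mapping_eq_sum_single)
  also have "poly_eval \<phi> c \<dots> =
      (\<Sum>m\<in>Poly_Mapping.keys p. \<phi> (Poly_Mapping.lookup p m) * mon_eval c m) *
      (\<Sum>m\<in>Poly_Mapping.keys q. \<phi> (Poly_Mapping.lookup q m) * mon_eval c m)"
    by (simp add: sum_product poly_eval_sum[OF \<phi>] mult_single poly_eval_single[OF \<phi>] \<phi>m mon_eval_add ac_simps)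
  finally show "poly_eval \<phi> c (p * q) = poly_eval \<phi> c p * poly_eval \<phi> c q"
    by (simp add: poly_eval_superset[OF \<phi>, of "Poly_Mapping.keys p" p] poly_eval_superset[OF \<phi>, of "Poly_Mapping.keys q" q])
qed

lemma poly_eval_Var: "is_ring_hom \<phi> \<Longrightarrow> poly_eval \<phi> c (Var v) = c v"
  unfolding Var_def by (subst poly_eval_single) (auto simp: mon_eval_def is_ring_hom_def)

lemma poly_eval_Const: "is_ring_hom \<phi> \<Longrightarrow> poly_eval \<phi> c (Const a) = \<phi> a"
  unfolding Const_def by (subst poly_eval_single) (auto simp: mon_eval_def)

lemma mon_eval_Var: "mon_eval Var m = (Poly_Mapping.single m 1 :: ('v, 'k::comm_ring_1) mpoly)"
proof -
  have pw: "(Var v :: ('v, 'k) mpoly) ^ n = Poly_Mapping.single (Poly_Mapping.single v n) 1" for v n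
  proof (induction n)
    case (Suc n)
    then show ?case by (simp add: Var_def mult_single flip: single_add)
  qed simp
  have "(\<Prod>v\<in>A. Var v ^ Poly_Mapping.lookup m v) =
      (Poly_Mapping.single (\<Sum>v\<in>A. Poly_Mapping.single v (Poly_Mapping.lookup m v)) 1 :: ('v, 'k) mpoly)" for A
    by (induction A rule: infinite_finite_induct) (simp_all add: pw mult_single flip: single_one)
  then show ?thesis unfolding mon_eval_def by (simp flip: poly_mapping_eq_sum_single)
qed

lemma poly_eval_Const_Var: "poly_eval Const Var p = p"
  by (subst poly_eval_superset[OF is_ring_hom_Const, of "Poly_Mapping.keys p"])
    (simp_all add: mon_eval_Var Const_def mult_single flip: poly_mapping_eq_sum_single)

lemma poly_vars_add: "poly_vars (p + q) \<subseteq> poly_vars p \<union> poly_vars q"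
  unfolding poly_vars_def using keys_add[of p q] by blast

lemma poly_vars_mult: "poly_vars (p * q) \<subseteq> poly_vars p \<union> poly_vars q"
  unfolding poly_vars_def using keys_mult[of p q] keys_add by fastforce

lemma poly_vars_uminus: "poly_vars (- p) = poly_vars p"
  by (simp add: poly_vars_def in_keys_iff set_eq_iff)

lemma poly_vars_Const: "poly_vars (Const a) = {}"
  by (auto simp: poly_vars_def Const_def split: if_splits)

lemma poly_vars_Var: "poly_vars (Var v :: ('v, 'k::comm_ring_1) mpoly) = {v}"
  by (auto simp: poly_vars_def Var_def)

section \<open>Polynomial rings in a given set of variables and their ideals\<close>

lemma poly_ring_simps:
  "carrier (poly_ring V) = {p. poly_vars p \<subseteq> V}"
  "monoid.mult (poly_ring V) = (*)" "ring.add (poly_ring V) = (+)"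
  "monoid.one (poly_ring V) = 1" "ring.zero (poly_ring V) = 0"
  by (simp_all add: poly_ring_def ring_of_type_algebra_def)

lemma poly_carrier_closed:
  "0 \<in> carrier (poly_ring V)" "1 \<in> carrier (poly_ring V)"
  "p \<in> carrier (poly_ring V) \<Longrightarrow> q \<in> carrier (poly_ring V) \<Longrightarrow> p + q \<in> carrier (poly_ring V)"
  "p \<in> carrier (poly_ring V) \<Longrightarrow> q \<in> carrier (poly_ring V) \<Longrightarrow> p * q \<in> carrier (poly_ring V)"
  "p \<in> carrier (poly_ring V) \<Longrightarrow> - p \<in> carrier (poly_ring V)"
  "Const a \<in> carrier (poly_ring V)"
  "v \<in> V \<Longrightarrow> Var v \<in> carrier (poly_ring V)"
  using poly_vars_add[of p q] poly_vars_mult[of p q] poly_vars_Const[of "1 :: 'b"]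
  by (auto simp: poly_ring_simps poly_vars_uminus poly_vars_Const poly_vars_Var)
    (auto simp: poly_vars_def)

lemma cring_poly_ring: "cring (poly_ring V :: ('v, 'k::comm_ring_1) mpoly ring)"
proof (rule cringI)
  show "abelian_group (poly_ring V :: ('v, 'k) mpoly ring)"
  proof (rule abelian_groupI)
    fix p :: "('v, 'k) mpoly" assume "p \<in> carrier (poly_ring V)"
    then show "\<exists>q\<in>carrier (poly_ring V). q \<oplus>\<^bsub>poly_ring V\<^esub> p = \<zero>\<^bsub>poly_ring V\<^esub>"
      using poly_carrier_closed(5) by (intro bexI[of _ "- p"]) (auto simp: poly_ring_simps(2-))
  qed (use poly_carrier_closed in \<open>auto simp: poly_ring_simps(2-) ac_simps\<close>)
  show "Group.comm_monoid (poly_ring V :: ('v, 'k) mpoly ring)"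
    by (rule comm_monoidI) (use poly_carrier_closed in \<open>auto simp: poly_ring_simps(2-) ac_simps\<close>)
qed (auto simp: poly_ring_simps(2-) distrib_right)

lemma poly_ring_a_inv: "p \<in> carrier (poly_ring V) \<Longrightarrow> \<ominus>\<^bsub>poly_ring V\<^esub> p = - p"
proof -
  assume p: "p \<in> carrier (poly_ring V)"
  interpret cring "poly_ring V" by (rule cring_poly_ring)
  show ?thesis
    by (rule minus_equality) (use p poly_carrier_closed(5)[OF p] in \<open>auto simp: poly_ring_simps(2-)\<close>)
qed

lemma poly_ideal_closed:
  assumes "ideal I (poly_ring V)"
  shows "0 \<in> I" "I \<subseteq> carrier (poly_ring V)"
    "p \<in> I \<Longrightarrow> q \<in> I \<Longrightarrow> p + q \<in> I" "p \<in> I \<Longrightarrow> - p \<in> I"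
    "p \<in> I \<Longrightarrow> q \<in> carrier (poly_ring V) \<Longrightarrow> q * p \<in> I"
proof -
  interpret ideal I "poly_ring V" by (rule assms)
  show sub: "I \<subseteq> carrier (poly_ring V)" by (auto dest: a_subset[THEN subsetD])
  show "0 \<in> I" using additive_subgroup.zero_closed[OF ideal.axioms(1)[OF assms]] by (simp add: poly_ring_simps)
  show "p + q \<in> I" if "p \<in> I" "q \<in> I" using additive_subgroup.a_closed[OF ideal.axioms(1)[OF assms] that] by (simp add: poly_ring_simps)
  show "- p \<in> I" if "p \<in> I" using additive_subgroup.a_inv_closed[OF ideal.axioms(1)[OF assms] that] that sub by (auto simp: poly_ring_a_inv)
  show "q * p \<in> I" if "p \<in> I" "q \<in> carrier (poly_ring V)" using I_l_closed[OF that] by (simp add: poly_ring_simps)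
qed

text \<open>Related pairs are equal, so preservation of this relation says that a construction does
  not leave the subring.\<close>

lemma ring_relation_carrier: "ring_relation (\<lambda>p q. p = q \<and> p \<in> carrier (poly_ring V))"
  by standard (auto intro: poly_carrier_closed)

text \<open>\<open>I\<close> is an ideal of K[V] and not of the whole polynomial type, so
  multiplying a congruence requires both sides to be in K[V].\<close>

lemma ring_relation_cong:
  assumes I: "ideal I (poly_ring V)"
  shows "ring_relation (\<lambda>p q. p \<in> carrier (poly_ring V) \<and> q \<in> carrier (poly_ring V) \<and> p - q \<in> I)"
proof
  fix a b c d :: "('a, 'b) mpoly"
  note I = poly_ideal_closed[OF assms]
  assume 1: "a \<in> carrier (poly_ring V) \<and> b \<in> carrier (poly_ring V) \<and> a - b \<in> I"
  have "- a - - b = - (a - b)" by simp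
  then show "- a \<in> carrier (poly_ring V) \<and> - b \<in> carrier (poly_ring V) \<and> - a - - b \<in> I"
    using 1 I(4)[of "a - b"] poly_carrier_closed(5) by auto
  assume 2: "c \<in> carrier (poly_ring V) \<and> d \<in> carrier (poly_ring V) \<and> c - d \<in> I"
  have eq: "a + c - (b + d) = (a - b) + (c - d)" by simp
  show "a + c \<in> carrier (poly_ring V) \<and> b + d \<in> carrier (poly_ring V) \<and> a + c - (b + d) \<in> I"
    unfolding eq using 1 2 I(3)[of "a - b" "c - d"] poly_carrier_closed(3) by blast
  have "a * c - b * d = c * (a - b) + b * (c - d)" by (simp add: algebra_simps)
  then show "a * c \<in> carrier (poly_ring V) \<and> b * d \<in> carrier (poly_ring V) \<and> a * c - b * d \<in> I"
    using 1 2 I(3,5) poly_carrier_closed(4) by auto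
qed (use poly_ideal_closed[OF I] poly_carrier_closed in auto)

lemma poly_eval_carrier:
  assumes "\<And>a. \<phi> a \<in> carrier (poly_ring W)" "\<And>v. v \<in> poly_vars p \<Longrightarrow> c v \<in> carrier (poly_ring W)"
  shows "poly_eval \<phi> c p \<in> carrier (poly_ring W)"
proof -
  interpret ring_relation "\<lambda>p q. p = q \<and> p \<in> carrier (poly_ring W)" by (rule ring_relation_carrier)
  show ?thesis using E_poly_eval[of \<phi> \<phi> p c c] assms by blast
qed

lemma genideal_subset_kernel:
  assumes h: "is_ring_hom h" and G: "G \<subseteq> carrier (poly_ring V)" and "\<And>p. p \<in> G \<Longrightarrow> h p = 0"
    and p: "p \<in> genideal (poly_ring V) G"
  shows "h p = 0"
proof -
  interpret cring "poly_ring V" by (rule cring_poly_ring)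
  have "ideal {p \<in> carrier (poly_ring V). h p = 0} (poly_ring V)"
  proof (rule idealI[OF ring_axioms])
    show "subgroup {p \<in> carrier (poly_ring V). h p = 0} (add_monoid (poly_ring V))"
    proof (rule group.subgroupI[OF a_group])
      show "{p \<in> carrier (poly_ring V). h p = 0} \<noteq> {}"
        using is_ring_hom_zero[OF h] poly_carrier_closed(1) by blast
    next
      fix a assume "a \<in> {p \<in> carrier (poly_ring V). h p = 0}"
      then show "inv\<^bsub>add_monoid (poly_ring V)\<^esub> a \<in> {p \<in> carrier (poly_ring V). h p = 0}"
        using poly_ring_a_inv[of a V] poly_carrier_closed(5)[of a V] is_ring_hom_uminus[OF h, of a]
        unfolding a_inv_def by simp
    next
      fix a b assume "a \<in> {p \<in> carrier (poly_ring V). h p = 0}" "b \<in> {p \<in> carrier (poly_ring V). h p = 0}"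
      then show "a \<otimes>\<^bsub>add_monoid (poly_ring V)\<^esub> b \<in> {p \<in> carrier (poly_ring V). h p = 0}"
        using h poly_carrier_closed(3)[of a V b] by (simp add: poly_ring_simps(2-) is_ring_hom_def)
    qed auto
  qed (use h poly_carrier_closed(4) in \<open>auto simp: poly_ring_simps(2-) is_ring_hom_def\<close>)
  then have "genideal (poly_ring V) G \<subseteq> {p \<in> carrier (poly_ring V). h p = 0}"
    by (rule genideal_minimal) (use assms in auto)
  with p show ?thesis by blast
qed

section \<open>Coordinates\<close>

text \<open>The images of the generators under \<open>Gamma_elem c\<close>; values of
  \<open>c\<close> off \<open>Gamma_coords\<close> have no influence
  (\<open>gen_cong\<close>).\<close>

definition gen :: "('n::{finite,linorder} \<times> 'n set \<Rightarrow> 'k::comm_ring_1) \<Rightarrow> 'n \<Rightarrow> ('n, 'k) grassmann" where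
  "gen c i = gvar i + (\<Sum>\<beta> | (i, \<beta>) \<in> Gamma_coords. gscale (c (i, \<beta>)) (gmonom \<beta>))"

lemma Gamma_elem_eq: "Gamma_elem c = gsubst (gen c)"
  by (rule ext) (simp add: Gamma_elem_def gsubst_def gprod_def gen_def[abs_def])

lemma gcoeff_gen_minus_gvar:
  "gcoeff (gen c i - gvar i) \<beta> = (if (i, \<beta>) \<in> Gamma_coords then c (i, \<beta>) else 0)"
proof -
  have "gcoeff (gen c i - gvar i) \<beta> =
      (\<Sum>\<gamma> | (i, \<gamma>) \<in> Gamma_coords. if \<gamma> = \<beta> then c (i, \<beta>) else 0)"
    unfolding gen_def add_diff_cancel_left' gcoeff_sum gscale.rep_eq gmonom.rep_eq
    by (rule sum.cong) auto
  then show ?thesis by (simp add: sum.delta)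
qed

lemma gcoeff_gen: "gcoeff (gen c i) \<beta> = gcoeff (gvar i) \<beta> + (if (i, \<beta>) \<in> Gamma_coords then c (i, \<beta>) else 0)"
  using gcoeff_gen_minus_gvar[of c i \<beta>] by (simp add: minus_grassmann.rep_eq algebra_simps)

lemma gen_cong: "(\<And>v. v \<in> Gamma_coords \<Longrightarrow> c v = d v) \<Longrightarrow> gen c = gen d"
  by (rule ext, rule grassmann_eqI) (simp add: gcoeff_gen)

lemma admissible_gen: "admissible (gen c)"
  by (auto simp: admissible_def gparity_def gfil_def gcoeff_gen_minus_gvar Gamma_coords_def
      intro!: gsuppI split: if_splits)

lemma gen_odd: "gen c i \<in> gparity 1"
  by (rule admissible_odd[OF admissible_gen])

lemma gcoord_gsubst: "gcoord (gsubst f) (i, \<beta>) = gcoeff (f i - gvar i) \<beta>"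
  by (simp add: gcoord_def)

lemma gcoord_gen: "v \<in> Gamma_coords \<Longrightarrow> gcoord (gsubst (gen c)) v = c v"
  by (cases v) (simp add: gcoord_gsubst gcoeff_gen_minus_gvar)

lemma gen_gcoord:
  assumes "admissible f"
  shows "gen (gcoord (gsubst f)) = f"
proof (rule ext, rule grassmann_eqI)
  fix i \<beta>
  have "f i - gvar i \<in> gparity 1" "f i - gvar i \<in> gfil 3" using assms by (auto simp: admissible_def)
  then have "gcoeff (f i - gvar i) \<beta> = 0" if "(i, \<beta>) \<notin> Gamma_coords"
    using that gsuppD[of "f i - gvar i" _ \<beta>] by (auto simp: gparity_def gfil_def Gamma_coords_def)
  then show "gcoeff (gen (gcoord (gsubst f)) i) \<beta> = gcoeff (f i) \<beta>"
    by (auto simp: gcoeff_gen gcoord_gsubst minus_grassmann.rep_eq)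
qed

lemma principal_gen: "principal (gen c) \<longleftrightarrow> (\<forall>i \<beta>. (i, \<beta>) \<in> Gamma_coords \<longrightarrow> i \<notin> \<beta> \<longrightarrow> c (i, \<beta>) = 0)"
proof -
  have "gcoeff (gen c i) \<beta> = (if (i, \<beta>) \<in> Gamma_coords then c (i, \<beta>) else 0)" if "i \<notin> \<beta>" for i \<beta>
    using that by (auto simp: gcoeff_gen gvar_def gmonom.rep_eq)
  then have *: "i \<notin> \<beta> \<longrightarrow> gcoeff (gen c i) \<beta> = 0 \<longleftrightarrow> ((i, \<beta>) \<in> Gamma_coords \<longrightarrow> i \<notin> \<beta> \<longrightarrow> c (i, \<beta>) = 0)"
    if "i \<notin> \<beta>" for i \<beta> using that by simp
  have "principal (gen c) \<longleftrightarrow> (\<forall>i \<beta>. i \<notin> \<beta> \<longrightarrow> gcoeff (gen c i) \<beta> = 0)"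
    unfolding principal_def gsupp_def by blast
  then show ?thesis using * by blast
qed

lemma (in ring_relation) grel_gen:
  fixes c :: "'n::{finite,linorder} \<times> 'n set \<Rightarrow> 'k"
  assumes "\<And>v. v \<in> Gamma_coords \<Longrightarrow> E (c v) (d v)"
  shows "grel (gen c i) (gen d i)"
  unfolding grel_def gcoeff_gen gvar_def gmonom.rep_eq
  by (auto intro!: E_add intro: assms E_zero E_one)

definition jac :: "('n::{finite,linorder} \<times> 'n set \<Rightarrow> 'k::comm_ring_1) \<Rightarrow> 'n set \<Rightarrow> 'k" where
  "jac c \<alpha> = gcoeff (gjacobian (gsubst (gen c))) \<alpha>"

lemma (in ring_relation) E_jac:
  fixes c :: "'n::{finite,linorder} \<times> 'n set \<Rightarrow> 'k"
  assumes "\<And>v. v \<in> Gamma_coords \<Longrightarrow> E (c v) (d v)"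
  shows "E (jac c \<alpha>) (jac d \<alpha>)"
  unfolding jac_def by (intro grelD grel_gjacobian grel_gen assms)

lemma jac_odd: "odd (card \<alpha>) \<Longrightarrow> jac c \<alpha> = 0"
  using gjacobian_even[of "gen c", OF gen_odd] gsuppD[of _ _ \<alpha>] by (auto simp: jac_def gparity_def)

text \<open>The triangular shape of the equations: changing only coordinates above degree
  \<open>k\<close> changes the coefficients of J up to degree \<open>k\<close> by linear terms with
  unit coefficients, and by nothing below degree \<open>k\<close>. It is the trace of
  \<open>gjacobian_first_order\<close> read off coefficientwise.\<close>

lemma jac_diff:
  fixes c d :: "'n::{finite,linorder} \<times> 'n set \<Rightarrow> 'k::comm_ring_1"
  assumes cd: "\<And>i \<beta>. (i, \<beta>) \<in> Gamma_coords \<Longrightarrow> card \<beta> \<le> k \<Longrightarrow> c (i, \<beta>) = d (i, \<beta>)"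
    and \<alpha>: "card \<alpha> \<le> k"
  shows "jac c \<alpha> - jac d \<alpha> = (\<Sum>i\<in>- \<alpha>. if (i, insert i \<alpha>) \<in> Gamma_coords
    then tsign i \<alpha> * (c (i, insert i \<alpha>) - d (i, insert i \<alpha>)) else 0)"
proof -
  have co: "gcoeff (gen c i - gen d i) \<beta> = (if (i, \<beta>) \<in> Gamma_coords then c (i, \<beta>) - d (i, \<beta>) else 0)" for i \<beta>
    by (simp add: minus_grassmann.rep_eq gcoeff_gen)
  have gf: "gen c i - gen d i \<in> gfil (Suc k)" for i
    unfolding gfil_def by (rule gsuppI) (auto simp: co cd not_less_eq_eq)
  from gjacobian_first_order[of "gen c" "gen d", OF admissible_gfil2[OF admissible_gen]
      admissible_gfil2[OF admissible_gen] gf]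
  have "gcoeff (gjacobian (gsubst (gen c)) - gjacobian (gsubst (gen d)) -
      (\<Sum>i\<in>UNIV. gpartial i (gen c i - gen d i))) \<alpha> = 0"
    by (rule gsuppD[OF _, of _ "{\<alpha>. Suc k \<le> card \<alpha>}", folded gfil_def]) (use \<alpha> in auto)
  then have "jac c \<alpha> - jac d \<alpha> = (\<Sum>i\<in>UNIV. gcoeff (gpartial i (gen c i - gen d i)) \<alpha>)"
    by (simp add: jac_def gcoeff_simps)
  also have "\<dots> = (\<Sum>i\<in>- \<alpha>. gcoeff (gpartial i (gen c i - gen d i)) \<alpha>)"
    by (rule sum.mono_neutral_right) (auto simp: gcoeff_gpartial)
  also have "\<dots> = (\<Sum>i\<in>- \<alpha>. if (i, insert i \<alpha>) \<in> Gamma_coords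
      then tsign i \<alpha> * (c (i, insert i \<alpha>) - d (i, insert i \<alpha>)) else 0)"
    by (rule sum.cong) (simp_all add: gcoeff_gpartial co)
  finally show ?thesis .
qed

section \<open>The zeros of the ideal of \<open>\<Sigma>'\<close>\<close>

abbreviation (input) "Sigma'_generators \<equiv>
  {gcoeff (gjacobian (Gamma_elem Var) - 1) \<alpha> | \<alpha>. True} \<union> {gcoeff (Gamma_elem Var (gvar i)) \<alpha> | i \<alpha>. i \<notin> \<alpha>}"

lemma Sigma'_generators_carrier:
  "(Sigma'_generators :: ('n::{finite,linorder} \<times> 'n set, 'k::comm_ring_1) mpoly set) \<subseteq>
    carrier (poly_ring Gamma_coords)"
proof -
  interpret ring_relation "\<lambda>p q. p = q \<and> p \<in> carrier (poly_ring (Gamma_coords :: ('n \<times> 'n set) set))"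
    by (rule ring_relation_carrier)
  have g: "grel (gen Var i) (gen Var i :: ('n, ('n \<times> 'n set, 'k) mpoly) grassmann)" for i
    by (rule grel_gen) (auto intro: poly_carrier_closed)
  have "gcoeff (gjacobian (Gamma_elem Var) - 1) \<alpha> \<in> carrier (poly_ring Gamma_coords :: ('n \<times> 'n set, 'k) mpoly ring)" for \<alpha>
    using grelD[OF grel_diff[OF grel_gjacobian[of "gen Var" "gen Var", OF g] grel_one], of \<alpha>]
    by (simp add: Gamma_elem_eq)
  moreover have "gcoeff (Gamma_elem Var (gvar i)) \<alpha> \<in> carrier (poly_ring Gamma_coords :: ('n \<times> 'n set, 'k) mpoly ring)" for i \<alpha>
    using grelD[OF g[of i], of \<alpha>] by (simp add: Gamma_elem_eq)
  ultimately show ?thesis by blast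
qed

lemma ideal_Sigma': "ideal Sigma'_ideal (poly_ring Gamma_coords)"
  unfolding Sigma'_ideal_def
  by (rule ring.genideal_ideal[OF cring.axioms(1)[OF cring_poly_ring] Sigma'_generators_carrier])

lemma Sigma'_generators_subset: "Sigma'_generators \<subseteq> Sigma'_ideal"
  unfolding Sigma'_ideal_def
  by (rule ring.genideal_self[OF cring.axioms(1)[OF cring_poly_ring] Sigma'_generators_carrier])

lemma jac_Var_in_ideal: "\<alpha> \<noteq> {} \<Longrightarrow> jac Var \<alpha> \<in> Sigma'_ideal"
proof -
  assume "\<alpha> \<noteq> {}"
  then have "jac Var \<alpha> = gcoeff (gjacobian (Gamma_elem Var) - 1) \<alpha>"
    by (simp add: jac_def Gamma_elem_eq gcoeff_simps)
  then show ?thesis using Sigma'_generators_subset by blast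
qed

lemma Var_in_ideal: "(i, \<beta>) \<in> Gamma_coords \<Longrightarrow> i \<notin> \<beta> \<Longrightarrow> Var (i, \<beta>) \<in> Sigma'_ideal"
proof -
  assume v: "(i, \<beta>) \<in> Gamma_coords" "i \<notin> \<beta>"
  then have "gcoeff (gen Var i) \<beta> = Var (i, \<beta>)"
    by (auto simp: gcoeff_gen gvar_def gmonom.rep_eq)
  then have eq: "gcoeff (Gamma_elem Var (gvar i)) \<beta> = Var (i, \<beta>)" by (simp add: Gamma_elem_eq)
  have "gcoeff (Gamma_elem Var (gvar i)) \<beta> \<in> Sigma'_generators" using v(2) by blast
  from subsetD[OF Sigma'_generators_subset this] show ?thesis unfolding eq .
qed

text \<open>Evaluation at \<open>c\<close> is a ring homomorphism that carries the generic
  substitution to the one with coordinates \<open>c\<close>, hence the generic equations to those of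
  the latter.\<close>

lemma Sigma'_ideal_zeros:
  fixes c :: "'n::{finite,linorder} \<times> 'n set \<Rightarrow> 'r::comm_ring_1"
  assumes \<phi>: "is_ring_hom \<phi>"
  shows "(\<forall>p\<in>Sigma'_ideal. poly_eval \<phi> c p = 0) \<longleftrightarrow> principal (gen c) \<and> gjacobian (gsubst (gen c)) = 1"
proof -
  let ?h = "poly_eval \<phi> c"
  have h: "is_ring_hom ?h" by (rule is_ring_hom_poly_eval[OF \<phi>])
  interpret ring_relation "\<lambda>a b. b = ?h a" by (rule ring_relation_hom[OF h])
  have g: "grel (gen Var i) (gen c i)" for i
    by (rule grel_gen) (simp add: poly_eval_Var[OF \<phi>])
  have 1: "?h (gcoeff (gjacobian (Gamma_elem Var) - 1) \<alpha>) = gcoeff (gjacobian (gsubst (gen c)) - 1) \<alpha>" for \<alpha>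
    using grelD[OF grel_diff[OF grel_gjacobian[of "gen Var" "gen c", OF g] grel_one], of \<alpha>]
    by (simp add: Gamma_elem_eq)
  have 2: "?h (gcoeff (Gamma_elem Var (gvar i)) \<alpha>) = gcoeff (gen c i) \<alpha>" for i \<alpha>
    using grelD[OF g[of i], of \<alpha>] by (simp add: Gamma_elem_eq)
  have "(\<forall>p\<in>Sigma'_ideal. ?h p = 0) \<longleftrightarrow> (\<forall>p\<in>Sigma'_generators. ?h p = 0)"
    using genideal_subset_kernel[OF h Sigma'_generators_carrier] Sigma'_generators_subset
    unfolding Sigma'_ideal_def by blast
  also have "\<dots> \<longleftrightarrow> (\<forall>\<alpha>. gcoeff (gjacobian (gsubst (gen c)) - 1) \<alpha> = 0) \<and> (\<forall>i \<alpha>. i \<notin> \<alpha> \<longrightarrow> gcoeff (gen c i) \<alpha> = 0)"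
    unfolding 1[symmetric] 2[symmetric] by blast
  also have "(\<forall>\<alpha>. gcoeff (gjacobian (gsubst (gen c)) - 1) \<alpha> = 0) \<longleftrightarrow> gjacobian (gsubst (gen c)) - 1 = 0"
    by (metis grassmann_eqI zero_grassmann.rep_eq)
  also have "(\<forall>i \<alpha>. i \<notin> \<alpha> \<longrightarrow> gcoeff (gen c i) \<alpha> = 0) \<longleftrightarrow> principal (gen c)"
    unfolding principal_def gsupp_def by blast
  finally show ?thesis by (simp add: conj_commute)
qed

section \<open>Points over an algebra and the group law\<close>

lemma subgroup_Sigma':
  "subgroup (Sigma'_group :: (('n::{finite,linorder}, 'r::comm_ring_1) grassmann \<Rightarrow> _) set) (BijGroup UNIV)"
proof -
  interpret G: group "BijGroup (UNIV :: ('n, 'r) grassmann set)" by (rule group_BijGroup)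
  have carr: "carrier (BijGroup UNIV) = {\<sigma> :: ('n, 'r) grassmann \<Rightarrow> ('n, 'r) grassmann. bij \<sigma>}"
    by (simp add: BijGroup_def Bij_def extensional_def)
  have mult: "\<sigma> \<otimes>\<^bsub>BijGroup UNIV\<^esub> \<tau> = \<sigma> \<circ> \<tau>" if "bij \<sigma>" "bij \<tau>"
    for \<sigma> \<tau> :: "('n, 'r) grassmann \<Rightarrow> ('n, 'r) grassmann"
    using that by (auto simp: BijGroup_def Bij_def extensional_def compose_def)
  have one: "\<one>\<^bsub>BijGroup UNIV\<^esub> = (id :: ('n, 'r) grassmann \<Rightarrow> ('n, 'r) grassmann)"
    by (auto simp: BijGroup_def)
  have bij: "bij \<sigma>" if "\<sigma> \<in> Sigma'_group" for \<sigma> :: "('n, 'r) grassmann \<Rightarrow> ('n, 'r) grassmann"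
    using that by (auto simp: Sigma'_group_eq bij_gsubst)
  have id: "id = gsubst (gvar :: 'n \<Rightarrow> ('n, 'r) grassmann)" by (auto simp: gsubst_id)
  show ?thesis
  proof (rule G.subgroupI)
    show "(Sigma'_group :: (('n, 'r) grassmann \<Rightarrow> ('n, 'r) grassmann) set) \<subseteq> carrier (BijGroup UNIV)"
      using bij by (auto simp: carr)
    show "(Sigma'_group :: (('n, 'r) grassmann \<Rightarrow> ('n, 'r) grassmann) set) \<noteq> {}"
      using admissible_gvar principal_gvar gjacobian_id by (auto simp: Sigma'_group_eq)
  next
    fix \<sigma> :: "('n, 'r) grassmann \<Rightarrow> ('n, 'r) grassmann" assume \<sigma>: "\<sigma> \<in> Sigma'_group"
    then obtain f where f: "\<sigma> = gsubst f" "admissible f" "principal f" "gjacobian (gsubst f) = 1"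
      by (auto simp: Sigma'_group_eq)
    obtain g where g: "admissible g" "principal g" "gsubst f \<circ> gsubst g = id" "gsubst g \<circ> gsubst f = id"
      using gsubst_inverse[OF f(2,3)] by blast
    have "gsubst g (gjacobian (gsubst f)) * gjacobian (gsubst g) = 1"
      using gjacobian_comp[of g f, OF admissible_odd[OF g(1)] admissible_odd[OF f(2)]]
      by (simp add: g(4) id gjacobian_id)
    then have "gjacobian (gsubst g) = 1" by (simp add: f(4))
    then have "gsubst g \<in> Sigma'_group" using g by (auto simp: Sigma'_group_eq)
    moreover have "inv\<^bsub>BijGroup UNIV\<^esub> \<sigma> = gsubst g"
      by (rule G.inv_equality) (simp_all add: mult carr one f g bij_gsubst)
    ultimately show "inv\<^bsub>BijGroup UNIV\<^esub> \<sigma> \<in> Sigma'_group" by simp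
  next
    fix \<sigma> \<tau> :: "('n, 'r) grassmann \<Rightarrow> ('n, 'r) grassmann"
    assume "\<sigma> \<in> Sigma'_group" "\<tau> \<in> Sigma'_group"
    then obtain f g where f: "\<sigma> = gsubst f" "admissible f" "principal f" "gjacobian (gsubst f) = 1"
      and g: "\<tau> = gsubst g" "admissible g" "principal g" "gjacobian (gsubst g) = 1"
      by (auto simp: Sigma'_group_eq)
    note odd = admissible_odd[OF f(2)] admissible_odd[OF g(2)]
    have "principal (\<lambda>i. gsubst f (g i))"
      using gsubst_gsupp_containing[of f, OF odd(1) f(3)] g(3) by (simp add: principal_def)
    moreover have "gjacobian (gsubst f \<circ> gsubst g) = 1"
      using gjacobian_comp[of f g, OF odd] f(4) g(4) by simp
    ultimately have "gsubst f \<circ> gsubst g \<in> Sigma'_group"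
      using admissible_comp[OF f(2) g(2)] by (auto simp: Sigma'_group_eq gsubst_comp[of f g, OF odd])
    then show "\<sigma> \<otimes>\<^bsub>BijGroup UNIV\<^esub> \<tau> \<in> Sigma'_group"
      using f g by (simp add: mult bij_gsubst)
  qed
qed

lemma bij_betw_coordinates:
  fixes \<phi> :: "'k::comm_ring_1 \<Rightarrow> 'r::comm_ring_1"
  assumes \<phi>: "is_ring_hom \<phi>"
  shows "bij_betw (\<lambda>\<sigma>. restrict (gcoord \<sigma>) Gamma_coords)
    (Sigma'_group :: (('n::{finite,linorder}, 'r) grassmann \<Rightarrow> ('n, 'r) grassmann) set)
    {c \<in> Gamma_coords \<rightarrow>\<^sub>E UNIV. \<forall>p \<in> Sigma'_ideal. poly_eval \<phi> c p = 0}"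
proof (rule bij_betw_byWitness[of _ "\<lambda>c. gsubst (gen c)"])
  have restr: "gen (restrict c Gamma_coords) = gen c" for c :: "'n \<times> 'n set \<Rightarrow> 'r"
    by (rule gen_cong) simp
  show "\<forall>\<sigma>\<in>Sigma'_group :: (('n, 'r) grassmann \<Rightarrow> ('n, 'r) grassmann) set.
      gsubst (gen (restrict (gcoord \<sigma>) Gamma_coords)) = \<sigma>"
    by (auto simp: Sigma'_group_eq restr gen_gcoord)
  show "\<forall>c\<in>{c \<in> Gamma_coords \<rightarrow>\<^sub>E UNIV. \<forall>p \<in> Sigma'_ideal. poly_eval \<phi> c p = 0}.
      restrict (gcoord (gsubst (gen c))) Gamma_coords = (c :: 'n \<times> 'n set \<Rightarrow> 'r)"
    by (auto simp: gcoord_gen PiE_def extensional_def fun_eq_iff)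
  show "(\<lambda>\<sigma>. restrict (gcoord \<sigma>) Gamma_coords) ` (Sigma'_group :: (('n, 'r) grassmann \<Rightarrow> ('n, 'r) grassmann) set)
      \<subseteq> {c \<in> Gamma_coords \<rightarrow>\<^sub>E UNIV. \<forall>p \<in> Sigma'_ideal. poly_eval \<phi> c p = 0}"
    by (auto simp: Sigma'_group_eq Sigma'_ideal_zeros[OF \<phi>, THEN iffD2, rule_format] restr gen_gcoord)
  show "(\<lambda>c. gsubst (gen c)) ` {c \<in> Gamma_coords \<rightarrow>\<^sub>E UNIV. \<forall>p \<in> Sigma'_ideal. poly_eval \<phi> c p = 0}
      \<subseteq> (Sigma'_group :: (('n, 'r) grassmann \<Rightarrow> ('n, 'r) grassmann) set)"
    unfolding Sigma'_ideal_zeros[OF \<phi>] Sigma'_group_eq using admissible_gen by blast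
qed

lemma gen_Gamma_comult:
  "gen Gamma_comult = (\<lambda>i. gsubst (gen (\<lambda>v. Var (Inl v))) (gen (\<lambda>v. Var (Inr v)) i))"
  unfolding Gamma_comult_def Gamma_elem_eq gsubst_comp[of "gen _" "gen _", OF gen_odd gen_odd]
  by (rule gen_gcoord[OF admissible_comp[OF admissible_gen admissible_gen]])

text \<open>The product is computed once for two generic elements and then specialised along the
  evaluation homomorphism.\<close>

lemma gcoord_comp:
  fixes \<phi> :: "'k::comm_ring_1 \<Rightarrow> 'r::comm_ring_1"
    and \<sigma> \<tau> :: "('n::{finite,linorder}, 'r) grassmann \<Rightarrow> ('n, 'r) grassmann"
  assumes \<phi>: "is_ring_hom \<phi>" and "\<sigma> \<in> Sigma'_group" "\<tau> \<in> Sigma'_group"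
  shows "gcoord (\<sigma> \<circ> \<tau>) v = poly_eval \<phi> (case_sum (gcoord \<sigma>) (gcoord \<tau>)) (Gamma_comult v)"
proof -
  obtain f g where f: "\<sigma> = gsubst f" "admissible f" and g: "\<tau> = gsubst g" "admissible g"
    using assms(2,3) by (auto simp: Sigma'_group_eq)
  let ?h = "poly_eval \<phi> (case_sum (gcoord \<sigma>) (gcoord \<tau>))"
  have h: "is_ring_hom ?h" by (rule is_ring_hom_poly_eval[OF \<phi>])
  interpret ring_relation "\<lambda>a b. b = ?h a" by (rule ring_relation_hom[OF h])
  have 1: "grel (gen (\<lambda>v. Var (Inl v)) i) (gen (gcoord \<sigma>) i)"
    and 2: "grel (gen (\<lambda>v. Var (Inr v)) i) (gen (gcoord \<tau>) i)" for i
    by (rule grel_gen, simp add: poly_eval_Var[OF \<phi>])+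
  obtain i \<beta> where v: "v = (i, \<beta>)" by force
  have "grel (gvar i :: ('n, _) grassmann) (gvar i)" unfolding gvar_def by (rule grel_gmonom)
  from grelD[OF grel_diff[OF grel_gsubst[of "gen _" "gen _", OF 1 2[of i]] this], of \<beta>]
  have "gcoeff (gsubst (gen (gcoord \<sigma>)) (gen (gcoord \<tau>) i) - gvar i) \<beta> = ?h (Gamma_comult v)"
    by (simp add: v Gamma_comult_def gcoord_def Gamma_elem_eq)
  then show ?thesis
    unfolding f(1) g(1) gen_gcoord[OF f(2)] gen_gcoord[OF g(2)] by (simp add: v gcoord_gsubst gcoord_def)
qed

section \<open>Unipotence\<close>

lemma exists_enumeration_by_decreasing_card:
  "\<exists>N. \<exists>e :: nat \<Rightarrow> 'n::finite set. bij_betw e {..<N} UNIV \<and> (\<forall>r<N. \<forall>s<r. card (e r) \<le> card (e s))"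
proof -
  obtain xs where xs: "set xs = (UNIV :: 'n set set)" "distinct xs"
    using finite_distinct_list[of "UNIV :: 'n set set"] by auto
  \<comment> \<open>Complementary sizes as keys turn increasing sorting into decreasing
    cardinality.\<close>
  define ys where "ys = sort_key (\<lambda>\<alpha>. CARD('n) - card \<alpha>) xs"
  have ys: "set ys = UNIV" "distinct ys" "sorted (map (\<lambda>\<alpha>. CARD('n) - card \<alpha>) ys)"
    using xs by (simp_all add: ys_def)
  have len: "length ys = card (UNIV :: 'n set set)"
    using distinct_card[OF ys(2)] ys(1) by simp
  have bij: "bij_betw ((!) ys) {..<card (UNIV :: 'n set set)} UNIV"
    using bij_betw_nth[OF ys(2), of "{..<card (UNIV :: 'n set set)}" UNIV] ys(1) len by simp
  have "card (ys ! r) \<le> card (ys ! s)" if "r < card (UNIV :: 'n set set)" "s < r" for r s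
  proof -
    have "CARD('n) - card (ys ! s) \<le> CARD('n) - card (ys ! r)"
      using sorted_nth_mono[OF ys(3), of s r] that len by simp
    moreover have "card (ys ! r) \<le> CARD('n)" "card (ys ! s) \<le> CARD('n)" by (simp_all add: card_mono)
    ultimately show ?thesis by linarith
  qed
  with bij show ?thesis by blast
qed

text \<open>Composition is matrix multiplication, in the same order: the column at \<alpha> holds
  the image of the monomial \<alpha>.\<close>

lemma gcoeff_gprod_gsubst_comp:
  assumes f: "\<And>i. f i \<in> gparity 1" and g: "\<And>i. g i \<in> gparity 1"
  shows "gcoeff (gprod (\<lambda>i. gsubst f (g i)) \<alpha>) \<beta> =
    (\<Sum>\<gamma>\<in>UNIV. gcoeff (gprod f \<gamma>) \<beta> * gcoeff (gprod g \<alpha>) \<gamma>)"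
proof -
  have "gprod (\<lambda>i. gsubst f (g i)) \<alpha> = (gsubst f \<circ> gsubst g) (gmonom \<alpha>)"
    unfolding gsubst_comp[of f g, OF f g] by simp
  also have "\<dots> = (\<Sum>\<gamma>\<in>UNIV. gscale (gcoeff (gprod g \<alpha>) \<gamma>) (gprod f \<gamma>))"
    by (simp add: gsubst_def[of f])
  finally show ?thesis by (simp add: gcoeff_simps mult.commute)
qed

lemma (in ring_relation) E_gprod_gen:
  fixes c :: "'n::{finite,linorder} \<times> 'n set \<Rightarrow> 'k"
  assumes "\<And>v. v \<in> Gamma_coords \<Longrightarrow> E (c v) (d v)"
  shows "E (gcoeff (gprod (gen c) \<alpha>) \<beta>) (gcoeff (gprod (gen d) \<alpha>) \<beta>)"
  unfolding gprod_def by (intro grelD grel_prod_list grel_gen assms)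

lemma gprod_gen_hom:
  assumes "is_ring_hom h"
  shows "h (gcoeff (gprod (gen c) \<alpha>) \<beta>) = gcoeff (gprod (gen (\<lambda>v. h (c v))) \<alpha>) \<beta>"
proof -
  interpret ring_relation "\<lambda>a b. b = h a" by (rule ring_relation_hom[OF assms])
  show ?thesis using E_gprod_gen[where c = c and \<alpha> = \<alpha> and \<beta> = \<beta>, OF refl] by simp
qed

text \<open>
  The faithful unitriangular representation is the action on the Grassmann algebra, in the monomial
  basis ordered by decreasing degree: \<open>\<sigma>(x\<^sup>\<alpha>) - x\<^sup>\<alpha>\<close> only involves monomials of degree
  larger than \<open>|\<alpha>|\<close>, and the columns at the generators contain all coordinates.
\<close>

lemma is_unipotent_Sigma':
  "is_unipotent_group Gamma_coords (Sigma'_ideal :: ('n::{finite,linorder} \<times> 'n set, 'k::comm_ring_1) mpoly set) Gamma_comult"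
proof -
  let ?I = "Sigma'_ideal :: ('n \<times> 'n set, 'k) mpoly set"
  obtain N and e :: "nat \<Rightarrow> 'n set" where e: "bij_betw e {..<N} UNIV"
    and mono: "\<And>r s. r < N \<Longrightarrow> s < r \<Longrightarrow> card (e r) \<le> card (e s)"
    using exists_enumeration_by_decreasing_card[where 'n = 'n] by blast
  define u :: "nat \<Rightarrow> nat \<Rightarrow> ('n \<times> 'n set, 'k) mpoly"
    where "u r s = gcoeff (gprod (gen Var) (e s)) (e r)" for r s
  note I = poly_ideal_closed[OF ideal_Sigma'[where 'a = 'n and 'b = 'k]]
  have carr: "u r s \<in> carrier (poly_ring Gamma_coords)" for r s
  proof -
    interpret ring_relation "\<lambda>p q. p = q \<and> p \<in> carrier (poly_ring (Gamma_coords :: ('n \<times> 'n set) set))"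
      by (rule ring_relation_carrier)
    show ?thesis unfolding u_def
      by (rule E_gprod_gen[where c = Var and d = Var, THEN conjunct2]) (simp add: poly_carrier_closed(7))
  qed
  have tri: "u r s = (if r = s then 1 else 0)" if "r < N" "s \<le> r" for r s
  proof -
    have le: "card (e r) \<le> card (e s)" using mono[of r s] that by (cases "s = r") auto
    have "gprod (gen Var) (e s) - gmonom (e s) \<in> (gfil (Suc (card (e s))) :: ('n, ('n \<times> 'n set, 'k) mpoly) grassmann set)"
      by (rule gprod_gfil[of "gen Var", OF admissible_gfil2[OF admissible_gen]])
    from gsuppD[OF this[unfolded gfil_def], of "e r"] le
    have "u r s = gcoeff (gmonom (e s)) (e r)" by (simp add: u_def minus_grassmann.rep_eq)
    moreover have "e r = e s \<longleftrightarrow> r = s"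
      using bij_betw_imp_inj_on[OF e] that by (auto simp: inj_on_def)
    ultimately show ?thesis by (auto simp: gmonom.rep_eq)
  qed
  let ?l = "poly_eval Const (\<lambda>v. Var (Inl v)) :: _ \<Rightarrow> (('n \<times> 'n set) + ('n \<times> 'n set), 'k) mpoly"
  let ?r = "poly_eval Const (\<lambda>v. Var (Inr v)) :: _ \<Rightarrow> (('n \<times> 'n set) + ('n \<times> 'n set), 'k) mpoly"
  have hom: "poly_eval Const d (u r s) = gcoeff (gprod (gen d) (e s)) (e r)"
    for d :: "'n \<times> 'n set \<Rightarrow> ('w, 'k) mpoly" and r s
    unfolding u_def gprod_gen_hom[OF is_ring_hom_poly_eval[OF is_ring_hom_Const]]
    by (simp add: poly_eval_Var[OF is_ring_hom_Const])
  have mult: "poly_eval Const Gamma_comult (u r s) - (\<Sum>t<N. ?l (u r t) * ?r (u t s)) = 0" for r s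
  proof -
    have "(\<Sum>t<N. ?l (u r t) * ?r (u t s)) = (\<Sum>\<gamma>\<in>UNIV.
        gcoeff (gprod (gen (\<lambda>v. Var (Inl v))) \<gamma>) (e r) * gcoeff (gprod (gen (\<lambda>v. Var (Inr v))) (e s)) \<gamma>)"
      unfolding hom by (rule sum.reindex_bij_betw[OF e])
    then show ?thesis
      unfolding hom gen_Gamma_comult gcoeff_gprod_gsubst_comp[of "gen _" "gen _", OF gen_odd gen_odd] by simp
  qed
  have gen_q: "\<exists>q\<in>carrier (poly_ring ({..<N} \<times> {..<N})). p - poly_eval Const (\<lambda>(r, s). u r s) q \<in> ?I"
    if p: "p \<in> carrier (poly_ring Gamma_coords)" for p :: "('n \<times> 'n set, 'k) mpoly"
  proof -
    \<comment> \<open>The coordinate \<open>(i, \<beta>)\<close> is the matrix entry in row \<beta>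
      and column \<open>{i}\<close>, so this matrix variable represents it.\<close>
    define w :: "'n \<times> 'n set \<Rightarrow> (nat \<times> nat, 'k) mpoly"
      where "w = (\<lambda>(i, \<beta>). Var (inv_into {..<N} e \<beta>, inv_into {..<N} e {i}))"
    have inv: "inv_into {..<N} e \<beta> < N" "e (inv_into {..<N} e \<beta>) = \<beta>" for \<beta>
      using bij_betw_imp_surj_on[OF e] inv_into_into[of \<beta> e "{..<N}"] f_inv_into_f[of \<beta> e "{..<N}"] by auto
    have "poly_eval Const w p \<in> carrier (poly_ring ({..<N} \<times> {..<N}))"
      by (rule poly_eval_carrier) (auto simp: w_def inv intro!: poly_carrier_closed)
    moreover have "poly_eval Const (\<lambda>(r, s). u r s) (poly_eval Const w p) = p"
    proof -
      let ?h = "poly_eval Const (\<lambda>(r, s). u r s)"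
      interpret ring_relation "\<lambda>a b. b = ?h a"
        by (rule ring_relation_hom[OF is_ring_hom_poly_eval[OF is_ring_hom_Const]])
      have "Var v = ?h (w v)" if "v \<in> poly_vars p" for v
      proof -
        obtain i \<beta> where v: "v = (i, \<beta>)" by force
        with that p have "(i, \<beta>) \<in> Gamma_coords" by (auto simp: poly_ring_simps)
        \<comment> \<open>Coordinates have degree at least 3, so the summand \<open>gvar i\<close>
          does not disturb this entry.\<close>
        moreover from this have "\<beta> \<noteq> {i}" by (auto simp: Gamma_coords_def)
        ultimately have "u (inv_into {..<N} e \<beta>) (inv_into {..<N} e {i}) = Var v"
          by (simp add: u_def inv v gprod_def gcoeff_gen gvar_def gmonom.rep_eq)
        then show ?thesis by (simp add: v w_def poly_eval_Var[OF is_ring_hom_Const])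
      qed
      from E_poly_eval[where \<phi> = Const and \<psi> = Const and c = w and d = Var and p = p, OF _ this]
      show ?thesis by (simp add: poly_eval_Const_Var poly_eval_Const[OF is_ring_hom_Const])
    qed
    ultimately show ?thesis using I(1) by (intro bexI[of _ "poly_eval Const w p"]) simp_all
  qed
  have zero: "0 \<in> genideal (poly_ring V) S" for V :: "'w set" and S :: "('w, 'k) mpoly set"
    unfolding genideal_def using poly_ideal_closed(1) by blast
  show ?thesis
    unfolding is_unipotent_group_def Let_def
    by (intro exI[of _ N] exI[of _ u] conjI allI impI ballI)
      (simp_all add: carr tri I(1) mult zero gen_q)
qed

section \<open>Solving the equations of \<open>\<Sigma>'\<close>\<close>

definition pick :: "'n set \<Rightarrow> 'n" where
  "pick \<alpha> = (SOME i. i \<notin> \<alpha>)"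

lemma pick_notin: "\<alpha> \<noteq> UNIV \<Longrightarrow> pick \<alpha> \<notin> \<alpha>"
  unfolding pick_def by (rule someI_ex) auto

text \<open>
  The equation at \<open>\<alpha>\<close> contains the coordinates \<open>(i, \<alpha> \<union> {i})\<close>, \<open>i \<notin> \<alpha>\<close>, linearly with unit
  coefficients, next to coordinates of lower degree; it is solved for \<open>i = pick \<alpha>\<close>.
\<close>

definition free_coords :: "('n::{finite,linorder} \<times> 'n set) set" where
  "free_coords = {(i, \<beta>) \<in> Gamma_coords. i \<in> \<beta> \<and> i \<noteq> pick (\<beta> - {i})}"

lemma insert_in_Gamma_coords:
  fixes \<alpha> :: "'n::{finite,linorder} set"
  assumes "even (card \<alpha>)" "\<alpha> \<noteq> {}" "i \<notin> \<alpha>"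
  shows "(i, insert i \<alpha>) \<in> Gamma_coords"
proof -
  have "card \<alpha> \<noteq> 0" using assms(2) by simp
  moreover have "card \<alpha> \<noteq> 1" using assms(1) by auto
  ultimately have "2 \<le> card \<alpha>" by linarith
  then show ?thesis using assms by (simp add: Gamma_coords_def)
qed

text \<open>Equations are solved degree by degree, over any subring \<open>S\<close>. A correction
  in degree \<open>Suc k\<close> repairs the equations at degree \<open>k\<close> without spoiling
  the earlier ones, by \<open>jac_diff\<close>.\<close>

lemma exists_solution_upto:
  fixes w :: "'n::{finite,linorder} \<times> 'n set \<Rightarrow> 'r::comm_ring_1"
  assumes S: "ring_relation (\<lambda>p q. p = q \<and> p \<in> S)" and w: "\<forall>v\<in>free_coords. w v \<in> S"
  shows "\<exists>c. (\<forall>v. c v \<in> S) \<and> (\<forall>v\<in>free_coords. c v = w v) \<and> (\<forall>i \<beta>. i \<notin> \<beta> \<longrightarrow> c (i, \<beta>) = 0) \<and>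
    (\<forall>\<alpha>. \<alpha> \<noteq> {} \<longrightarrow> \<alpha> \<noteq> UNIV \<longrightarrow> card \<alpha> < k \<longrightarrow> jac c \<alpha> = 0)"
proof (induction k)
  case 0
  interpret ring_relation "\<lambda>p q. p = q \<and> p \<in> S" by (rule S)
  show ?case
    by (rule exI[of _ "\<lambda>v. if v \<in> free_coords then w v else 0"])
      (use w E_zero in \<open>auto simp: free_coords_def\<close>)
next
  case (Suc k)
  interpret ring_relation "\<lambda>p q. p = q \<and> p \<in> S" by (rule S)
  from Suc obtain c where "\<forall>v. c v \<in> S" "\<forall>v\<in>free_coords. c v = w v" "\<forall>i \<beta>. i \<notin> \<beta> \<longrightarrow> c (i, \<beta>) = 0"
      "\<forall>\<alpha>. \<alpha> \<noteq> {} \<longrightarrow> \<alpha> \<noteq> UNIV \<longrightarrow> card \<alpha> < k \<longrightarrow> jac c \<alpha> = 0"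
    by (elim exE conjE)
  note c = this[rule_format]
  define D where "D v \<longleftrightarrow> v \<in> Gamma_coords \<and> card (snd v) = Suc k \<and> fst v \<in> snd v \<and>
    fst v = pick (snd v - {fst v})" for v :: "'n \<times> 'n set"
  \<comment> \<open>The eliminated coordinate enters the equation with coefficient
    \<open>tsign\<close>, which is its own inverse, so this correction changes \<open>jac\<close> by
    exactly minus its value.\<close>
  define d where "d v = (if D v then c v - tsign (fst v) (snd v - {fst v}) * jac c (snd v - {fst v}) else c v)"
    for v
  have jS: "jac c \<alpha> \<in> S" for \<alpha> using E_jac[of c c \<alpha>] c(1) by simp
  have "tsign i \<alpha> \<in> S" for i \<alpha> using E_minus_one_power unfolding tsign_def by blast
  then have tS: "tsign i \<alpha> * jac c \<alpha> \<in> S" for i \<alpha>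
    using E_mult[of "tsign i \<alpha>" "tsign i \<alpha>" "jac c \<alpha>" "jac c \<alpha>"] jS by blast
  have dS: "d v \<in> S" for v
    using E_diff[of "c v" "c v"] c(1) tS unfolding d_def by auto
  have dw: "d v = w v" if "v \<in> free_coords" for v
    using that c(2) by (auto simp: d_def D_def free_coords_def)
  have d0: "d (i, \<beta>) = 0" if "i \<notin> \<beta>" for i \<beta>
    using that c(3) by (auto simp: d_def D_def)
  have "jac d \<alpha> = 0" if \<alpha>: "\<alpha> \<noteq> {}" "\<alpha> \<noteq> UNIV" "card \<alpha> < Suc k" for \<alpha>
  proof (cases "odd (card \<alpha>)")
    case False
    have diff: "jac d \<alpha> - jac c \<alpha> = (\<Sum>i\<in>- \<alpha>. if (i, insert i \<alpha>) \<in> Gamma_coords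
        then tsign i \<alpha> * (d (i, insert i \<alpha>) - c (i, insert i \<alpha>)) else 0)"
      by (rule jac_diff[of k]) (use \<alpha> in \<open>auto simp: d_def D_def\<close>)
    show ?thesis
    proof (cases "card \<alpha> = k")
      case True
      have "(\<Sum>i\<in>- \<alpha>. if (i, insert i \<alpha>) \<in> Gamma_coords
          then tsign i \<alpha> * (d (i, insert i \<alpha>) - c (i, insert i \<alpha>)) else 0) =
          (\<Sum>i\<in>- \<alpha>. if i = pick \<alpha> then - jac c \<alpha> else 0)"
      proof (rule sum.cong)
        fix i assume i: "i \<in> - \<alpha>"
        then have V: "(i, insert i \<alpha>) \<in> Gamma_coords"
          using False \<alpha>(1) by (intro insert_in_Gamma_coords) auto
        have ins: "insert i \<alpha> - {i} = \<alpha>" "card (insert i \<alpha>) = Suc k" using i True by auto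
        show "(if (i, insert i \<alpha>) \<in> Gamma_coords
            then tsign i \<alpha> * (d (i, insert i \<alpha>) - c (i, insert i \<alpha>)) else 0) =
            (if i = pick \<alpha> then - jac c \<alpha> else 0)"
          using V ins i by (cases "i = pick \<alpha>") (auto simp: d_def D_def)
      qed simp
      also have "\<dots> = - jac c \<alpha>" using pick_notin[OF \<alpha>(2)] by (subst sum.delta) auto
      finally show ?thesis using diff by simp
    next
      case neq: False
      have "(\<Sum>i\<in>- \<alpha>. if (i, insert i \<alpha>) \<in> Gamma_coords
          then tsign i \<alpha> * (d (i, insert i \<alpha>) - c (i, insert i \<alpha>)) else 0) = 0"
      proof (intro sum.neutral ballI)
        fix i assume "i \<in> - \<alpha>"
        then have "card (insert i \<alpha>) \<noteq> Suc k" using neq by simp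
        then show "(if (i, insert i \<alpha>) \<in> Gamma_coords
          then tsign i \<alpha> * (d (i, insert i \<alpha>) - c (i, insert i \<alpha>)) else 0) = 0"
          by (simp add: d_def D_def)
      qed
      with diff c(4)[OF \<alpha>(1,2)] \<alpha>(3) neq show ?thesis by simp
    qed
  qed (rule jac_odd)
  then show ?case by (intro exI[of _ d] conjI allI ballI impI dS dw d0)
qed

text \<open>Solving in all degrees leaves the top coefficient, which \<open>gjacobian_eq_one\<close>
  forces to vanish.\<close>

lemma exists_solution:
  fixes w :: "'n::{finite,linorder} \<times> 'n set \<Rightarrow> 'r::comm_ring_1"
  assumes "ring_relation (\<lambda>p q. p = q \<and> p \<in> S)" "\<forall>v\<in>free_coords. w v \<in> S"
  shows "\<exists>c. (\<forall>v. c v \<in> S) \<and> (\<forall>v\<in>free_coords. c v = w v) \<and>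
    principal (gen c) \<and> gjacobian (gsubst (gen c)) = 1"
proof -
  obtain c where "\<forall>v. c v \<in> S" "\<forall>v\<in>free_coords. c v = w v" "\<forall>i \<beta>. i \<notin> \<beta> \<longrightarrow> c (i, \<beta>) = 0"
      "\<forall>\<alpha>. \<alpha> \<noteq> {} \<longrightarrow> \<alpha> \<noteq> UNIV \<longrightarrow> card \<alpha> < Suc (CARD('n)) \<longrightarrow> jac c \<alpha> = 0"
    using exists_solution_upto[of S w "Suc (CARD('n))", OF assms] by (elim exE conjE)
  note c = this[rule_format]
  have pr: "principal (gen c)" using c(3) by (simp add: principal_gen)
  have "card \<alpha> < Suc (CARD('n))" for \<alpha> :: "'n set" by (simp add: card_mono less_Suc_eq_le)
  then have "gjacobian (gsubst (gen c)) = 1"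
    using c(4) by (intro gjacobian_eq_one admissible_gen pr) (simp add: jac_def)
  with pr show ?thesis by (intro exI[of _ c] conjI allI ballI c)
qed

text \<open>Uniqueness of the solution, modulo the ideal, applied to the generic point.\<close>

lemma Var_cong_solution:
  fixes \<rho> :: "'n::{finite,linorder} \<times> 'n set \<Rightarrow> ('n \<times> 'n set, 'k::comm_ring_1) mpoly"
  assumes carr: "\<And>v. v \<in> Gamma_coords \<Longrightarrow> \<rho> v \<in> carrier (poly_ring Gamma_coords)"
    and free: "\<And>v. v \<in> free_coords \<Longrightarrow> \<rho> v = Var v"
    and sol: "principal (gen \<rho>)" "gjacobian (gsubst (gen \<rho>)) = 1"
    and v: "v \<in> Gamma_coords"
  shows "Var v - \<rho> v \<in> Sigma'_ideal"
  using v
proof (induction "card (snd v)" arbitrary: v rule: less_induct)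
  case less
  note I = poly_ideal_closed[OF ideal_Sigma'[where 'a = 'n and 'b = 'k]]
  obtain i \<beta> where v: "v = (i, \<beta>)" by force
  have V: "(i, \<beta>) \<in> Gamma_coords" using less.prems by (simp add: v)
  consider "i \<notin> \<beta>" | "(i, \<beta>) \<in> free_coords" | "i \<in> \<beta>" "i = pick (\<beta> - {i})"
    using V by (auto simp: free_coords_def)
  then show ?case
  proof cases
    case 1
    then have "\<rho> v = 0" using sol(1) V by (auto simp: v principal_gen)
    then show ?thesis using Var_in_ideal[OF V 1] by (simp add: v)
  next
    case 2
    then show ?thesis using I(1) by (simp add: v free)
  next
    case 3
    define \<alpha> where "\<alpha> = \<beta> - {i}"
    have \<beta>: "\<beta> = insert i \<alpha>" and i: "i \<notin> \<alpha>" "i = pick \<alpha>" using 3 by (auto simp: \<alpha>_def)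
    have card: "card \<beta> = Suc (card \<alpha>)" using i by (simp add: \<beta>)
    have \<alpha>: "\<alpha> \<noteq> {}" "even (card \<alpha>)" using V card by (auto simp: Gamma_coords_def)
    \<comment> \<open>A hybrid of solution and generic point. By induction it is congruent to the
      generic point modulo the ideal, which puts \<open>jac d \<alpha>\<close> into the ideal; and
      it agrees with \<rho> up to degree \<open>card \<alpha>\<close>, so \<open>jac_diff\<close>
      compares it with \<rho> exactly.\<close>
    define d where "d u = (if card (snd u) \<le> card \<alpha> then \<rho> u else Var u)" for u
    interpret ring_relation "\<lambda>p q. p \<in> carrier (poly_ring (Gamma_coords :: ('n \<times> 'n set) set)) \<and>
        q \<in> carrier (poly_ring Gamma_coords) \<and> p - q \<in> (Sigma'_ideal :: ('n \<times> 'n set, 'k) mpoly set)"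
      by (rule ring_relation_cong[OF ideal_Sigma'])
    have "jac Var \<alpha> - jac d \<alpha> \<in> Sigma'_ideal"
    proof -
      have Vu: "(Var u :: ('n \<times> 'n set, 'k) mpoly) \<in> carrier (poly_ring Gamma_coords)" if "u \<in> Gamma_coords" for u
        by (rule poly_carrier_closed(7)[OF that])
      have E: "(Var u :: ('n \<times> 'n set, 'k) mpoly) \<in> carrier (poly_ring Gamma_coords) \<and> d u \<in> carrier (poly_ring Gamma_coords) \<and>
          Var u - d u \<in> (Sigma'_ideal :: ('n \<times> 'n set, 'k) mpoly set)" if u: "u \<in> Gamma_coords" for u
        using less.hyps[of u, OF _ u] carr[OF u] I(1) Vu[OF u]
        by (cases "card (snd u) \<le> card \<alpha>") (simp_all add: d_def v card less_Suc_eq_le)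
      show ?thesis by (rule E_jac[of Var d \<alpha>, THEN conjunct2, THEN conjunct2]) (rule E)
    qed
    then have "- (jac Var \<alpha> - jac d \<alpha>) + jac Var \<alpha> \<in> Sigma'_ideal"
      using I(3,4) jac_Var_in_ideal[OF \<alpha>(1)] by blast
    then have jd: "jac d \<alpha> \<in> Sigma'_ideal" by simp
    have "jac d \<alpha> - jac \<rho> \<alpha> = (\<Sum>j\<in>- \<alpha>. if (j, insert j \<alpha>) \<in> Gamma_coords
        then tsign j \<alpha> * (d (j, insert j \<alpha>) - \<rho> (j, insert j \<alpha>)) else 0)"
      by (rule jac_diff[of "card \<alpha>"]) (simp_all add: d_def)
    \<comment> \<open>The other coordinates over \<alpha> are free, where \<rho> is already generic;
      only the eliminated one remains.\<close>
    also have "\<dots> = (\<Sum>j\<in>- \<alpha>. if j = i then tsign i \<alpha> * (Var (i, \<beta>) - \<rho> (i, \<beta>)) else 0)"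
    proof (rule sum.cong)
      fix j assume j: "j \<in> - \<alpha>"
      have V': "(j, insert j \<alpha>) \<in> Gamma_coords" using j \<alpha> by (intro insert_in_Gamma_coords) auto
      have d: "d (j, insert j \<alpha>) = Var (j, insert j \<alpha>)" using j by (simp add: d_def)
      show "(if (j, insert j \<alpha>) \<in> Gamma_coords then tsign j \<alpha> * (d (j, insert j \<alpha>) - \<rho> (j, insert j \<alpha>)) else 0) =
          (if j = i then tsign i \<alpha> * (Var (i, \<beta>) - \<rho> (i, \<beta>)) else 0)"
      proof (cases "j = i")
        case False
        then have "(j, insert j \<alpha>) \<in> free_coords" using V' j i by (auto simp: free_coords_def)
        then show ?thesis using False by (simp add: d free)
      qed (use V' d in \<open>simp add: \<beta>\<close>)
    qed simp
    also have "\<dots> = tsign i \<alpha> * (Var (i, \<beta>) - \<rho> (i, \<beta>))" using i by (subst sum.delta) auto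
    also have "jac \<rho> \<alpha> = 0" using \<alpha>(1) by (simp add: jac_def sol(2) gcoeff_simps)
    finally have "tsign i \<alpha> * jac d \<alpha> = Var (i, \<beta>) - \<rho> (i, \<beta>)" by simp
    moreover have "tsign i \<alpha> \<in> (carrier (poly_ring Gamma_coords) :: ('n \<times> 'n set, 'k) mpoly set)"
      using E_minus_one_power unfolding tsign_def by blast
    ultimately show ?thesis using I(5)[OF jd] by (metis v)
  qed
qed

text \<open>\<theta> evaluates at a solution over the polynomial ring in the free coordinates, and
  \<iota> includes that ring back into the coordinate ring. Then \<theta> after \<iota> is the
  identity, while \<iota> after \<theta> is the identity modulo the ideal by uniqueness. So \<theta>
  is onto with kernel the ideal.\<close>

lemma is_affine_Sigma':
  "is_affine_of_dim Gamma_coords (Sigma'_ideal :: ('n::{finite,linorder} \<times> 'n set, 'k::comm_ring_1) mpoly set)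
    (card (free_coords :: ('n \<times> 'n set) set))"
proof -
  let ?V = "Gamma_coords :: ('n \<times> 'n set) set" and ?W = "free_coords :: ('n \<times> 'n set) set"
  let ?I = "Sigma'_ideal :: ('n \<times> 'n set, 'k) mpoly set"
  let ?d = "card ?W"
  let ?P = "poly_ring {..<?d} :: (nat, 'k) mpoly ring" and ?K = "poly_ring ?V :: ('n \<times> 'n set, 'k) mpoly ring"
  note Ch = is_ring_hom_Const
  obtain e where e: "bij_betw e ?W {..<?d}"
    using ex_bij_betw_finite_nat[of ?W] by (auto simp: atLeast0LessThan)
  obtain \<rho>' :: "'n \<times> 'n set \<Rightarrow> (nat, 'k) mpoly" where \<rho>': "\<And>v. \<rho>' v \<in> carrier ?P"
      "\<And>v. v \<in> ?W \<Longrightarrow> \<rho>' v = Var (e v)" "principal (gen \<rho>')" "gjacobian (gsubst (gen \<rho>')) = 1"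
  proof -
    have "\<forall>v\<in>?W. (Var (e v) :: (nat, 'k) mpoly) \<in> carrier ?P"
      using bij_betwE[OF e] poly_carrier_closed(7)[of _ "{..<?d}"] by blast
    from exists_solution[OF ring_relation_carrier this] show ?thesis by (elim exE conjE) (rule that, auto)
  qed
  define \<theta> where "\<theta> = poly_eval (Const :: 'k \<Rightarrow> _) \<rho>'"
  define \<iota> where "\<iota> = poly_eval (Const :: 'k \<Rightarrow> _) (\<lambda>t. Var (inv_into ?W e t))"
  have \<theta>h: "is_ring_hom \<theta>" and \<iota>h: "is_ring_hom \<iota>"
    unfolding \<theta>_def \<iota>_def by (rule is_ring_hom_poly_eval[OF Ch])+
  have WV: "?W \<subseteq> ?V" by (auto simp: free_coords_def)
  have inv: "inv_into ?W e t \<in> ?W" "e (inv_into ?W e t) = t" if "t < ?d" for t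
    using that bij_betw_imp_surj_on[OF e] inv_into_into[of t e ?W] f_inv_into_f[of t e ?W] by auto
  have inv': "inv_into ?W e (e v) = v" if "v \<in> ?W" for v
    using bij_betw_imp_inj_on[OF e] that by (rule inv_into_f_f)
  have \<theta>c: "\<theta> p \<in> carrier ?P" for p
    unfolding \<theta>_def by (rule poly_eval_carrier) (auto intro: poly_carrier_closed \<rho>')
  have \<iota>c: "\<iota> q \<in> carrier ?K" if "q \<in> carrier ?P" for q
    unfolding \<iota>_def by (rule poly_eval_carrier)
      (use that inv(1) WV in \<open>auto simp: poly_ring_simps(1) poly_vars_Const poly_vars_Var\<close>)
  \<comment> \<open>The solution carried back along \<iota>: its free coordinates are their own
    variables, so \<open>Var_cong_solution\<close> compares it with the generic point.\<close>
  define \<rho> where "\<rho> v = \<iota> (\<rho>' v)" for v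
  have diff: "Var v - \<rho> v \<in> ?I" if "v \<in> ?V" for v
  proof (rule Var_cong_solution)
    interpret ring_relation "\<lambda>a b. b = \<iota> a" by (rule ring_relation_hom[OF \<iota>h])
    have g: "grel (gen \<rho>' i) (gen \<rho> i)" for i by (rule grel_gen) (simp add: \<rho>_def)
    show "\<rho> v \<in> carrier ?K" for v unfolding \<rho>_def by (rule \<iota>c[OF \<rho>'(1)])
    show "\<rho> v = Var v" if "v \<in> ?W" for v
      using that by (simp add: \<rho>_def \<rho>' \<iota>_def poly_eval_Var[OF Ch] inv')
    show "principal (gen \<rho>)"
      using \<rho>'(3) is_ring_hom_zero[OF \<iota>h] by (simp add: principal_gen \<rho>_def)
    show "gjacobian (gsubst (gen \<rho>)) = 1"
    proof (rule grassmann_eqI)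
      fix \<alpha>
      show "gcoeff (gjacobian (gsubst (gen \<rho>))) \<alpha> = gcoeff 1 \<alpha>"
        using grelD[OF grel_gjacobian[of "gen \<rho>'" "gen \<rho>", OF g], of \<alpha>]
          \<iota>h is_ring_hom_zero[OF \<iota>h]
        by (simp add: \<rho>'(4) one_grassmann.rep_eq is_ring_hom_def)
    qed
  qed (rule that)
  have cong: "p - \<iota> (\<theta> p) \<in> ?I" if p: "p \<in> carrier ?K" for p
  proof -
    have 1: "\<iota> (\<theta> p) = poly_eval Const \<rho> p"
    proof -
      interpret ring_relation "\<lambda>a b. b = \<iota> a" by (rule ring_relation_hom[OF \<iota>h])
      show ?thesis unfolding \<theta>_def
        using E_poly_eval[where \<phi> = Const and \<psi> = Const and c = \<rho>' and d = \<rho> and p = p]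
        by (simp add: \<rho>_def \<iota>_def poly_eval_Const[OF Ch])
    qed
    interpret ring_relation "\<lambda>p q. p \<in> carrier ?K \<and> q \<in> carrier ?K \<and> p - q \<in> ?I"
      by (rule ring_relation_cong[OF ideal_Sigma'])
    have "Var v \<in> carrier ?K \<and> \<rho> v \<in> carrier ?K \<and> Var v - \<rho> v \<in> ?I" if "v \<in> poly_vars p" for v
    proof -
      have v: "v \<in> ?V" using that p by (auto simp: poly_ring_simps(1))
      show ?thesis unfolding \<rho>_def
        by (intro conjI poly_carrier_closed(7)[OF v] \<iota>c \<rho>'(1) diff[OF v, unfolded \<rho>_def])
    qed
    from E_poly_eval[where \<phi> = Const and \<psi> = Const and c = Var and d = \<rho> and p = p, OF _ this]
    show ?thesis using poly_ideal_closed(1)[OF ideal_Sigma'] poly_carrier_closed(6)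
      by (auto simp: 1 poly_eval_Const_Var)
  qed
  have \<theta>\<iota>: "\<theta> (\<iota> q) = q" if q: "q \<in> carrier ?P" for q
  proof -
    interpret ring_relation "\<lambda>a b. b = \<theta> a" by (rule ring_relation_hom[OF \<theta>h])
    have "Var t = \<theta> (Var (inv_into ?W e t))" if "t \<in> poly_vars q" for t
    proof -
      have "t < ?d" using that q by (auto simp: poly_ring_simps(1))
      then show ?thesis using inv by (simp add: \<theta>_def poly_eval_Var[OF Ch] \<rho>')
    qed
    from E_poly_eval[where \<phi> = Const and \<psi> = Const and c = "\<lambda>t. Var (inv_into ?W e t)" and d = Var and p = q, OF _ this]
    show ?thesis by (simp add: \<iota>_def poly_eval_Const_Var) (simp add: \<theta>_def poly_eval_Const[OF Ch])
  qed
  have kills: "\<theta> p = 0" if "p \<in> ?I" for p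
    using Sigma'_ideal_zeros[OF Ch, of \<rho>'] \<rho>'(3,4) that by (auto simp: \<theta>_def)
  \<comment> \<open>If \<theta> p = 0 then \<open>cong\<close> reads p - 0; conversely \<theta>
    kills the ideal since it evaluates at a solution.\<close>
  have kernel: "a_kernel ?K ?P \<theta> = ?I"
  proof (intro equalityI subsetI)
    fix p assume "p \<in> a_kernel ?K ?P \<theta>"
    then have "p \<in> carrier ?K" "\<theta> p = 0" by (auto simp: a_kernel_def' poly_ring_simps)
    then show "p \<in> ?I" using cong[of p] is_ring_hom_zero[OF \<iota>h] by simp
  next
    fix p assume "p \<in> ?I"
    then show "p \<in> a_kernel ?K ?P \<theta>"
      using kills poly_ideal_closed(2)[OF ideal_Sigma'] by (auto simp: a_kernel_def' poly_ring_simps(5))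
  qed
  have "\<theta> \<in> ring_hom ?K ?P"
    by (rule ring_hom_memI) (use \<theta>h \<theta>c in \<open>auto simp: poly_ring_simps(2-) is_ring_hom_def\<close>)
  then interpret \<theta>: ring_hom_ring ?K ?P \<theta>
    by (intro ring_hom_ringI2 cring.axioms(1) cring_poly_ring)
  have "\<theta> ` carrier ?K = carrier ?P"
    using \<theta>c \<theta>\<iota> \<iota>c by (auto simp: image_iff) metis
  from \<theta>.FactRing_iso_set[OF this] have iso: "(\<lambda>Y. the_elem (\<theta> ` Y)) \<in> ring_iso (?K Quot ?I) ?P"
    by (simp add: kernel)
  have elem: "the_elem (\<theta> ` (?I +>\<^bsub>?K\<^esub> Const a)) = Const a" for a
    using \<theta>.the_elem_simp[OF poly_carrier_closed(6)[of a], unfolded kernel]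
    by (simp add: \<theta>_def poly_eval_Const[OF Ch])
  show ?thesis unfolding is_affine_of_dim_def by (rule bexI[OF _ iso]) (simp add: elem)
qed

section \<open>The dimension\<close>

text \<open>A free coordinate is an even \<alpha>, neither empty nor full, together with an index
  outside \<alpha> other than \<open>pick \<alpha>\<close>.\<close>

lemma card_free_coords:
  "card (free_coords :: ('n::{finite,linorder} \<times> 'n set) set) =
    (\<Sum>s = 1..(CARD('n) - 1) div 2. (CARD('n) choose (2 * s)) * (CARD('n) - 2 * s - 1))"
proof -
  let ?S = "{1..(CARD('n) - 1) div 2}"
  define C where "C k = {\<alpha> :: 'n set. card \<alpha> = k}" for k
  have C: "card (C k) = CARD('n) choose k" for k
    using n_subsets[of "UNIV :: 'n set" k] by (simp add: C_def)
  \<comment> \<open>The bound on s excludes the full set when n is even, where there is no index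
    left to pick.\<close>
  define A where "A = (\<Union>s\<in>?S. C (2 * s))"
  have A: "\<alpha> \<in> A \<longleftrightarrow> even (card \<alpha>) \<and> \<alpha> \<noteq> {} \<and> \<alpha> \<noteq> UNIV" for \<alpha>
  proof
    assume "\<alpha> \<in> A"
    then obtain s where s: "1 \<le> s" "s \<le> (CARD('n) - 1) div 2" "card \<alpha> = 2 * s"
      by (auto simp: A_def C_def)
    then show "even (card \<alpha>) \<and> \<alpha> \<noteq> {} \<and> \<alpha> \<noteq> UNIV" by auto
  next
    assume \<alpha>: "even (card \<alpha>) \<and> \<alpha> \<noteq> {} \<and> \<alpha> \<noteq> UNIV"
    then have "card \<alpha> < CARD('n)" by (intro psubset_card_mono) auto
    moreover have "card \<alpha> \<noteq> 0" using \<alpha> by simp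
    moreover have "card \<alpha> = 2 * (card \<alpha> div 2)" using \<alpha> by simp
    ultimately have "1 \<le> card \<alpha> div 2" "card \<alpha> \<le> CARD('n) - 1" by linarith+
    then have "card \<alpha> div 2 \<in> ?S" using div_le_mono[of "card \<alpha>" "CARD('n) - 1" 2] by simp
    then show "\<alpha> \<in> A" using \<alpha> unfolding A_def C_def by (intro UN_I) auto
  qed
  let ?f = "\<lambda>(\<alpha>, i). (i, insert i \<alpha>)"
  have eq: "free_coords = ?f ` Sigma A (\<lambda>\<alpha>. - \<alpha> - {pick \<alpha>})"
  proof (intro equalityI subsetI)
    fix v :: "'n \<times> 'n set" assume v: "v \<in> free_coords"
    obtain i \<beta> where [simp]: "v = (i, \<beta>)" by force
    have \<beta>: "i \<in> \<beta>" "i \<noteq> pick (\<beta> - {i})" "odd (card \<beta>)" "3 \<le> card \<beta>"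
      using v by (auto simp: free_coords_def Gamma_coords_def)
    have card: "card \<beta> = Suc (card (\<beta> - {i}))" using \<beta>(1) by (metis card_Suc_Diff1 finite)
    have "card (\<beta> - {i}) \<noteq> 0" using \<beta>(4) card by linarith
    then have "\<beta> - {i} \<noteq> {}" by force
    moreover have "even (card (\<beta> - {i}))" using \<beta>(3) card by simp
    moreover have "\<beta> - {i} \<noteq> UNIV" by blast
    ultimately have "\<beta> - {i} \<in> A" unfolding A by blast
    then show "v \<in> ?f ` Sigma A (\<lambda>\<alpha>. - \<alpha> - {pick \<alpha>})"
      using \<beta> by (intro image_eqI[of _ _ "(\<beta> - {i}, i)"]) auto
  next
    fix v :: "'n \<times> 'n set" assume "v \<in> ?f ` Sigma A (\<lambda>\<alpha>. - \<alpha> - {pick \<alpha>})"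
    then obtain \<alpha> i where v: "v = (i, insert i \<alpha>)" "\<alpha> \<in> A" "i \<notin> \<alpha>" "i \<noteq> pick \<alpha>" by auto
    then show "v \<in> free_coords"
      using insert_in_Gamma_coords[of \<alpha> i] by (auto simp: A free_coords_def)
  qed
  have inj: "inj_on ?f (Sigma A (\<lambda>\<alpha>. - \<alpha> - {pick \<alpha>}))"
    by (rule inj_onI) (auto dest: insert_ident)
  have "card (free_coords :: ('n \<times> 'n set) set) = card (Sigma A (\<lambda>\<alpha>. - \<alpha> - {pick \<alpha>}))"
    unfolding eq by (rule card_image[OF inj])
  also have "\<dots> = (\<Sum>\<alpha>\<in>A. card (- \<alpha> - {pick \<alpha>}))" by (rule card_SigmaI) auto
  also have "\<dots> = (\<Sum>\<alpha>\<in>A. CARD('n) - card \<alpha> - 1)"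
  proof (rule sum.cong)
    fix \<alpha> assume "\<alpha> \<in> A"
    then have "pick \<alpha> \<in> - \<alpha>" using pick_notin[of \<alpha>] by (auto simp: A)
    then show "card (- \<alpha> - {pick \<alpha>}) = CARD('n) - card \<alpha> - 1"
      by (simp add: card_Diff_singleton Compl_eq_Diff_UNIV card_Diff_subset)
  qed simp
  also have "\<dots> = (\<Sum>s\<in>?S. \<Sum>\<alpha>\<in>C (2 * s). CARD('n) - card \<alpha> - 1)"
    unfolding A_def by (rule sum.UNION_disjoint) (auto simp: C_def)
  also have "\<dots> = (\<Sum>s\<in>?S. \<Sum>\<alpha>\<in>C (2 * s). CARD('n) - 2 * s - 1)"
    by (intro sum.cong) (auto simp: C_def)
  also have "\<dots> = (\<Sum>s\<in>?S. (CARD('n) choose (2 * s)) * (CARD('n) - 2 * s - 1))" by (simp add: C)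
  finally show ?thesis .
qed

section \<open>Binomial sums\<close>

lemma int_choose_absorb:
  assumes "k < n"
  shows "(int n - int k - 1) * int (n choose k) = int n * int ((n - 1) choose k) - int (n choose k)"
proof -
  have "int ((n - k) * (n choose k)) = int (n * ((n - 1) choose k))" by (simp only: binomial_absorb_comp)
  then have "(int n - int k) * int (n choose k) = int n * int ((n - 1) choose k)"
    using assms by (simp add: of_nat_diff)
  then show ?thesis by (simp add: algebra_simps)
qed

lemma sum_even_indices:
  fixes g :: "nat \<Rightarrow> int"
  shows "(\<Sum>i\<le>m. if even i then g i else 0) = g 0 + (\<Sum>s = 1..m div 2. g (2 * s))"
proof -
  have "(\<Sum>i\<le>m. if even i then g i else 0) = (\<Sum>i\<in>{i. i \<le> m \<and> even i}. g i)"
    by (rule sum.mono_neutral_cong_right) auto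
  also have "{i. i \<le> m \<and> even i} = (\<lambda>s. 2 * s) ` {0..m div 2}" by (auto elim!: evenE)
  also have "(\<Sum>i\<in>(\<lambda>s. 2 * s) ` {0..m div 2}. g i) = (\<Sum>s = 0..m div 2. g (2 * s))"
    by (subst sum.reindex) (auto simp: inj_on_def)
  also have "\<dots> = g 0 + (\<Sum>s = 1..m div 2. g (2 * s))" by (simp add: sum.atLeast_Suc_atMost)
  finally show ?thesis .
qed

text \<open>Subsets of even size are half of all subsets; the empty one, s = 0, is taken
  off.\<close>

lemma sum_choose_even:
  assumes "0 < n"
  shows "(\<Sum>s = 1..n div 2. int (n choose (2 * s))) = 2 ^ (n - 1) - 1"
proof -
  obtain m where n: "n = Suc m" using assms by (cases n) auto
  have "2 * (\<Sum>i\<le>n. if even i then of_nat (n choose i) else 0) = (2 ^ n :: int)"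
    by (rule choose_even_sum[OF assms])
  then have "2 * (1 + (\<Sum>s = 1..n div 2. int (n choose (2 * s)))) = 2 ^ n"
    unfolding sum_even_indices by simp
  also have "\<dots> = 2 * 2 ^ (n - 1)" by (simp add: n)
  finally have "1 + (\<Sum>s = 1..n div 2. int (n choose (2 * s))) = 2 ^ (n - 1)"
    by (simp only: mult_cancel_left) simp
  then show ?thesis by (simp add: algebra_simps)
qed

lemma dimension_closed_form:
  assumes "2 \<le> n"
  shows "(\<Sum>s = 1..(n - 1) div 2. int n * int ((n - 1) choose (2 * s)) - int (n choose (2 * s))) =
    (if even n then (int n - 2) * 2 ^ (n - 2) - int n + 2 else (int n - 2) * 2 ^ (n - 2) - int n + 1)"
proof -
  obtain m where n: "n = Suc (Suc m)" using assms by (metis add_2_eq_Suc le_Suc_ex)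
  have 1: "(\<Sum>s = 1..(n - 1) div 2. int ((n - 1) choose (2 * s))) = 2 ^ m - 1"
    using sum_choose_even[of "n - 1"] by (simp add: n)
  \<comment> \<open>For even n the range stops short of s = n/2, so n choose n = 1 is missing as
    well.\<close>
  have 2: "(\<Sum>s = 1..(n - 1) div 2. int (n choose (2 * s))) = 2 * 2 ^ m - (if even n then 2 else 1)"
  proof (cases "even n")
    case True
    then have "n div 2 = Suc ((n - 1) div 2)" "2 * Suc ((n - 1) div 2) = n" by (auto simp: n elim!: evenE)
    then show ?thesis using sum_choose_even[of n] True by (simp add: n)
  next
    case False
    then have "n div 2 = (n - 1) div 2" by (auto elim!: oddE)
    then show ?thesis using sum_choose_even[of n] False by (simp add: n)
  qed
  show ?thesis
    unfolding sum_subtractf sum_distrib_left[symmetric] 1 2 by (simp add: n algebra_simps)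
qed

theorem corollary5p6:
  fixes n :: nat
  assumes n_def: "n = card (UNIV :: 'n::{finite,linorder} set)" and n4: "n \<ge> 4"
  shows
    \<comment> \<open>for every commutative \<open>K\<close>-algebra \<open>R\<close>, \<open>\<Sigma>'(R)\<close> is a group, and the coordinates identify it
        with the set of \<open>R\<close>-valued zeros of the ideal \<open>Sigma'_ideal\<close> of \<open>K[\<Gamma>]\<close>, the group law
        being given by the polynomials \<open>Gamma_comult\<close>\<close>
    "(\<forall>\<phi> :: 'k::comm_ring_1 \<Rightarrow> 'r::comm_ring_1.
        \<phi> \<in> ring_hom ring_of_type_algebra ring_of_type_algebra \<longrightarrow>
        subgroup (Sigma'_group :: (('n, 'r) grassmann \<Rightarrow> ('n, 'r) grassmann) set) (BijGroup UNIV) \<and>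
        bij_betw (\<lambda>\<sigma>. restrict (gcoord \<sigma>) Gamma_coords)
          (Sigma'_group :: (('n, 'r) grassmann \<Rightarrow> ('n, 'r) grassmann) set)
          {c \<in> Gamma_coords \<rightarrow>\<^sub>E UNIV. \<forall>p \<in> Sigma'_ideal. poly_eval \<phi> c p = 0} \<and>
        (\<forall>\<sigma> \<in> Sigma'_group. \<forall>\<tau> \<in> Sigma'_group. \<forall>v \<in> Gamma_coords.
          gcoord (\<sigma> \<circ> \<tau> :: ('n, 'r) grassmann \<Rightarrow> ('n, 'r) grassmann) v =
            poly_eval \<phi> (case_sum (gcoord \<sigma>) (gcoord \<tau>)) (Gamma_comult v))) \<and>
     is_unipotent_group Gamma_coords (Sigma'_ideal :: ('n \<times> 'n set, 'k) mpoly set) Gamma_comult \<and>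
     (\<exists>d :: nat.
        is_affine_of_dim Gamma_coords (Sigma'_ideal :: ('n \<times> 'n set, 'k) mpoly set) d \<and>
        int d = (\<Sum>s = 1..(n - 1) div 2. int n * int ((n - 1) choose (2 * s)) - int (n choose (2 * s))) \<and>
        int d = (\<Sum>s = 1..(n - 1) div 2. (int n - 2 * int s - 1) * int (n choose (2 * s))) \<and>
        int d = (if even n then (int n - 2) * 2 ^ (n - 2) - int n + 2
                 else (int n - 2) * 2 ^ (n - 2) - int n + 1))"
proof (intro conjI allI impI)
  fix \<phi> :: "'k \<Rightarrow> 'r"
  assume "\<phi> \<in> ring_hom ring_of_type_algebra ring_of_type_algebra"
  then have \<phi>: "is_ring_hom \<phi>" by (simp add: is_ring_hom_iff)
  show "subgroup (Sigma'_group :: (('n, 'r) grassmann \<Rightarrow> ('n, 'r) grassmann) set) (BijGroup UNIV)"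
    by (rule subgroup_Sigma')
  show "bij_betw (\<lambda>\<sigma>. restrict (gcoord \<sigma>) Gamma_coords)
      (Sigma'_group :: (('n, 'r) grassmann \<Rightarrow> ('n, 'r) grassmann) set)
      {c \<in> Gamma_coords \<rightarrow>\<^sub>E UNIV. \<forall>p \<in> Sigma'_ideal. poly_eval \<phi> c p = 0}"
    by (rule bij_betw_coordinates[OF \<phi>])
  show "\<forall>\<sigma> \<in> Sigma'_group. \<forall>\<tau> \<in> Sigma'_group. \<forall>v \<in> Gamma_coords.
      gcoord (\<sigma> \<circ> \<tau> :: ('n, 'r) grassmann \<Rightarrow> ('n, 'r) grassmann) v =
        poly_eval \<phi> (case_sum (gcoord \<sigma>) (gcoord \<tau>)) (Gamma_comult v)"
    by (intro ballI gcoord_comp[OF \<phi>])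
next
  show "is_unipotent_group Gamma_coords (Sigma'_ideal :: ('n \<times> 'n set, 'k) mpoly set) Gamma_comult"
    by (rule is_unipotent_Sigma')
next
  let ?d = "card (free_coords :: ('n \<times> 'n set) set)"
  have "int ?d = (\<Sum>s = 1..(n - 1) div 2. int (n choose (2 * s)) * int (n - 2 * s - 1))"
    by (simp add: card_free_coords n_def)
  also have "\<dots> = (\<Sum>s = 1..(n - 1) div 2. (int n - 2 * int s - 1) * int (n choose (2 * s)))"
    \<comment> \<open>On this range 2s + 1 \<le> n, so the truncated subtraction is exact.\<close>
    by (rule sum.cong) (auto simp: of_nat_diff)
  finally have 2: "int ?d = (\<Sum>s = 1..(n - 1) div 2. (int n - 2 * int s - 1) * int (n choose (2 * s)))" .
  also have "\<dots> = (\<Sum>s = 1..(n - 1) div 2. int n * int ((n - 1) choose (2 * s)) - int (n choose (2 * s)))"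
  proof (rule sum.cong)
    fix s assume "s \<in> {1..(n - 1) div 2}"
    then have "2 * s < n" using n4 by auto
    from int_choose_absorb[OF this]
    show "(int n - 2 * int s - 1) * int (n choose (2 * s)) =
        int n * int ((n - 1) choose (2 * s)) - int (n choose (2 * s))" by simp
  qed simp
  finally have 1: "int ?d = (\<Sum>s = 1..(n - 1) div 2.
      int n * int ((n - 1) choose (2 * s)) - int (n choose (2 * s)))" .
  also have "\<dots> = (if even n then (int n - 2) * 2 ^ (n - 2) - int n + 2
      else (int n - 2) * 2 ^ (n - 2) - int n + 1)"
    using n4 by (intro dimension_closed_form) simp
  finally show "\<exists>d. is_affine_of_dim Gamma_coords (Sigma'_ideal :: ('n \<times> 'n set, 'k) mpoly set) d \<and>
      int d = (\<Sum>s = 1..(n - 1) div 2. int n * int ((n - 1) choose (2 * s)) - int (n choose (2 * s))) \<and>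
      int d = (\<Sum>s = 1..(n - 1) div 2. (int n - 2 * int s - 1) * int (n choose (2 * s))) \<and>
      int d = (if even n then (int n - 2) * 2 ^ (n - 2) - int n + 2
               else (int n - 2) * 2 ^ (n - 2) - int n + 1)"
    using is_affine_Sigma' 1 2 by blast
qed

end
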